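(* In linear time, one can transform any instance $I=(G,w)$ of \textsc{Min-Power Symmetric Connectivity} with feedback edge number $g$ into an instance $I'=(G',w')$ and compute a value $d\in\mathbb{N}$ such that $G'$ has at most $40g-26$ vertices, $41g-27$ edges, and $\mathrm{opt}(I)=\mathrm{opt}(I')+d$.
   Context: \textsc{Min-Power Symmetric Connectivity} (MinPSC): given a connected undirected graph $G=(V,E)$ with $n$ vertices, $m$ edges and edge weights $w\colon E\to\mathbb{N}$, find a connected spanning subgraph $T=(V,F)$ of $G$ minimizing $\sum_{v\in V}\max_{\{u,v\}\in F} w(\{u,v\})$. For an instance $I$, $\mathrm{opt}(I)$ denotes the minimum cost of a solution. The feedback edge number of a graph is the minimum number of edges whose deletion turns it into a forest (tree).
   Formalization: The bounds 40g-26 and 41g-27 are claimed only for feedback edge number g ≥ 1, since for trees (g = 0) they are negative and no graph can meet them; the linear-time transformation and opt(I) = opt(I') + d are still claimed for every instance. *)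

theory Defs
  imports Main
begin

section \<open>Min-Power Symmetric Connectivity\<close>

text \<open>Finite simple graphs are given by a vertex set and a set of two-element edges; the values
  of a weight function outside the edge set are irrelevant.\<close>

definition simple_graph :: "'a set \<Rightarrow> 'a set set \<Rightarrow> bool" where
  "simple_graph V E \<longleftrightarrow> finite V \<and> (\<forall>e\<in>E. e \<subseteq> V \<and> card e = 2)"

definition connected_graph :: "'a set \<Rightarrow> 'a set set \<Rightarrow> bool" where
  "connected_graph V E \<longleftrightarrow> V \<noteq> {} \<and> (\<forall>u\<in>V. \<forall>v\<in>V. (u, v) \<in> {(x, y). {x, y} \<in> E}\<^sup>*)"

definition minpsc_graph :: "'a set \<Rightarrow> 'a set set \<Rightarrow> bool" where
  "minpsc_graph V E \<longleftrightarrow> simple_graph V E \<and> connected_graph V E"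

text \<open>The inserted \<open>0\<close> only matters for a vertex without incident edge, which in a connected
  graph occurs only if there is a single vertex.\<close>

definition power_cost :: "'a set \<Rightarrow> ('a set \<Rightarrow> nat) \<Rightarrow> 'a set set \<Rightarrow> nat" where
  "power_cost V w F = (\<Sum>v\<in>V. Max (insert 0 {w {u, v} | u. {u, v} \<in> F}))"

definition opt :: "'a set \<Rightarrow> 'a set set \<Rightarrow> ('a set \<Rightarrow> nat) \<Rightarrow> nat" where
  "opt V E w = Min (power_cost V w ` {F. F \<subseteq> E \<and> connected_graph V F})"

definition is_cycle :: "'a set set \<Rightarrow> 'a list \<Rightarrow> bool" where
  "is_cycle E vs \<longleftrightarrow> length vs \<ge> 3 \<and> distinct vs \<and>
     (\<forall>i<length vs. {vs ! i, vs ! (Suc i mod length vs)} \<in> E)"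

definition forest :: "'a set set \<Rightarrow> bool" where
  "forest E \<longleftrightarrow> (\<nexists>vs. is_cycle E vs)"

definition feedback_edge_number :: "'a set set \<Rightarrow> nat" where
  "feedback_edge_number E = Min (card ` {S. S \<subseteq> E \<and> forest (E - S)})"


section \<open>Random access machine programs and their running time\<close>

text \<open>Structured programs for a random access machine whose memory consists of unbounded,
  initially zero arrays of natural numbers, addressed by name (a program mentions only finitely
  many). A scalar variable is cell \<open>0\<close> of an array. Addition, truncated subtraction, comparison and
  indirect memory access are the only operations.\<close>

type_synonym name = string
type_synonym state = "name \<Rightarrow> nat \<Rightarrow> nat"

datatype aexp = Const nat | Cell name aexp | Plus aexp aexp | Minus aexp aexp

datatype bexp = Less aexp aexp | Neg bexp | Conj bexp bexp

datatype com = Skip | Store name aexp aexp | Seq com com | Cond bexp com com | While bexp com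

fun aval :: "aexp \<Rightarrow> state \<Rightarrow> nat" where
  "aval (Const k) s = k"
| "aval (Cell x a) s = s x (aval a s)"
| "aval (Plus a b) s = aval a s + aval b s"
| "aval (Minus a b) s = aval a s - aval b s"

fun bval :: "bexp \<Rightarrow> state \<Rightarrow> bool" where
  "bval (Less a b) s \<longleftrightarrow> aval a s < aval b s"
| "bval (Neg b) s \<longleftrightarrow> \<not> bval b s"
| "bval (Conj b b') s \<longleftrightarrow> bval b s \<and> bval b' s"

text \<open>\<open>exec c s t s'\<close>: program \<open>c\<close> started in state \<open>s\<close> halts after \<open>t\<close> steps in state \<open>s'\<close>. One
  step is charged per executed command and per evaluated test. The expressions in a fixed program
  have bounded size, so this is the uniform cost measure up to a factor depending only on the
  program.\<close>

inductive exec :: "com \<Rightarrow> state \<Rightarrow> nat \<Rightarrow> state \<Rightarrow> bool" where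
  Skip: "exec Skip s 1 s"
| Store: "exec (Store x a b) s 1 (s(x := (s x)(aval a s := aval b s)))"
| Seq: "exec c s t s' \<Longrightarrow> exec c' s' t' s'' \<Longrightarrow> exec (Seq c c') s (t + t') s''"
| CondTrue: "bval b s \<Longrightarrow> exec c s t s' \<Longrightarrow> exec (Cond b c c') s (Suc t) s'"
| CondFalse: "\<not> bval b s \<Longrightarrow> exec c' s t s' \<Longrightarrow> exec (Cond b c c') s (Suc t) s'"
| WhileFalse: "\<not> bval b s \<Longrightarrow> exec (While b c) s 1 s"
| WhileTrue: "bval b s \<Longrightarrow> exec c s t s' \<Longrightarrow> exec (While b c) s' t' s'' \<Longrightarrow>
    exec (While b c) s (Suc (t + t')) s''"

lemma exec_deterministic:
  assumes "exec c s t s'" and "exec c s u s''"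
  shows "t = u \<and> s' = s''"
  using assms
proof (induction arbitrary: u s'' rule: exec.induct)
  case (Skip s) then show ?case by (auto elim: exec.cases)
next
  case (Store x a b s) then show ?case by (auto elim: exec.cases)
next
  case (Seq c s t s' c' t' s'')
  from Seq.prems show ?case by (cases rule: exec.cases) (use Seq.IH in blast)+
next
  case (CondTrue b s c t s' c')
  from CondTrue.prems show ?case
    by (cases rule: exec.cases) (use CondTrue in blast)+
next
  case (CondFalse b s c' t s' c)
  from CondFalse.prems show ?case
    by (cases rule: exec.cases) (use CondFalse in blast)+
next
  case (WhileFalse b s c)
  from WhileFalse.prems show ?case
    by (cases rule: exec.cases) (use WhileFalse in blast)+
next
  case (WhileTrue b s c t s' t' s'')
  from WhileTrue.prems show ?case
    by (cases rule: exec.cases) (use WhileTrue in blast)+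
qed


section \<open>Instances in memory\<close>

text \<open>The vertices are \<open>0, \<dots>, n - 1\<close>, and the edges are listed once each, in arbitrary order and
  orientation.\<close>

definition stores_instance :: "state \<Rightarrow> nat set \<Rightarrow> nat set set \<Rightarrow> (nat set \<Rightarrow> nat) \<Rightarrow> bool" where
  "stores_instance s V E w \<longleftrightarrow>
     V = {..<s ''n'' 0} \<and>
     bij_betw (\<lambda>i. {s ''tail'' i, s ''head'' i}) {..<s ''m'' 0} E \<and>
     (\<forall>i<s ''m'' 0. w {s ''tail'' i, s ''head'' i} = s ''weight'' i)"

definition initial_state :: "state \<Rightarrow> nat set \<Rightarrow> nat set set \<Rightarrow> (nat set \<Rightarrow> nat) \<Rightarrow> bool" where
  "initial_state s V E w \<longleftrightarrow>
     stores_instance s V E w \<and>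
     (\<forall>x i. s x i \<noteq> 0 \<longrightarrow>
        x \<in> {''n'', ''m''} \<and> i = 0 \<or> x \<in> {''tail'', ''head'', ''weight''} \<and> i < s ''m'' 0)"

end

theory Submission
  imports Defs
begin

text \<open>
  We work with the more general problem in which every vertex \<open>v\<close> has a lower bound \<open>l v\<close> on what it
  pays, together with a constant \<open>d\<close> that is added to the cost.

  The edge at a vertex of degree one belongs to every solution. So the vertex can be deleted: what it
  pays goes into \<open>d\<close>, and the weight of its edge into the lower bound of its neighbour. What
  remains has minimum degree two, unless it is a single vertex.

  On a path whose inner vertices have degree two, a solution omits at most one edge, and if
  it omits an edge between inner vertices, this may be assumed to be the one that saves most. Among
  five consecutive inner vertices there is thus always one both of whose edges are forced. It is
  bypassed by an edge of the smaller of the two weights, and the larger weight goes into the lower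
  bound of the neighbour it belonged to. When this is no longer possible, every edge is within three
  edges of a vertex of degree at least three, or the graph is a cycle on at most four vertices; since
  the degrees exceed two by \<open>2 (m - n)\<close> in total, and \<open>m - n\<close> never changes, this bounds the size of
  the graph.

  Throughout, the lower bounds sum up to at most \<open>d\<close>. Hence in the end each of them can be turned into
  a pendant edge, at the expense of \<open>d\<close>.
\<close>

section \<open>Connecting edge sets and their cost\<close>

text \<open>Why one of five inner vertices can always be bypassed: they have four inner edges, two
  on each side of the middle vertex. An omitted edge slides past a vertex of degree two without
  affecting connectivity, so only its saving matters. The largest of the four savings is attained on
  one side, and on the other side both edges may be kept. The delicate direction is the converse,
  where a solution omits the bypass edge: its saving must not exceed the larger saving of the two
  edges it stands for. This holds because the heavier weight has become a lower bound at its own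
  end, which cancels the saving there. Constants: an edge end at a branching vertex accounts for at
  most three edges (zero, one or two hops away), a degree \<open>d\<close> of at least three
  satisfies \<open>d \<le> 3 * (d - 2)\<close>, and the total excess is \<open>2 * (m - n)\<close>.
  So at most \<open>18 * (m - n)\<close> edges and \<open>17 * (m - n)\<close> vertices remain,
  where \<open>m - n\<close> is less than the feedback edge number \<open>g\<close>. With pendants
  this gives \<open>34 * (g - 1)\<close> vertices and \<open>35 * (g - 1)\<close> edges; the stated
  bounds also leave room for the 8 vertices and 8 edges that a cycle on four vertices
  yields.\<close>

definition connects :: "'v set \<Rightarrow> ('e \<Rightarrow> 'v set) \<Rightarrow> 'e set \<Rightarrow> bool" where
  "connects A en J \<longleftrightarrow> A \<noteq> {} \<and>
     (\<forall>S. S \<subseteq> A \<and> S \<noteq> {} \<and> S \<noteq> A \<longrightarrow> (\<exists>i\<in>J. en i \<inter> S \<noteq> {} \<and> en i \<inter> (A - S) \<noteq> {}))"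

text \<open>The lower bound takes the place of the inserted zero in \<open>power_cost\<close>; with
  \<open>l\<close> constantly zero this is what a vertex pays in the original problem.\<close>

definition pw :: "('e \<Rightarrow> 'v set) \<Rightarrow> ('e \<Rightarrow> nat) \<Rightarrow> ('v \<Rightarrow> nat) \<Rightarrow> 'e set \<Rightarrow> 'v \<Rightarrow> nat" where
  "pw en w l J v = Max (insert (l v) (w ` {i\<in>J. v \<in> en i}))"

definition cost :: "'v set \<Rightarrow> ('e \<Rightarrow> 'v set) \<Rightarrow> ('e \<Rightarrow> nat) \<Rightarrow> ('v \<Rightarrow> nat) \<Rightarrow> 'e set \<Rightarrow> nat" where
  "cost A en w l J = (\<Sum>v\<in>A. pw en w l J v)"

text \<open>\<open>Inf\<close> on the natural numbers is a lower bound and is attained on every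
  nonempty set, so no finiteness has to be carried along.\<close>

definition optval :: "'v set \<Rightarrow> 'e set \<Rightarrow> ('e \<Rightarrow> 'v set) \<Rightarrow> ('e \<Rightarrow> nat) \<Rightarrow> ('v \<Rightarrow> nat) \<Rightarrow> nat" where
  "optval A I en w l = Inf (cost A en w l ` {J. J \<subseteq> I \<and> connects A en J})"

definition mgraph :: "'v set \<Rightarrow> 'e set \<Rightarrow> ('e \<Rightarrow> 'v set) \<Rightarrow> bool" where
  "mgraph A I en \<longleftrightarrow> finite A \<and> finite I \<and> (\<forall>i\<in>I. en i \<subseteq> A \<and> card (en i) = 2) \<and>
     inj_on en I \<and> connects A en I"

definition inc :: "'e set \<Rightarrow> ('e \<Rightarrow> 'v set) \<Rightarrow> 'v \<Rightarrow> 'e set" where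
  "inc I en v = {i\<in>I. v \<in> en i}"

lemma mgraphD:
  assumes "mgraph A I en"
  shows "finite A" "finite I" "\<And>i. i \<in> I \<Longrightarrow> en i \<subseteq> A" "\<And>i. i \<in> I \<Longrightarrow> card (en i) = 2"
    "inj_on en I" "connects A en I"
  using assms by (auto simp: mgraph_def)

lemma connectsI:
  assumes "A \<noteq> {}"
    and "\<And>S. S \<subseteq> A \<Longrightarrow> S \<noteq> {} \<Longrightarrow> S \<noteq> A \<Longrightarrow> \<exists>i\<in>J. en i \<inter> S \<noteq> {} \<and> en i \<inter> (A - S) \<noteq> {}"
  shows "connects A en J"
  using assms unfolding connects_def by blast

lemma connectsE:
  assumes "connects A en J" "S \<subseteq> A" "S \<noteq> {}" "S \<noteq> A"
  obtains i where "i \<in> J" "en i \<inter> S \<noteq> {}" "en i \<inter> (A - S) \<noteq> {}"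
  using assms unfolding connects_def by blast

lemma connects_mono: "connects A en J \<Longrightarrow> J \<subseteq> K \<Longrightarrow> connects A en K"
  unfolding connects_def by blast

lemma connects_cong:
  "(\<And>i. i \<in> J \<Longrightarrow> en i = en' i) \<Longrightarrow> connects A en J = connects A en' J"
  unfolding connects_def by auto

lemma pw_insert:
  assumes "finite J"
  shows "pw en w l (insert i J) v = (if v \<in> en i then max (w i) (pw en w l J v) else pw en w l J v)"
proof (cases "v \<in> en i")
  case True
  then have "{j \<in> insert i J. v \<in> en j} = insert i {j\<in>J. v \<in> en j}" by auto
  then show ?thesis
    using assms True by (simp add: pw_def insert_commute[of "l v" "w i"])
next
  case False
  then have "{j \<in> insert i J. v \<in> en j} = {j\<in>J. v \<in> en j}" by auto
  then show ?thesis using False by (simp add: pw_def)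
qed

lemma pw_upd:
  assumes "finite J"
  shows "pw en w (l(u := max (l u) k)) J v = (if v = u then max k (pw en w l J v) else pw en w l J v)"
proof -
  let ?W = "w ` {i\<in>J. u \<in> en i}"
  have "finite ?W" using assms by simp
  then have "Max (insert (max k (l u)) ?W) = max k (Max (insert (l u) ?W))"
    by (cases "?W = {}") (simp_all del: image_is_empty add: max.assoc)
  then show ?thesis by (simp add: pw_def max.commute)
qed

lemma pw_cong:
  assumes "l v = l' v" "inc J en v = inc J' en' v" "\<And>i. i \<in> inc J en v \<Longrightarrow> w i = w' i"
  shows "pw en w l J v = pw en' w' l' J' v"
proof -
  have "w ` inc J en v = w' ` inc J' en' v" using assms by (metis image_cong)
  then show ?thesis using assms(1) unfolding pw_def inc_def by simp
qed

lemma pw_single: "inc J en v = {i} \<Longrightarrow> pw en w l J v = max (l v) (w i)"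
  by (simp add: pw_def inc_def)

lemma pw_pair: "inc J en v = {i, j} \<Longrightarrow> pw en w l J v = max (max (l v) (w i)) (w j)"
  by (simp add: pw_def inc_def max.assoc)

lemma cost_cong:
  assumes "\<And>v. v \<in> A \<Longrightarrow> l v = l' v" "\<And>i. i \<in> J \<Longrightarrow> en i = en' i" "\<And>i. i \<in> J \<Longrightarrow> w i = w' i"
  shows "cost A en w l J = cost A en' w' l' J"
  unfolding cost_def
proof (rule sum.cong[OF refl], rule pw_cong)
  fix v assume "v \<in> A"
  show "inc J en v = inc J en' v" using assms(2) by (auto simp: inc_def)
qed (use assms in \<open>auto simp: inc_def\<close>)

lemma optval_cong:
  assumes "\<And>v. v \<in> A \<Longrightarrow> l v = l' v" "\<And>i. i \<in> I \<Longrightarrow> en i = en' i" "\<And>i. i \<in> I \<Longrightarrow> w i = w' i"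
  shows "optval A I en w l = optval A I en' w' l'"
proof -
  have "{J. J \<subseteq> I \<and> connects A en J} = {J. J \<subseteq> I \<and> connects A en' J}"
    using connects_cong[of _ en en' A] assms(2) by blast
  moreover have "cost A en w l J = cost A en' w' l' J" if "J \<subseteq> I" for J
    using that by (intro cost_cong) (use assms in auto)
  ultimately show ?thesis unfolding optval_def by (metis (mono_tags, lifting) image_cong mem_Collect_eq)
qed

lemma optval_le:
  assumes "J \<subseteq> I" "connects A en J"
  shows "optval A I en w l \<le> cost A en w l J"
  unfolding optval_def using assms by (intro cInf_lower) auto

lemma optval_attained:
  assumes "connects A en I"
  obtains J where "J \<subseteq> I" "connects A en J" "optval A I en w l = cost A en w l J"
proof -
  let ?C = "cost A en w l ` {J. J \<subseteq> I \<and> connects A en J}"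
  have "?C \<noteq> {}" using assms by auto
  then have "Inf ?C \<in> ?C" by (rule Inf_nat_def1)
  then show ?thesis using that unfolding optval_def by auto
qed

text \<open>Solutions are translated both ways at no extra cost. The translations need not be
  inverse to each other, which leaves room for exchanging the omitted edge.\<close>

lemma optval_eqI:
  assumes "connects A en I"
    and 1: "\<And>J. J \<subseteq> I \<Longrightarrow> connects A en J \<Longrightarrow>
      \<exists>J'\<subseteq>I'. connects A' en' J' \<and> cost A' en' w' l' J' + d \<le> cost A en w l J"
    and 2: "\<And>J'. J' \<subseteq> I' \<Longrightarrow> connects A' en' J' \<Longrightarrow>
      \<exists>J\<subseteq>I. connects A en J \<and> cost A en w l J \<le> cost A' en' w' l' J' + d"
  shows "optval A I en w l = optval A' I' en' w' l' + d"
proof (rule antisym)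
  obtain J' where "J' \<subseteq> I'" "connects A' en' J'" using 1[OF order.refl assms(1)] by blast
  then have "connects A' en' I'" by (rule connects_mono[rotated])
  then obtain J' where J': "J' \<subseteq> I'" "connects A' en' J'" "optval A' I' en' w' l' = cost A' en' w' l' J'"
    by (rule optval_attained)
  from 2[OF J'(1,2)] show "optval A I en w l \<le> optval A' I' en' w' l' + d"
    using J'(3) optval_le by (metis order.trans)
  obtain J where J: "J \<subseteq> I" "connects A en J" "optval A I en w l = cost A en w l J"
    using assms(1) by (rule optval_attained)
  from 1[OF J(1,2)] obtain J1 where "J1 \<subseteq> I'" "connects A' en' J1"
    "cost A' en' w' l' J1 + d \<le> cost A en w l J" by blast
  then show "optval A' I' en' w' l' + d \<le> optval A I en w l"
    using J(3) optval_le[of J1 I' A' en' w' l'] by linarith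
qed

lemma not_isolated:
  assumes "connects A en J" "v \<in> A" "A \<noteq> {v}"
  shows "\<exists>i\<in>J. v \<in> en i"
  using connectsE[OF assms(1), of "{v}"] assms(2,3) by blast


section \<open>Deleting a vertex of degree one\<close>

text \<open>A cut of the smaller graph is extended by putting \<open>x\<close> on the side of
  \<open>u\<close>. Then \<open>i\<close> does not cross it, so the crossing edge avoids
  \<open>x\<close> and crosses the original cut.\<close>

lemma connects_remove_leaf:
  assumes J: "connects A en J" and x: "x \<in> A" "u \<in> A" "x \<noteq> u" "en i = {x, u}" "inc J en x \<subseteq> {i}"
  shows "connects (A - {x}) en (J - {i})"
proof (rule connectsI)
  show "A - {x} \<noteq> {}" using x by blast
  fix S assume S: "S \<subseteq> A - {x}" "S \<noteq> {}" "S \<noteq> A - {x}"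
  define T where "T = (if u \<in> S then insert x S else S)"
  have "T \<subseteq> A" "T \<noteq> {}" "T \<noteq> A" using S x unfolding T_def by auto
  then obtain j where j: "j \<in> J" "en j \<inter> T \<noteq> {}" "en j \<inter> (A - T) \<noteq> {}"
    using connectsE[OF J] by metis
  have "j \<noteq> i" using j x(4) S x(1-3) unfolding T_def by (auto split: if_splits)
  then have "x \<notin> en j" using j(1) x(5) unfolding inc_def by blast
  then have "en j \<inter> S \<noteq> {}" "en j \<inter> (A - {x} - S) \<noteq> {}"
    using j(2,3) unfolding T_def by (auto split: if_splits)
  then show "\<exists>i\<in>J - {i}. en i \<inter> S \<noteq> {} \<and> en i \<inter> (A - {x} - S) \<noteq> {}"
    using j(1) \<open>j \<noteq> i\<close> by blast
qed

text \<open>A cut whose restriction to \<open>A - {x}\<close> is trivial separates exactly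
  \<open>x\<close> from the rest and is crossed by \<open>i\<close>; any other cut is crossed within
  \<open>A - {x}\<close>.\<close>

lemma connects_add_leaf:
  assumes J: "connects (A - {x}) en J" and x: "x \<in> A" "u \<in> A" "x \<noteq> u" "en i = {x, u}"
  shows "connects A en (insert i J)"
proof (rule connectsI)
  show "A \<noteq> {}" using x by blast
  fix S assume S: "S \<subseteq> A" "S \<noteq> {}" "S \<noteq> A"
  show "\<exists>j\<in>insert i J. en j \<inter> S \<noteq> {} \<and> en j \<inter> (A - S) \<noteq> {}"
  proof (cases "S - {x} = {} \<or> S - {x} = A - {x}")
    case True
    then have "en i \<inter> S \<noteq> {} \<and> en i \<inter> (A - S) \<noteq> {}" using S x by auto
    then show ?thesis by blast
  next
    case False
    then obtain j where "j \<in> J" "en j \<inter> (S - {x}) \<noteq> {}" "en j \<inter> (A - {x} - (S - {x})) \<noteq> {}"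
      using connectsE[OF J, of "S - {x}"] S(1) by (metis Diff_mono order.refl)
    then show ?thesis by blast
  qed
qed

locale leaf =
  fixes A :: "'v set" and I :: "'e set" and en :: "'e \<Rightarrow> 'v set" and x u :: 'v and i :: 'e
  assumes g: "mgraph A I en" and i: "inc I en x = {i}" "en i = {x, u}" "x \<noteq> u"
begin

lemma mem: "x \<in> A" "u \<in> A" "i \<in> I"
  using i mgraphD(3)[OF g, of i] unfolding inc_def by auto

lemma mgraph_peel: "mgraph (A - {x}) (I - {i}) en"
  unfolding mgraph_def
proof (intro conjI ballI)
  show "connects (A - {x}) en (I - {i})"
    by (rule connects_remove_leaf[of A en I x u i]) (use mgraphD[OF g] mem i in auto)
  fix j assume j: "j \<in> I - {i}"
  show "en j \<subseteq> A - {x}" using mgraphD(3)[OF g, of j] j i(1) unfolding inc_def by auto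
qed (use mgraphD[OF g] in \<open>auto intro: inj_on_subset\<close>)

text \<open>Once \<open>i\<close> is used, its weight is a fixed lower bound at \<open>u\<close>,
  and \<open>x\<close>, having no other edge, pays a fixed amount.\<close>

lemma cost_peel:
  assumes J: "J \<subseteq> I" "i \<in> J"
  shows "cost A en w l J = cost (A - {x}) en w (l(u := max (l u) (w i))) (J - {i}) + max (l x) (w i)"
proof -
  have f: "finite (J - {i})" using J mgraphD(2)[OF g] finite_subset by blast
  have "inc J en x = {i}" using i J unfolding inc_def by auto
  then have x: "pw en w l J x = max (l x) (w i)" by (rule pw_single)
  have "cost A en w l J = pw en w l J x + (\<Sum>v\<in>A - {x}. pw en w l J v)"
    unfolding cost_def using sum.remove[OF mgraphD(1)[OF g] mem(1)] .
  also have "(\<Sum>v\<in>A - {x}. pw en w l J v) =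
      (\<Sum>v\<in>A - {x}. pw en w (l(u := max (l u) (w i))) (J - {i}) v)"
  proof (rule sum.cong[OF refl])
    fix v assume v: "v \<in> A - {x}"
    have "pw en w l J v = pw en w l (insert i (J - {i})) v" using J(2) by (simp add: insert_absorb)
    also have "\<dots> = pw en w (l(u := max (l u) (w i))) (J - {i}) v"
      using v i(2,3) unfolding pw_insert[OF f] pw_upd[OF f] by auto
    finally show "pw en w l J v = pw en w (l(u := max (l u) (w i))) (J - {i}) v" .
  qed
  finally show ?thesis using x by (simp add: cost_def)
qed

lemma optval_peel:
  "optval A I en w l = optval (A - {x}) (I - {i}) en w (l(u := max (l u) (w i))) + max (l x) (w i)"
proof (rule optval_eqI)
  show "connects A en I" using mgraphD[OF g] by blast
next
  fix J assume J: "J \<subseteq> I" "connects A en J"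
  have "A \<noteq> {x}" using mem i(3) by auto
  then have "i \<in> J" using not_isolated[OF J(2) mem(1)] i(1) J(1) by (auto simp: inc_def set_eq_iff)
  moreover have "connects (A - {x}) en (J - {i})"
    by (rule connects_remove_leaf[of A en J x u i]) (use mem i J in \<open>auto simp: inc_def\<close>)
  ultimately show "\<exists>J'\<subseteq>I - {i}. connects (A - {x}) en J' \<and>
    cost (A - {x}) en w (l(u := max (l u) (w i))) J' + max (l x) (w i) \<le> cost A en w l J"
    using J cost_peel[of J w l] by (intro exI[of _ "J - {i}"]) auto
next
  fix J' assume J': "J' \<subseteq> I - {i}" "connects (A - {x}) en J'"
  have "connects A en (insert i J')"
    by (rule connects_add_leaf[of A x en J' u i]) (use mem i J' in auto)
  moreover have "insert i J' - {i} = J'" "J' \<subseteq> I" using J' by auto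
  ultimately show "\<exists>J\<subseteq>I. connects A en J \<and>
    cost A en w l J \<le> cost (A - {x}) en w (l(u := max (l u) (w i))) J' + max (l x) (w i)"
    using J' mem cost_peel[of "insert i J'" w l] by (intro exI[of _ "insert i J'"]) auto
qed

end

section \<open>Sliding the omitted edge along a path\<close>

text \<open>In \<open>F - {f}\<close> the vertex \<open>v\<close> is a leaf hanging on
  \<open>f'\<close>. Passing to \<open>F - {f'}\<close> hangs the same leaf on \<open>f\<close>
  instead.\<close>

lemma shift:
  assumes F: "connects A en (F - {f})" and f: "f \<in> F" "f \<noteq> f'" and v: "v \<in> A" "A \<noteq> {v}"
    and inc: "inc F en v \<subseteq> {f, f'}" "v \<in> en f" "card (en f) = 2" "card (en f') = 2"
    and sub: "en f \<subseteq> A"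
  shows "f' \<in> F" and "connects A en (F - {f'})"
proof -
  obtain j where "j \<in> F - {f}" "v \<in> en j" using not_isolated[OF F v] by blast
  then have vf': "f' \<in> F" "v \<in> en f'" using inc(1) unfolding inc_def by auto
  show "f' \<in> F" by (rule vf')
  obtain a where a: "en f = {v, a}" "a \<noteq> v" using inc(2,3) unfolding card_2_iff by (metis insert_iff insert_commute singletonD)
  obtain b where b: "en f' = {v, b}" "b \<noteq> v" using vf'(2) inc(4) unfolding card_2_iff by (metis insert_iff insert_commute singletonD)
  have aA: "a \<in> A" using sub a by auto
  show "connects A en (F - {f'})"
  proof (rule connectsI)
    show "A \<noteq> {}" using v by blast
    fix S assume S: "S \<subseteq> A" "S \<noteq> {}" "S \<noteq> A"
    show "\<exists>i\<in>F - {f'}. en i \<inter> S \<noteq> {} \<and> en i \<inter> (A - S) \<noteq> {}"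
    proof (rule ccontr)
      assume *: "\<not> ?thesis"
      have av: "a \<in> S \<longleftrightarrow> v \<in> S" using * f a v aA by auto
      \<comment> \<open>\<open>v\<close> is moved to the other side of the cut; its neighbour
        \<open>a\<close> stays behind, so \<open>T\<close> is a proper cut. Since \<open>f'\<close>
        crosses \<open>S\<close>, it does not cross \<open>T\<close>, and any other edge of
        \<open>F - {f}\<close> crossing \<open>T\<close> avoids \<open>v\<close> and hence crosses
        \<open>S\<close> as well.\<close>
      define T where "T = (if v \<in> S then S - {v} else insert v S)"
      have "T \<subseteq> A" "T \<noteq> {}" "T \<noteq> A" using S v(1) av a(2) aA unfolding T_def by auto
      then obtain j where j: "j \<in> F - {f}" "en j \<inter> T \<noteq> {}" "en j \<inter> (A - T) \<noteq> {}"
        using connectsE[OF F] by metis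
      obtain k where k: "k \<in> F - {f}" "en k \<inter> S \<noteq> {}" "en k \<inter> (A - S) \<noteq> {}"
        using connectsE[OF F S] by metis
      have "k = f'" using k * by blast
      then have bv: "b \<in> S \<longleftrightarrow> v \<notin> S" using k b by auto
      have "j \<noteq> f'" using j bv b unfolding T_def by (auto split: if_splits)
      then have "v \<notin> en j" using j(1) inc(1) unfolding inc_def by auto
      then have "en j \<inter> S \<noteq> {}" "en j \<inter> (A - S) \<noteq> {}"
        using j(2,3) unfolding T_def by (auto split: if_splits)
      then show False using * j(1) \<open>j \<noteq> f'\<close> by blast
    qed
  qed
qed

text \<open>What is saved by omitting the edge \<open>f\<close> between \<open>a\<close> and
  \<open>b\<close>, where \<open>fa\<close> and \<open>fb\<close> are the other edges at these ends.
  Truncated subtraction gives zero at an end that has to pay at least \<open>w f\<close>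
  anyway.\<close>

definition saving :: "('e \<Rightarrow> nat) \<Rightarrow> ('v \<Rightarrow> nat) \<Rightarrow> 'v \<Rightarrow> 'e \<Rightarrow> 'e \<Rightarrow> 'e \<Rightarrow> 'v \<Rightarrow> nat" where
  "saving w l a fa f fb b = (w f - max (l a) (w fa)) + (w f - max (l b) (w fb))"

lemma cost_saving:
  assumes fin: "finite A" "finite F" and F: "connects A en (F - {f})" and f: "f \<in> F" "en f = {a, b}" "a \<noteq> b"
    and ab: "a \<in> A" "b \<in> A"
    and inc: "inc F en a \<subseteq> {fa, f}" "inc F en b \<subseteq> {fb, f}"
  shows "cost A en w l F = cost A en w l (F - {f}) + saving w l a fa f fb b"
proof -
  have one: "pw en w l F v = pw en w l (F - {f}) v + (w f - max (l v) (w fv))"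
    if v: "v \<in> A" "A \<noteq> {v}" "inc F en v \<subseteq> {fv, f}" "v \<in> en f" for v fv
  proof -
    \<comment> \<open>Without \<open>f\<close> the vertex \<open>v\<close> is still not isolated, so
      the other edge \<open>fv\<close> must be present.\<close>
    obtain j where "j \<in> F - {f}" "v \<in> en j" using not_isolated[OF F v(1,2)] by blast
    then have *: "inc (F - {f}) en v = {fv}" using v(3) unfolding inc_def by auto
    have "pw en w l F v = pw en w l (insert f (F - {f})) v" using f(1) by (simp add: insert_absorb)
    also have "\<dots> = max (w f) (pw en w l (F - {f}) v)" using v(4) fin(2) by (simp only: pw_insert finite_Diff if_True)
    finally show ?thesis using pw_single[OF *, of w l] by simp
  qed
  have other: "pw en w l F v = pw en w l (F - {f}) v" if "v \<notin> {a, b}" for v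
    using that f(2) by (intro pw_cong) (auto simp: inc_def)
  have split: "cost A en w l X = pw en w l X a + (pw en w l X b + (\<Sum>v\<in>A - {a} - {b}. pw en w l X v))" for X
    unfolding cost_def using fin ab f(3)
    by (subst sum.remove[of A a]; simp; subst sum.remove[of "A - {a}" b]; simp)
  have "(\<Sum>v\<in>A - {a} - {b}. pw en w l F v) = (\<Sum>v\<in>A - {a} - {b}. pw en w l (F - {f}) v)"
    by (rule sum.cong) (use other in auto)
  moreover have "pw en w l F a = pw en w l (F - {f}) a + (w f - max (l a) (w fa))"
    by (rule one) (use ab f inc in auto)
  moreover have "pw en w l F b = pw en w l (F - {f}) b + (w f - max (l b) (w fb))"
    by (rule one) (use ab f inc in auto)
  ultimately show ?thesis unfolding split saving_def by linarith
qed

section \<open>Bypassing a vertex of degree two\<close>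

text \<open>The index \<open>p\<close> serves both for the half \<open>{x, u}\<close> of the path
  and for the bypass edge \<open>{x, y}\<close>; only \<open>q\<close> disappears. A deletion mark
  and one overwritten pair of ends thus describe the new graph.\<close>

lemma connects_subdivide:
  assumes u: "u \<notin> A'" and ends: "x \<in> A'" "y \<in> A'" "en p = {x, u}" "en q = {u, y}" "en' p = {x, y}"
    and J: "p \<in> J" "q \<notin> J" "\<And>j. j \<in> J \<Longrightarrow> j \<noteq> p \<Longrightarrow> en j = en' j \<and> u \<notin> en j"
  shows "connects A' en' J \<longleftrightarrow> connects (insert u A') en (insert q J)"
proof
  assume c: "connects A' en' J"
  show "connects (insert u A') en (insert q J)"
  proof (rule connectsI)
    fix S assume S: "S \<subseteq> insert u A'" "S \<noteq> {}" "S \<noteq> insert u A'"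
    show "\<exists>i\<in>insert q J. en i \<inter> S \<noteq> {} \<and> en i \<inter> (insert u A' - S) \<noteq> {}"
    proof (cases "S - {u} = {} \<or> S - {u} = A'")
      case True
      then have "en p \<inter> S \<noteq> {} \<and> en p \<inter> (insert u A' - S) \<noteq> {}" using S u ends by auto
      then show ?thesis using J by blast
    next
      case False
      then obtain j where j: "j \<in> J" "en' j \<inter> (S - {u}) \<noteq> {}" "en' j \<inter> (A' - (S - {u})) \<noteq> {}"
        using connectsE[OF c, of "S - {u}"] S(1) by (metis Diff_subset_conv insert_is_Un)
      show ?thesis
      proof (cases "j = p")
        case True
        then have "(x \<in> S) \<noteq> (y \<in> S)" using j u ends by auto
        then have "(en p \<inter> S \<noteq> {} \<and> en p \<inter> (insert u A' - S) \<noteq> {}) \<or>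
          (en q \<inter> S \<noteq> {} \<and> en q \<inter> (insert u A' - S) \<noteq> {})" using ends by auto
        then show ?thesis using J by blast
      next
        case False
        then show ?thesis using j J(3)[of j] by (intro bexI[of _ j]) auto
      qed
    qed
  qed simp
next
  assume c: "connects (insert u A') en (insert q J)"
  show "connects A' en' J"
  proof (rule connectsI)
    show "A' \<noteq> {}" using ends by blast
    fix S assume S: "S \<subseteq> A'" "S \<noteq> {}" "S \<noteq> A'"
    \<comment> \<open>With \<open>u\<close> on the side of \<open>x\<close>, the edge
      \<open>p\<close> does not cross, and a crossing of \<open>q\<close> separates \<open>x\<close>
      from \<open>y\<close>.\<close>
    define T where "T = (if x \<in> S then insert u S else S)"
    have "T \<subseteq> insert u A'" "T \<noteq> {}" "T \<noteq> insert u A'" using S u unfolding T_def by auto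
    then obtain j where j: "j \<in> insert q J" "en j \<inter> T \<noteq> {}" "en j \<inter> (insert u A' - T) \<noteq> {}"
      using connectsE[OF c] by metis
    have "j \<noteq> p" using j(2,3) ends S u unfolding T_def by (auto split: if_splits)
    show "\<exists>i\<in>J. en' i \<inter> S \<noteq> {} \<and> en' i \<inter> (A' - S) \<noteq> {}"
    proof (cases "j = q")
      case True
      then have "(x \<in> S) \<noteq> (y \<in> S)" using j(2,3) ends S u unfolding T_def by (auto split: if_splits)
      then have "en' p \<inter> S \<noteq> {} \<and> en' p \<inter> (A' - S) \<noteq> {}" using ends by auto
      then show ?thesis using J by blast
    next
      case False
      then have "en j = en' j" "u \<notin> en j" "j \<in> J" using j(1) \<open>j \<noteq> p\<close> J by auto
      then show ?thesis using j(2,3) unfolding T_def by (intro bexI[of _ j]) (auto split: if_splits)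
    qed
  qed
qed

text \<open>In order along the path: \<open>e0\<close>, \<open>v1\<close>, \<open>s\<close>,
  \<open>v2\<close>, \<open>r\<close>, \<open>x\<close>, \<open>p\<close>, \<open>u\<close>,
  \<open>q\<close>, \<open>y\<close>, \<open>z\<close>. The vertex \<open>u\<close> is to be
  bypassed, and \<open>x\<close> is the middle vertex. The outer edges \<open>e0\<close> and
  \<open>z\<close> may coincide, namely in a cycle on five vertices.\<close>

locale window =
  fixes A :: "'v set" and I :: "'e set" and en :: "'e \<Rightarrow> 'v set"
    and v1 v2 x u y :: 'v and e0 s r p q z :: 'e
  assumes g: "mgraph A I en"
    and ends: "en s = {v1, v2}" "en r = {v2, x}" "en p = {x, u}" "en q = {u, y}"
    and dist: "distinct [v1, v2, x, u, y]"
    and incs: "inc I en v1 = {e0, s}" "inc I en v2 = {s, r}" "inc I en x = {r, p}"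
      "inc I en u = {p, q}" "inc I en y = {q, z}"
    and zq: "z \<noteq> q"
begin

abbreviation "A' \<equiv> A - {u}"
abbreviation "I' \<equiv> I - {q}"
abbreviation "en' \<equiv> en(p := {x, y})"

lemma memI: "s \<in> I" "r \<in> I" "p \<in> I" "q \<in> I" "z \<in> I" "e0 \<in> I"
  using incs unfolding inc_def by blast+

lemma memA: "v1 \<in> A" "v2 \<in> A" "x \<in> A" "u \<in> A" "y \<in> A"
  using mgraphD(3)[OF g memI(1)] mgraphD(3)[OF g memI(3)] mgraphD(3)[OF g memI(4)] ends by auto

lemma distinct_edges: "s \<noteq> r" "s \<noteq> p" "s \<noteq> q" "r \<noteq> p" "r \<noteq> q" "p \<noteq> q"
  using ends dist by (auto simp: doubleton_eq_iff)

lemma z_neq: "z \<noteq> p" "y \<in> en z" "u \<notin> en z" "z \<noteq> r" "z \<noteq> s"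
proof -
  show yz: "y \<in> en z" using incs(5) unfolding inc_def by blast
  then show "z \<noteq> p" "z \<noteq> r" "z \<noteq> s" using ends dist by auto
  then show "u \<notin> en z" using incs(4) memI(5) zq unfolding inc_def by auto
qed

lemma u_only: "j \<in> I \<Longrightarrow> u \<in> en j \<Longrightarrow> j = p \<or> j = q"
  using incs(4) unfolding inc_def by auto

lemma connects_iff:
  assumes "J \<subseteq> I'" "p \<in> J"
  shows "connects A' en' J \<longleftrightarrow> connects A en (insert q J)"
proof -
  have "connects A' en' J \<longleftrightarrow> connects (insert u A') en (insert q J)"
  proof (rule connects_subdivide)
    fix j assume "j \<in> J" "j \<noteq> p"
    then show "en j = en' j \<and> u \<notin> en j" using assms(1) u_only[of j] by auto
  qed (use memA dist ends assms in auto)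
  then show ?thesis using memA by (simp add: insert_absorb)
qed

lemma mgraph_contract: "mgraph A' I' en'"
  unfolding mgraph_def
proof (intro conjI ballI)
  show "connects A' en' I'"
    using connects_iff[of I'] memI distinct_edges mgraphD(6)[OF g] by (simp add: insert_absorb)
  show "inj_on en' I'"
  proof (rule inj_onI)
    \<comment> \<open>The bypass must not be parallel to an existing edge: such an edge would be one
      of \<open>r\<close> and \<open>p\<close> and also one of \<open>q\<close> and
      \<open>z\<close>.\<close>
    have *: "en j \<noteq> {x, y}" if "j \<in> I" for j
    proof
      assume j: "en j = {x, y}"
      then have "j \<in> inc I en x" "j \<in> inc I en y" using that unfolding inc_def by auto
      then show False using incs(3,5) z_neq distinct_edges by auto
    qed
    fix i j assume "i \<in> I'" "j \<in> I'" "en' i = en' j"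
    then show "i = j" using * mgraphD(5)[OF g] by (auto split: if_splits simp: inj_on_def)
  qed
  fix i assume i: "i \<in> I'"
  show "en' i \<subseteq> A'" using i mgraphD(3)[OF g, of i] u_only[of i] memA dist by auto
  show "card (en' i) = 2" using i mgraphD(4)[OF g, of i] dist by auto
qed (use mgraphD[OF g] in auto)

text \<open>Because the bypass edge inherits the index \<open>p\<close>, nothing changes at
  \<open>x\<close>, and at \<open>y\<close> the index \<open>q\<close> is replaced by
  \<open>p\<close>. So all degrees other than that of \<open>u\<close> survive, and one sum of edge
  numbers needs a correction.\<close>

lemma inc_contract:
  "inc I' en' v = (if v = u then {} else if v = y then {p, z} else inc I en v)"
proof -
  consider "v = u" | "v = y" | "v = x" | "v \<notin> {x, u, y}" by blast
  then show ?thesis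
  proof cases
    case 1
    then have "inc I' en' v = {}" using u_only dist unfolding inc_def by (auto split: if_splits)
    then show ?thesis using 1 by simp
  next
    case 2
    have "inc I' en' v = insert p (inc I en v - {q})"
      using 2 memI distinct_edges unfolding inc_def by (auto split: if_splits)
    then show ?thesis using 2 incs(5) dist zq by auto
  next
    case 3
    have "q \<notin> inc I en v" "p \<in> inc I en v" using 3 ends dist memI unfolding inc_def by auto
    then have "inc I' en' v = inc I en v"
      using 3 unfolding inc_def by (auto split: if_splits)
    then show ?thesis using 3 dist by auto
  next
    case 4
    have "q \<notin> inc I en v" "p \<notin> inc I en v" using 4 ends unfolding inc_def by auto
    then have "inc I' en' v = inc I en v"
      using 4 unfolding inc_def by (auto split: if_splits)
    then show ?thesis using 4 by auto
  qed
qed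

lemma card_inc_contract: "card (inc I' en' v) = (if v = u then 0 else card (inc I en v))"
  using inc_contract[of v] incs(5) zq z_neq by auto

lemma inc_sub: "F \<subseteq> I \<Longrightarrow> inc F en v \<subseteq> inc I en v"
  unfolding inc_def by auto

lemma A_not_single: "A \<noteq> {v}"
proof
  assume "A = {v}"
  then show False using memA dist by auto
qed

text \<open>Along the path, the edge missing from a solution can be moved towards \<^term>\<open>s\<close>.\<close>

lemma shifts:
  assumes F: "F \<subseteq> I"
  shows "connects A en (F - {q}) \<Longrightarrow> q \<in> F \<Longrightarrow> p \<in> F \<and> connects A en (F - {p})"
    and "connects A en (F - {p}) \<Longrightarrow> p \<in> F \<Longrightarrow> q \<in> F \<and> r \<in> F \<and> connects A en (F - {r})"
    and "connects A en (F - {r}) \<Longrightarrow> r \<in> F \<Longrightarrow> s \<in> F \<and> connects A en (F - {s})"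
proof -
  have card: "card (en s) = 2" "card (en r) = 2" "card (en p) = 2" "card (en q) = 2"
    using mgraphD(4)[OF g] memI by blast+
  have sub: "en s \<subseteq> A" "en r \<subseteq> A" "en p \<subseteq> A" "en q \<subseteq> A"
    using mgraphD(3)[OF g] memI by blast+
  have inc: "inc F en v2 \<subseteq> {r, s}" "inc F en x \<subseteq> {p, r}" "inc F en u \<subseteq> {q, p}" "inc F en u \<subseteq> {p, q}"
    using inc_sub[OF F] incs by blast+
  have ee: "u \<in> en p" "u \<in> en q" "x \<in> en p" "x \<in> en r" "v2 \<in> en r" using ends by auto
  show "p \<in> F \<and> connects A en (F - {p})" if "connects A en (F - {q})" "q \<in> F"
    by (intro conjI; rule shift[OF that(1)])
      (use that distinct_edges card sub inc(3) ee(2) memA(4) A_not_single in auto)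
  show "q \<in> F \<and> r \<in> F \<and> connects A en (F - {r})" if that: "connects A en (F - {p})" "p \<in> F"
  proof (intro conjI)
    show "q \<in> F"
      by (rule shift(1)[OF that(1,2) distinct_edges(6) memA(4) A_not_single inc(4) ee(1) card(3,4) sub(3)])
    show "r \<in> F" "connects A en (F - {r})"
      by (rule shift[OF that(1,2) distinct_edges(4)[symmetric] memA(3) A_not_single inc(2) ee(3) card(3,2) sub(3)])+
  qed
  show "s \<in> F \<and> connects A en (F - {s})" if "connects A en (F - {r})" "r \<in> F"
    using shift[OF that(1,2) distinct_edges(1)[symmetric] memA(2) A_not_single inc(1) ee(5) card(2,1) sub(2)]
    by blast
qed

context
  fixes w :: "'e \<Rightarrow> nat" and l :: "'v \<Rightarrow> nat"
begin

abbreviation "sav_s \<equiv> saving w l v1 e0 s r v2"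
abbreviation "sav_r \<equiv> saving w l v2 s r p x"
abbreviation "sav_p \<equiv> saving w l x r p q u"
abbreviation "sav_q \<equiv> saving w l u p q z y"
abbreviation "w' \<equiv> w(p := min (w p) (w q))"
abbreviation "l' \<equiv> (if w q < w p then l(x := max (l x) (w p)) else l(y := max (l y) (w q)))"
abbreviation "delta \<equiv> max (l u) (max (w p) (w q))"

lemma cost_savings:
  assumes F: "F \<subseteq> I"
  shows "connects A en (F - {s}) \<Longrightarrow> s \<in> F \<Longrightarrow> cost A en w l F = cost A en w l (F - {s}) + sav_s"
    and "connects A en (F - {r}) \<Longrightarrow> r \<in> F \<Longrightarrow> cost A en w l F = cost A en w l (F - {r}) + sav_r"
    and "connects A en (F - {p}) \<Longrightarrow> p \<in> F \<Longrightarrow> cost A en w l F = cost A en w l (F - {p}) + sav_p"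
    and "connects A en (F - {q}) \<Longrightarrow> q \<in> F \<Longrightarrow> cost A en w l F = cost A en w l (F - {q}) + sav_q"
  using mgraphD(1)[OF g] finite_subset[OF F mgraphD(2)[OF g]] memA ends dist incs inc_sub[OF F]
  by (intro cost_saving; force)+

text \<open>With both edges used, \<open>u\<close> pays \<open>delta\<close>. The bypass edge
  charges its ends the smaller weight only; the raised lower bound makes up for this at the end of
  the heavier edge.\<close>

lemma cost_contract:
  assumes J: "J \<subseteq> I'" "p \<in> J"
  shows "cost A en w l (insert q J) = cost A' en' w' l' J + delta"
proof -
  define K where "K = J - {p}"
  have "finite J" using J(1) mgraphD(2)[OF g] by (meson finite_Diff finite_subset)
  then have K: "finite K" "insert p K = J" "p \<notin> K" "q \<notin> K" "K \<subseteq> I"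
    using J unfolding K_def by auto
  have "inc (insert q J) en u = {p, q}" using incs(4) J memI unfolding inc_def by auto
  then have u: "pw en w l (insert q J) u = delta" by (simp add: pw_pair max.assoc)
  have rest: "pw en w l (insert q J) v = pw en' w' l' J v" if v: "v \<in> A'" for v
  proof -
    have 0: "pw en' w' l'' K v = pw en w l'' K v" for l''
      using K by (intro pw_cong) (auto simp: inc_def)
    have f: "finite (insert p K)" using K(1) by (rule finite.insertI)
    define P where "P = pw en w l K v"
    have "pw en w l (insert q J) v = (if v = y then max (w q) P else if v = x then max (w p) P else P)"
      unfolding K(2)[symmetric] pw_insert[OF f] pw_insert[OF K(1)] P_def using v ends dist by auto
    moreover have L: "pw en w l' K v =
        (if w q < w p then (if v = x then max (w p) P else P) else (if v = y then max (w q) P else P))"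
      using pw_upd[OF K(1), of en w l x "w p" v] pw_upd[OF K(1), of en w l y "w q" v]
      unfolding P_def by (cases "w q < w p") simp_all
    moreover have "pw en' w' l' J v =
        (let P' = if w q < w p then (if v = x then max (w p) P else P) else (if v = y then max (w q) P else P)
         in if v = x \<or> v = y then max (min (w p) (w q)) P' else P')"
      unfolding K(2)[symmetric] pw_insert[OF K(1)] 0 L by simp
    ultimately show ?thesis using dist by (cases "w q < w p") (simp_all add: min_def)
  qed
  have "cost A en w l (insert q J) = pw en w l (insert q J) u + (\<Sum>v\<in>A'. pw en w l (insert q J) v)"
    unfolding cost_def using sum.remove[OF mgraphD(1)[OF g] memA(4)] .
  also have "(\<Sum>v\<in>A'. pw en w l (insert q J) v) = cost A' en' w' l' J"
    unfolding cost_def by (rule sum.cong) (use rest in auto)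
  finally show ?thesis using u by simp
qed

text \<open>A solution lacking \<open>p\<close> or \<open>q\<close> gets the missing edge back and
  gives up \<open>s\<close> or \<open>r\<close> instead, whichever saves more; by
  \<open>best\<close> this costs nothing. A solution of the smaller graph lacking the bypass edge
  undergoes the same exchange.\<close>

lemma optval_contract:
  assumes best: "max sav_p sav_q \<le> max sav_s sav_r"
  shows "optval A I en w l = optval A' I' en' w' l' + delta"
proof (rule optval_eqI)
  show "connects A en I" using mgraphD[OF g] by blast
next
  fix J assume J: "J \<subseteq> I" "connects A en J"
  have "\<exists>F\<subseteq>I. p \<in> F \<and> q \<in> F \<and> connects A en F \<and> cost A en w l F \<le> cost A en w l J"
  proof (cases "p \<in> J \<and> q \<in> J")
    case False
    then obtain c where c: "c \<in> {p, q}" "c \<notin> J" by blast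
    define F where "F = insert c J"
    have cF: "c \<in> {p, q}" "c \<in> F" "J = F - {c}" "F \<subseteq> I"
      using J c memI unfolding F_def by auto
    have sub: "F - {s} \<subseteq> I" "F - {r} \<subseteq> I" using cF by auto
    have p: "p \<in> F" "connects A en (F - {p})"
      using cF J(2) shifts(1)[OF cF(4)] by auto
    have q: "q \<in> F" "r \<in> F" "connects A en (F - {r})" using shifts(2)[OF cF(4)] p by auto
    have s: "s \<in> F" "connects A en (F - {s})" using shifts(3)[OF cF(4)] q by auto
    have "cost A en w l F \<le> cost A en w l J + max sav_p sav_q"
      using cF J(2) cost_savings(3,4)[OF cF(4)] by auto
    moreover have "cost A en w l F = cost A en w l (F - {s}) + sav_s"
      "cost A en w l F = cost A en w l (F - {r}) + sav_r"
      using cost_savings(1,2)[OF cF(4)] q s by auto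
    ultimately have "cost A en w l (F - {s}) \<le> cost A en w l J \<or> cost A en w l (F - {r}) \<le> cost A en w l J"
      using best by (auto simp: max_def split: if_splits)
    moreover have "p \<in> F - {s}" "q \<in> F - {s}" "p \<in> F - {r}" "q \<in> F - {r}"
      using p q distinct_edges by auto
    ultimately show ?thesis using sub q(3) s(2) by blast
  qed (use J in auto)
  then obtain F where F: "F \<subseteq> I" "p \<in> F" "q \<in> F" "connects A en F" "cost A en w l F \<le> cost A en w l J"
    by blast
  have "insert q (F - {q}) = F" "F - {q} \<subseteq> I'" "p \<in> F - {q}" using F distinct_edges by auto
  then have "connects A' en' (F - {q})" "cost A en w l F = cost A' en' w' l' (F - {q}) + delta"
    using connects_iff[of "F - {q}"] cost_contract[of "F - {q}"] F(4) by auto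
  then show "\<exists>J'\<subseteq>I'. connects A' en' J' \<and> cost A' en' w' l' J' + delta \<le> cost A en w l J"
    using F \<open>F - {q} \<subseteq> I'\<close> by (intro exI[of _ "F - {q}"]) auto
next
  fix J assume J: "J \<subseteq> I'" "connects A' en' J"
  show "\<exists>F\<subseteq>I. connects A en F \<and> cost A en w l F \<le> cost A' en' w' l' J + delta"
  proof (cases "p \<in> J")
    case True
    then show ?thesis
      using J connects_iff[OF J(1)] cost_contract[OF J(1)] memI by (intro exI[of _ "insert q J"]) auto
  next
    case False
    define F where "F = insert p J"
    have F: "F \<subseteq> I'" "p \<in> F" "F - {p} = J" "finite F"
      using J False memI distinct_edges mgraphD(2)[OF g] finite_subset unfolding F_def by auto
    have incF: "inc F en' v \<subseteq> inc I' en' v" for v using F unfolding inc_def by auto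
    have ne: "A' \<noteq> {v}" for v
    proof
      assume "A' = {v}"
      moreover have "v1 \<in> A'" "v2 \<in> A'" using memA dist by auto
      ultimately show False using dist by auto
    qed
    note g' = mgraphD[OF mgraph_contract]
    have en': "en' s = {v1, v2}" "en' r = {v2, x}" "en' p = {x, y}" using ends distinct_edges by auto
    have sub: "en' r \<subseteq> A'" "en' p \<subseteq> A'" and card: "card (en' s) = 2" "card (en' r) = 2" "card (en' p) = 2"
      using g'(3,4) memI distinct_edges by blast+
    have "inc I' en' x = {r, p}" "inc I' en' v2 = {s, r}" "inc I' en' y = {p, z}"
      using inc_contract incs dist by auto
    then have inc: "inc F en' x \<subseteq> {p, r}" "inc F en' x \<subseteq> {r, p}" "inc F en' v2 \<subseteq> {r, s}" "inc F en' y \<subseteq> {z, p}"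
      using incF by blast+
    have memA': "x \<in> A'" "y \<in> A'" "v2 \<in> A'" using memA dist by auto
    have xy: "x \<noteq> y" "y \<noteq> x" using dist by auto
    have ee: "x \<in> en' p" "v2 \<in> en' r" unfolding en' by auto
    have Fp: "connects A' en' (F - {p})" using F(3) J(2) by simp
    have r: "r \<in> F" "connects A' en' (F - {r})"
      by (rule shift[OF Fp F(2) distinct_edges(4)[symmetric] memA'(1) ne inc(1) ee(1) card(3,2) sub(2)])+
    have s: "s \<in> F" "connects A' en' (F - {s})"
      by (rule shift[OF r(2,1) distinct_edges(1)[symmetric] memA'(3) ne inc(3) ee(2) card(2,1) sub(1)])+
    have c1: "cost A' en' w' l' F = cost A' en' w' l' (F - {p}) + saving w' l' x r p z y"
      using cost_saving[OF g'(1) F(4) Fp F(2) en'(3) _ memA'(1,2) inc(2,4)] dist by simp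
    \<comment> \<open>At the end whose lower bound was raised the bypass edge saves nothing. At the
      other end it has the weight of the edge that used to be there, so its saving is one summand of
      \<open>sav_p\<close> or \<open>sav_q\<close>.\<close>
    have c2: "saving w' l' x r p z y \<le> max sav_p sav_q"
    proof (cases "w q < w p")
      case True
      then have "saving w' l' x r p z y = w q - max (l y) (w z)"
        using distinct_edges(4) z_neq(1) xy by (simp add: saving_def)
      also have "\<dots> \<le> sav_q" by (simp add: saving_def)
      finally show ?thesis by simp
    next
      case False
      then have "saving w' l' x r p z y = w p - max (l x) (w r)"
        using distinct_edges(4) z_neq(1) xy by (simp add: saving_def)
      also have "\<dots> \<le> sav_p" by (simp add: saving_def)
      finally show ?thesis by simp
    qed
    have cF: "cost A' en' w' l' F \<le> cost A' en' w' l' J + max sav_s sav_r"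
      unfolding c1 F(3) by (intro add_left_mono order.trans[OF c2 best])
    define CJ where "CJ = cost A' en' w' l' J"
    define CF where "CF = cost A' en' w' l' F"
    \<comment> \<open>Costs are compared through \<open>G\<close>, which contains all four inner
      edges: it costs \<open>delta\<close> more than \<open>F\<close>, and from it \<open>s\<close>
      or \<open>r\<close> can be omitted with the known saving.\<close>
    define G where "G = insert q F"
    have GI: "G \<subseteq> I" using F memI unfolding G_def by auto
    have qF: "q \<notin> F" using F by auto
    have mem: "s \<in> G" "r \<in> G" using r s unfolding G_def by auto
    have minus: "insert q (F - {c}) = G - {c}" if "c \<noteq> q" for c
      using that qF unfolding G_def by auto
    have cs: "connects A en (G - {s})"
      using connects_iff[of "F - {s}"] s F distinct_edges minus[of s] by auto
    have cr: "connects A en (G - {r})"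
      using connects_iff[of "F - {r}"] r F distinct_edges minus[of r] by auto
    have "cost A en w l G = CF + delta"
      using cost_contract[OF F(1,2)] unfolding G_def CF_def .
    moreover note cost_savings(1)[OF GI cs mem(1)] cost_savings(2)[OF GI cr mem(2)]
    moreover have "CF \<le> CJ + max sav_s sav_r" using cF unfolding CJ_def CF_def .
    ultimately have "cost A en w l (G - {s}) \<le> CJ + delta \<or> cost A en w l (G - {r}) \<le> CJ + delta"
      by linarith
    moreover have "G - {s} \<subseteq> I" "G - {r} \<subseteq> I" using GI by auto
    ultimately show ?thesis using cs cr unfolding CJ_def by blast
  qed
qed

end

end

lemma card_2_other:
  assumes "card S = 2" "a \<in> S"
  obtains b where "S = {a, b}" "b \<noteq> a"
  using assms unfolding card_2_iff by (metis insert_commute insertE singletonD)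

lemma card_2_pair:
  assumes "card S = 2" "a \<in> S" "b \<in> S" "a \<noteq> b"
  shows "S = {a, b}"
  using card_2_other[OF assms(1,2)] assms(3,4) by (metis insertE singletonD)

section \<open>Turning a lower bound into a pendant edge\<close>

text \<open>This is the deletion of a leaf read backwards: peeling the new vertex \<open>x\<close>
  off again restores the bound \<open>l u\<close> and contributes \<open>l u\<close> to the
  constant.\<close>

lemma optval_pendant:
  assumes g: "mgraph A I en" and x: "x \<notin> A" "u \<in> A" "i \<notin> I"
  shows "mgraph (insert x A) (insert i I) (en(i := {u, x}))"
    and "optval A I en w l + l u =
      optval (insert x A) (insert i I) (en(i := {u, x})) (w(i := l u)) (l(u := 0, x := 0))"
proof -
  let ?A = "insert x A" let ?I = "insert i I" let ?en = "en(i := {u, x})"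
  have c: "connects ?A ?en ?I"
  proof (rule connects_add_leaf[where u = u])
    have "connects A ?en I = connects A en I" by (rule connects_cong) (use x in auto)
    then show "connects (?A - {x}) ?en I" using mgraphD(6)[OF g] x by simp
  qed (use x in auto)
  have ux: "u \<noteq> x" using x by auto
  have nx: "x \<notin> en j" if "j \<in> I" for j using mgraphD(3)[OF g that] x by auto
  show g': "mgraph ?A ?I ?en"
    unfolding mgraph_def
  proof (intro conjI ballI)
    show "connects ?A ?en ?I" by (rule c)
    show "finite ?A" "finite ?I" using mgraphD(1,2)[OF g] by auto
    show "inj_on ?en ?I"
    proof (rule inj_onI)
      fix j k assume jk: "j \<in> ?I" "k \<in> ?I" "?en j = ?en k"
      have "x \<in> ?en h \<longleftrightarrow> h = i" if "h \<in> ?I" for h using nx[of h] that by auto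
      then have ki: "j = i \<longleftrightarrow> k = i" using jk by metis
      show "j = k"
      proof (cases "j = i")
        case False
        then have "en j = en k" "j \<in> I" "k \<in> I" using jk ki by auto
        then show ?thesis using mgraphD(5)[OF g] by (simp add: inj_on_def)
      qed (use ki in simp)
    qed
    fix j assume j: "j \<in> ?I"
    show "?en j \<subseteq> ?A"
    proof (cases "j = i")
      case False
      then show ?thesis using j mgraphD(3)[OF g, of j] by auto
    qed (use x in simp)
    show "card (?en j) = 2"
    proof (cases "j = i")
      case False
      then show ?thesis using j mgraphD(4)[OF g, of j] by simp
    qed (use ux in simp)
  qed
  have inc: "inc ?I ?en x = {i}"
    using mgraphD(3)[OF g] x by (auto simp: inc_def)
  interpret leaf ?A ?I ?en x u i
    by unfold_locales (use g' inc x in auto)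
  have *: "?A - {x} = A" "?I - {i} = I" using x by auto
  have "optval ?A ?I ?en (w(i := l u)) (l(u := 0, x := 0)) =
      optval A I ?en (w(i := l u)) ((l(u := 0, x := 0))(u := l u)) + l u"
    using optval_peel[of "w(i := l u)" "l(u := 0, x := 0)"] unfolding * using x by auto
  also have "optval A I ?en (w(i := l u)) ((l(u := 0, x := 0))(u := l u)) = optval A I en w l"
    by (rule optval_cong) (use x in auto)
  finally show "optval A I en w l + l u = optval ?A ?I ?en (w(i := l u)) (l(u := 0, x := 0))" ..
qed

section \<open>The size of a reduced graph\<close>

lemma sum_degree:
  assumes "mgraph A I en"
  shows "(\<Sum>v\<in>A. card (inc I en v)) = 2 * card I"
proof -
  note g = mgraphD[OF assms]
  have "(\<Sum>v\<in>A. card (inc I en v)) = (\<Sum>v\<in>A. \<Sum>i\<in>I. if v \<in> en i then 1 else 0)"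
    using g(2) unfolding inc_def by (intro sum.cong) (auto simp: sum.If_cases Collect_conj_eq)
  also have "\<dots> = (\<Sum>i\<in>I. \<Sum>v\<in>A. if v \<in> en i then 1 else 0)" by (rule sum.swap)
  also have "\<dots> = (\<Sum>i\<in>I. 2)"
  proof (rule sum.cong[OF refl])
    fix i assume i: "i \<in> I"
    have "{v \<in> A. v \<in> en i} = en i" using g(3)[OF i] by auto
    then show "(\<Sum>v\<in>A. if v \<in> en i then 1 else 0) = (2::nat)"
      using g(1) g(4)[OF i] by (simp add: sum.If_cases Collect_conj_eq[symmetric] Int_def)
  qed
  finally show ?thesis by simp
qed

section \<open>Distance of an edge from the branching vertices\<close>

text \<open>Distances are measured between edges because their indices survive a contraction. Once
  no leaf is left, a degree other than two at an edge end means a branching vertex.\<close>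

fun near :: "'e set \<Rightarrow> ('e \<Rightarrow> 'v set) \<Rightarrow> nat \<Rightarrow> 'e \<Rightarrow> bool" where
  "near I en 0 i \<longleftrightarrow> (\<exists>v\<in>en i. card (inc I en v) \<noteq> 2)"
| "near I en (Suc k) i \<longleftrightarrow> near I en k i \<or> (\<exists>j\<in>I. near I en k j \<and> en i \<inter> en j \<noteq> {})"

text \<open>Bypassing only shortens walks: with \<open>q\<close> identified with \<open>p\<close>,
  edges meeting at \<open>u\<close> become equal, and edges meeting elsewhere still meet. So an edge
  found to be near stays near.\<close>

lemma (in window) near_contract:
  assumes "near I en k i" "i \<in> I"
  shows "near I' en' k (if i = q then p else i)"
  using assms
proof (induction k arbitrary: i)
  case 0
  then obtain v where v: "v \<in> en i" "card (inc I en v) \<noteq> 2" by auto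
  have "card (inc I en x) = 2" "card (inc I en u) = 2" "card (inc I en y) = 2"
    using incs(3-5) distinct_edges zq by auto
  then have "v \<noteq> x" "v \<noteq> u" "v \<noteq> y" using v by auto
  then have "v \<in> en' (if i = q then p else i)" using v(1) ends by (auto split: if_splits)
  moreover have "card (inc I' en' v) \<noteq> 2" using card_inc_contract[of v] v(2) \<open>v \<noteq> u\<close> by simp
  ultimately show ?case unfolding near.simps by blast
next
  case (Suc k)
  let ?f = "\<lambda>i. if i = q then p else i"
  show ?case
  proof (cases "near I en k i")
    case True
    then show ?thesis unfolding near.simps using Suc.IH Suc.prems(2) by blast
  next
    case False
    then obtain j c where j: "j \<in> I" "near I en k j" "c \<in> en i" "c \<in> en j" using Suc.prems by auto
    have IH: "near I' en' k (?f j)" using Suc.IH j by blast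
    have fj: "?f j \<in> I'" using j(1) memI distinct_edges by auto
    show ?thesis
    proof (cases "c = u")
      case True
      then have eq: "?f i = ?f j" using u_only Suc.prems(2) j by auto
      show ?thesis unfolding eq near.simps using IH by blast
    next
      case False
      have "c \<in> en' (?f h)" if "c \<in> en h" for h using that False ends by (auto split: if_splits)
      then have "en' (?f i) \<inter> en' (?f j) \<noteq> {}" using j by blast
      then show ?thesis unfolding near.simps using IH fj by blast
    qed
  qed
qed

text \<open>A walk that starts with an edge end at a branching vertex and then has no choice, as it
  only continues through vertices of degree two. The pair of \<open>v\<close> and \<open>i\<close>
  records that \<open>i\<close> is entered at \<open>v\<close>.\<close>

inductive reach :: "'e set \<Rightarrow> ('e \<Rightarrow> 'v set) \<Rightarrow> nat \<Rightarrow> 'v \<Rightarrow> 'e \<Rightarrow> bool" for I en where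
  start: "i \<in> inc I en v \<Longrightarrow> card (inc I en v) \<noteq> 2 \<Longrightarrow> reach I en 0 v i"
| step: "reach I en k v i \<Longrightarrow> en i = {v, u} \<Longrightarrow> v \<noteq> u \<Longrightarrow> inc I en u = {i, j} \<Longrightarrow> i \<noteq> j \<Longrightarrow>
    reach I en (Suc k) u j"

lemma reach_mem: "reach I en k v i \<Longrightarrow> v \<in> en i \<and> i \<in> I"
  by (induction rule: reach.induct) (auto simp: inc_def)

lemma near_reach:
  assumes "near I en k i" "i \<in> I" and two: "\<And>i. i \<in> I \<Longrightarrow> card (en i) = 2"
  shows "\<exists>j\<le>k. \<exists>v. reach I en j v i"
  using assms(1,2)
proof (induction k arbitrary: i)
  case 0
  then show ?case by (auto simp: inc_def intro!: reach.start)
next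
  case (Suc k)
  show ?case
  proof (cases "near I en k i")
    case True
    then show ?thesis using Suc.IH Suc.prems(2) le_Suc_eq by blast
  next
    case False
    then obtain i' c where i': "i' \<in> I" "near I en k i'" "c \<in> en i" "c \<in> en i'" using Suc.prems by auto
    then obtain j v where j: "j \<le> k" "reach I en j v i'" using Suc.IH by blast
    have ne: "i \<noteq> i'" using False i' by blast
    show ?thesis
    proof (cases "card (inc I en c) = 2")
      case deg: False
      then have "reach I en 0 c i" using i' Suc.prems(2) by (intro reach.start) (auto simp: inc_def)
      then show ?thesis by blast
    next
      case True
      then have incc: "inc I en c = {i', i}"
        using ne i' Suc.prems(2) by (intro card_2_pair) (auto simp: inc_def)
      show ?thesis
      proof (cases "c = v")
        case False
        have "en i' = {v, c}"
          using False reach_mem[OF j(2)] i' two[OF i'(1)] by (intro card_2_pair) auto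
        then have "reach I en (Suc j) c i" using reach.step[OF j(2) _ _ incc] False ne by auto
        then show ?thesis using j(1) by blast
      next
        case True
        from j(2) show ?thesis
        proof cases
          case start
          then show ?thesis using \<open>card (inc I en c) = 2\<close> True by simp
        next
          case (step k' v' h)
          \<comment> \<open>The walk entered \<open>i'\<close> at \<open>c\<close>, and the only
            other edge there is \<open>i\<close>; hence \<open>i\<close> was reached one hop
            earlier.\<close>
          then have "h = i" using incc True ne by auto
          then show ?thesis using step j(1) by (intro exI[of _ k']) auto
        qed
      qed
    qed
  qed
qed

text \<open>A step of \<open>reach\<close> as a total function, so that each starting end yields at
  most one edge per number of hops. \<open>the_elem\<close> matters only where the sets are
  singletons.\<close>

definition hop :: "'e set \<Rightarrow> ('e \<Rightarrow> 'v set) \<Rightarrow> 'v \<times> 'e \<Rightarrow> 'v \<times> 'e" where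
  "hop I en = (\<lambda>(v, i). let u = the_elem (en i - {v}) in (u, the_elem (inc I en u - {i})))"

lemma reach_hop:
  assumes "reach I en k v i"
  shows "(v, i) \<in> (hop I en ^^ k) ` {(v, i). i \<in> inc I en v \<and> card (inc I en v) \<noteq> 2}"
  using assms
proof (induction rule: reach.induct)
  case (step k v i u j)
  have "en i - {v} = {u}" "inc I en u - {i} = {j}" using step by auto
  then have "hop I en (v, i) = (u, j)" by (simp add: hop_def)
  moreover obtain p where "p \<in> {(v, i). i \<in> inc I en v \<and> card (inc I en v) \<noteq> 2}"
    "(v, i) = (hop I en ^^ k) p" using step.IH by (rule imageE)
  ultimately show ?case by (intro image_eqI[of _ _ p]) simp_all
qed simp

text \<open>Every edge is reached within two hops from an edge end at a branching vertex, and the degrees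
  of the branching vertices sum up to at most three times their total excess over two.\<close>

lemma near_count:
  assumes g: "mgraph A I en" and deg: "\<And>v. v \<in> A \<Longrightarrow> 2 \<le> card (inc I en v)"
    and near: "\<And>i. i \<in> I \<Longrightarrow> near I en 2 i"
  shows "18 * card A \<le> 17 * card I"
proof -
  note G = mgraphD[OF g]
  let ?B = "{v \<in> A. card (inc I en v) \<noteq> 2}"
  let ?W = "{(v, i). i \<in> inc I en v \<and> card (inc I en v) \<noteq> 2}"
  have W: "?W = (SIGMA v:?B. inc I en v)" using G(3) by (auto simp: inc_def)
  have fin: "finite (inc I en v)" for v using G(2) unfolding inc_def by simp
  have finW: "finite ?W" unfolding W using G(1) fin by simp
  have cW: "card ?W = (\<Sum>v\<in>?B. card (inc I en v))" unfolding W using G(1) fin by (simp add: card_SigmaI)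
  have "I \<subseteq> (\<Union>k\<le>2. snd ` (hop I en ^^ k) ` ?W)"
  proof
    fix i assume i: "i \<in> I"
    obtain k v where "k \<le> 2" "reach I en k v i"
      using near_reach[OF near[OF i] i G(4)] by blast
    then have "(v, i) \<in> (hop I en ^^ k) ` ?W" by (intro reach_hop)
    then have "i \<in> snd ` (hop I en ^^ k) ` ?W" by (rule rev_image_eqI) simp
    with \<open>k \<le> 2\<close> show "i \<in> (\<Union>k\<le>2. snd ` (hop I en ^^ k) ` ?W)" by blast
  qed
  then have "card I \<le> card (\<Union>k\<le>2. snd ` (hop I en ^^ k) ` ?W)"
    using finW by (intro card_mono) auto
  also have "\<dots> \<le> (\<Sum>k\<le>2. card (snd ` (hop I en ^^ k) ` ?W))"
    by (rule card_UN_le) simp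
  also have "\<dots> \<le> (\<Sum>k\<le>(2::nat). card ?W)"
    by (intro sum_mono order.trans[OF card_image_le card_image_le] finite_imageI finW)
  finally have 1: "card I \<le> 3 * card ?W" by simp
  \<comment> \<open>A degree \<open>d\<close> of at least three satisfies
    \<open>d \<le> 3 * (d - 2)\<close>, with equality at three.\<close>
  have "card ?W \<le> (\<Sum>v\<in>?B. 3 * (card (inc I en v) - 2))"
    unfolding cW by (rule sum_mono) (use deg in force)
  also have "\<dots> \<le> (\<Sum>v\<in>A. 3 * (card (inc I en v) - 2))"
    by (rule sum_mono2) (use G(1) in auto)
  finally have 2: "card ?W \<le> 3 * (\<Sum>v\<in>A. card (inc I en v) - 2)" by (simp add: sum_distrib_left)
  have "2 * card I = (\<Sum>v\<in>A. (card (inc I en v) - 2) + 2)"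
    unfolding sum_degree[OF g, symmetric] by (rule sum.cong) (use deg le_add_diff_inverse2 in metis)+
  then have "2 * card I = (\<Sum>v\<in>A. card (inc I en v) - 2) + 2 * card A" by (simp only: sum.distrib) simp
  \<comment> \<open>The excess is \<open>2 * (card I - card A)\<close>, so \<open>card I\<close> is
    at most \<open>3 * 3 * 2\<close> times \<open>card I - card A\<close>.\<close>
  then show ?thesis using 1 2 by linarith
qed

lemma closed_all:
  assumes "connects A en I" "S \<subseteq> A" "S \<noteq> {}" "\<And>i. i \<in> I \<Longrightarrow> en i \<inter> S \<noteq> {} \<Longrightarrow> en i \<subseteq> S"
  shows "S = A"
proof (rule ccontr)
  assume "S \<noteq> A"
  then obtain i where "i \<in> I" "en i \<inter> S \<noteq> {}" "en i \<inter> (A - S) \<noteq> {}"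
    using connectsE[OF assms(1-3)] by blast
  then show False using assms(4)[of i] by blast
qed

text \<open>Stated edge by edge, so that a loop over the edges can establish it, although the second
  alternative concerns the whole graph: a cycle too short to contain a window.\<close>

definition good :: "'v set \<Rightarrow> 'e set \<Rightarrow> ('e \<Rightarrow> 'v set) \<Rightarrow> 'e \<Rightarrow> bool" where
  "good A I en i \<longleftrightarrow> near I en 2 i \<or> (card A \<le> 4 \<and> (\<forall>v\<in>A. card (inc I en v) = 2))"

lemma (in window) good_contract:
  assumes "good A I en i" "i \<in> I'"
  shows "good A' I' en' i"
proof -
  have "card A' \<le> card A" using mgraphD(1)[OF g] by (intro card_mono) auto
  then show ?thesis
    using assms near_contract[of 2 i] card_inc_contract unfolding good_def by auto
qed

text \<open>In a connected graph without vertices of degree one, a degree below two occurs only if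
  there is a single vertex. Otherwise either one edge witnesses a short cycle, or all edges are near
  and can be counted.\<close>

lemma good_bounds:
  assumes g: "mgraph A I en" and deg: "\<And>v. v \<in> A \<Longrightarrow> card (inc I en v) \<noteq> 1"
    and good: "\<And>i. i \<in> I \<Longrightarrow> good A I en i"
  shows "18 * card A \<le> 17 * card I \<or> card A \<le> 4 \<and> card I \<le> 4"
proof -
  note G = mgraphD[OF g]
  consider "\<exists>v. A = {v}" | "card A \<le> 4" "\<forall>v\<in>A. card (inc I en v) = 2"
    | "\<nexists>v. A = {v}" "\<And>i. i \<in> I \<Longrightarrow> near I en 2 i"
    using good unfolding good_def by blast
  then show ?thesis
  proof cases
    case 1
    then obtain v where v: "A = {v}" by blast
    have "I = {}"
    proof (rule ccontr)
      assume "I \<noteq> {}"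
      then obtain i where "i \<in> I" by blast
      then have "en i \<subseteq> {v}" "card (en i) = 2" using G v by auto
      then show False using card_mono[of "{v}" "en i"] by simp
    qed
    then show ?thesis using v by simp
  next
    case 2
    then have "2 * card I = 2 * card A" using sum_degree[OF g] by simp
    then show ?thesis using 2 by simp
  next
    case 3
    have "2 \<le> card (inc I en v)" if v: "v \<in> A" for v
    proof -
      have "A \<noteq> {v}" using 3(1) by blast
      then have "inc I en v \<noteq> {}" using not_isolated[OF G(6) v] unfolding inc_def by blast
      moreover have "finite (inc I en v)" using G(2) unfolding inc_def by simp
      ultimately show ?thesis using deg[OF v]
        by (metis One_nat_def Suc_1 Suc_leI card_gt_0_iff le_neq_implies_less)
    qed
    then show ?thesis using near_count[OF g _ 3(2)] by blast
  qed
qed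


section \<open>Instances as graphs with numbered edges\<close>

lemma connected_graph_imp_connects:
  assumes c: "connected_graph V F" and sub: "\<And>e. e \<in> F \<Longrightarrow> e \<subseteq> V"
  shows "connects V (\<lambda>e. e) F"
proof (rule connectsI)
  show "V \<noteq> {}" using c unfolding connected_graph_def by blast
  fix S assume S: "S \<subseteq> V" "S \<noteq> {}" "S \<noteq> V"
  then obtain a b where ab: "a \<in> S" "b \<in> V" "b \<notin> S" by blast
  then have "(a, b) \<in> {(x, y). {x, y} \<in> F}\<^sup>*" using c S(1) unfolding connected_graph_def by auto
  then have "b \<notin> S \<longrightarrow> (\<exists>e\<in>F. e \<inter> S \<noteq> {} \<and> e \<inter> (V - S) \<noteq> {})"
  proof (induction rule: rtrancl_induct)
    case base
    then show ?case using ab(1) by simp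
  next
    case (step y z)
    show ?case
    proof (cases "y \<in> S")
      case True
      have yz: "{y, z} \<in> F" using step(2) by simp
      have "z \<in> V" using sub[OF yz] by simp
      then show ?thesis using True yz by (intro impI bexI[OF _ yz]) auto
    next
      case False
      then show ?thesis using step(3) by simp
    qed
  qed
  then show "\<exists>e\<in>F. e \<inter> S \<noteq> {} \<and> e \<inter> (V - S) \<noteq> {}" using ab(3) by simp
qed

lemma connects_imp_connected_graph:
  assumes c: "connects V (\<lambda>e. e) F" and sub: "\<And>e. e \<in> F \<Longrightarrow> e \<subseteq> V \<and> card e = 2"
  shows "connected_graph V F"
  unfolding connected_graph_def
proof (intro conjI ballI)
  show "V \<noteq> {}" using c unfolding connects_def by blast
  fix a b assume ab: "a \<in> V" "b \<in> V"
  define S where "S = {z\<in>V. (a, z) \<in> {(x, y). {x, y} \<in> F}\<^sup>*}"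
  have "S = V"
  proof (rule closed_all[OF c])
    show "S \<subseteq> V" "S \<noteq> {}" using ab unfolding S_def by auto
    fix e assume e: "e \<in> F" "e \<inter> S \<noteq> {}"
    then obtain z where z: "z \<in> e" "z \<in> S" by blast
    obtain t where t: "e = {z, t}" by (rule card_2_other[of e z]) (use sub[OF e(1)] z(1) in auto)
    then have "(z, t) \<in> {(x, y). {x, y} \<in> F}" using e(1) by simp
    then have "(a, t) \<in> {(x, y). {x, y} \<in> F}\<^sup>*"
      using z(2) unfolding S_def by (intro rtrancl_into_rtrancl[of a z _ t]) simp_all
    moreover have "t \<in> V" using sub[OF e(1)] t by simp
    ultimately have "t \<in> S" unfolding S_def by simp
    then show "e \<subseteq> S" using t z(2) by simp
  qed
  then show "(a, b) \<in> {(x, y). {x, y} \<in> F}\<^sup>*" using ab(2) unfolding S_def by blast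
qed

lemma connected_graph_iff:
  assumes "simple_graph V E" "F \<subseteq> E"
  shows "connected_graph V F \<longleftrightarrow> connects V (\<lambda>e. e) F"
proof -
  have "e \<subseteq> V \<and> card e = 2" if "e \<in> F" for e using assms that unfolding simple_graph_def by auto
  then show ?thesis using connected_graph_imp_connects connects_imp_connected_graph by metis
qed

lemma mgraph_of_instance:
  assumes V: "minpsc_graph V E" and fin: "finite I" and en: "bij_betw en I E"
  shows "mgraph V I en"
  unfolding mgraph_def
proof (intro conjI ballI)
  have s: "simple_graph V E" using V unfolding minpsc_graph_def by blast
  have "connects V (\<lambda>e. e) E"
    using V connected_graph_iff[OF s] unfolding minpsc_graph_def by blast
  then show "connects V en I" using bij_betw_imp_surj_on[OF en] unfolding connects_def by auto
  show "finite V" using s unfolding simple_graph_def by blast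
  fix i assume "i \<in> I"
  then have "en i \<in> E" using en bij_betwE by metis
  then show "en i \<subseteq> V" "card (en i) = 2" using s unfolding simple_graph_def by auto
qed (use fin bij_betw_imp_inj_on[OF en] in auto)

lemma instance_of_mgraph:
  assumes "mgraph V I en"
  shows "minpsc_graph V (en ` I)"
proof -
  note g = mgraphD[OF assms]
  have s: "simple_graph V (en ` I)" using g unfolding simple_graph_def by auto
  have "connects V (\<lambda>e. e) (en ` I)" using g(6) unfolding connects_def by auto
  then show ?thesis using s connected_graph_iff[OF s] unfolding minpsc_graph_def by auto
qed

text \<open>Edge sets correspond to index sets through \<open>en\<close>; \<open>Min\<close> and
  \<open>Inf\<close> agree because the set of costs is finite and, the graph being connected,
  nonempty.\<close>

lemma opt_eq_optval:
  assumes V: "minpsc_graph V E" and fin: "finite I" and en: "bij_betw en I E"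
    and W: "\<And>i. i \<in> I \<Longrightarrow> W (en i) = w i"
  shows "opt V E W = optval V I en w (\<lambda>_. 0)"
proof -
  have s: "simple_graph V E" using V unfolding minpsc_graph_def by blast
  have enI: "en ` I = E" by (rule bij_betw_imp_surj_on[OF en])
  have con: "connected_graph V (en ` J) \<longleftrightarrow> connects V en J" if "J \<subseteq> I" for J
    using connected_graph_iff[OF s, of "en ` J"] that enI unfolding connects_def by auto
  have cost: "power_cost V W (en ` J) = cost V en w (\<lambda>_. 0) J" if J: "J \<subseteq> I" for J
    unfolding power_cost_def cost_def pw_def
  proof (rule sum.cong[OF refl])
    fix v assume "v \<in> V"
    have "{W {a, v} |a. {a, v} \<in> en ` J} = W ` {e \<in> en ` J. v \<in> e}"
    proof (intro equalityI subsetI)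
      fix k assume "k \<in> W ` {e \<in> en ` J. v \<in> e}"
      then obtain e where e: "e \<in> en ` J" "v \<in> e" "k = W e" by blast
      then have "card e = 2" using s J enI unfolding simple_graph_def by blast
      then obtain a where "e = {a, v}" using e(2) unfolding card_2_iff by auto
      then show "k \<in> {W {a, v} |a. {a, v} \<in> en ` J}" using e by blast
    qed blast
    also have "\<dots> = w ` {i \<in> J. v \<in> en i}" using J W by (force simp: image_iff)
    finally show "Max (insert 0 {W {a, v} |a. {a, v} \<in> en ` J}) = Max (insert 0 (w ` {i \<in> J. v \<in> en i}))"
      by simp
  qed
  have "{F. F \<subseteq> E \<and> connected_graph V F} = (`) en ` {J. J \<subseteq> I \<and> connects V en J}"
  proof (intro equalityI subsetI)
    fix F assume "F \<in> {F. F \<subseteq> E \<and> connected_graph V F}"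
    then have F: "F \<subseteq> en ` I" "connected_graph V F" using enI by auto
    then obtain J where "J \<subseteq> I" "F = en ` J" by (meson subset_imageE)
    then show "F \<in> (`) en ` {J. J \<subseteq> I \<and> connects V en J}" using con F by blast
  qed (use con enI in blast)
  then have "power_cost V W ` {F. F \<subseteq> E \<and> connected_graph V F} =
      cost V en w (\<lambda>_. 0) ` {J. J \<subseteq> I \<and> connects V en J}"
    using cost by (auto simp: image_image image_iff)
  moreover have "finite (cost V en w (\<lambda>_. 0) ` {J. J \<subseteq> I \<and> connects V en J})" using fin by simp
  moreover have "{J. J \<subseteq> I \<and> connects V en J} \<noteq> {}"
    using mgraphD(6)[OF mgraph_of_instance[OF V fin en]] by blast
  ultimately show ?thesis unfolding opt_def optval_def by (simp add: cInf_eq_Min)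
qed

section \<open>Renumbering vertices and edges\<close>

text \<open>The two maps go in opposite directions, as in the program: \<open>num\<close> is the
  array of new vertex numbers, while \<open>sg\<close> tells from which old position a new edge was
  copied.\<close>

locale relabeling =
  fixes A :: "'v set" and I :: "'e set" and en :: "'e \<Rightarrow> 'v set" and w :: "'e \<Rightarrow> nat"
    and num :: "'v \<Rightarrow> 'u" and I' :: "'f set" and sg :: "'f \<Rightarrow> 'e"
    and en' :: "'f \<Rightarrow> 'u set" and w' :: "'f \<Rightarrow> nat"
  assumes g: "mgraph A I en" and num: "inj_on num A" and sg: "bij_betw sg I' I"
    and en': "\<And>j. j \<in> I' \<Longrightarrow> en' j = num ` en (sg j)" and w': "\<And>j. j \<in> I' \<Longrightarrow> w' j = w (sg j)"
begin

lemma sgI: "j \<in> I' \<Longrightarrow> sg j \<in> I"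
  using sg bij_betwE by metis

lemma sg_image: "sg ` I' = I"
  by (rule bij_betw_imp_surj_on[OF sg])

lemma num_mem_iff:
  assumes "v \<in> A" "j \<in> I'"
  shows "num v \<in> en' j \<longleftrightarrow> v \<in> en (sg j)"
  unfolding en'[OF assms(2)] by (rule inj_on_image_mem_iff[OF num assms(1) mgraphD(3)[OF g sgI[OF assms(2)]]])

lemma connects_relabel:
  assumes J: "J \<subseteq> I'"
  shows "connects (num ` A) en' J \<longleftrightarrow> connects A en (sg ` J)"
proof
  assume c: "connects (num ` A) en' J"
  show "connects A en (sg ` J)"
  proof (rule connectsI)
    show "A \<noteq> {}" using mgraphD(6)[OF g] unfolding connects_def by blast
    fix S assume S: "S \<subseteq> A" "S \<noteq> {}" "S \<noteq> A"
    then have "num ` S \<subseteq> num ` A" "num ` S \<noteq> {}" "num ` S \<noteq> num ` A"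
      using inj_on_image_eq_iff[OF num] by auto
    then obtain j where j: "j \<in> J" "en' j \<inter> num ` S \<noteq> {}" "en' j \<inter> (num ` A - num ` S) \<noteq> {}"
      using connectsE[OF c] by metis
    obtain a where a: "a \<in> S" "num a \<in> en' j" using j(2) by auto
    obtain b where b: "b \<in> A" "b \<notin> S" "num b \<in> en' j" using j(3) by auto
    have "j \<in> I'" using J j(1) by blast
    then have "a \<in> en (sg j)" "b \<in> en (sg j)" using num_mem_iff a b S(1) by blast+
    then show "\<exists>i\<in>sg ` J. en i \<inter> S \<noteq> {} \<and> en i \<inter> (A - S) \<noteq> {}" using a b j(1) by blast
  qed
next
  assume c: "connects A en (sg ` J)"
  show "connects (num ` A) en' J"
  proof (rule connectsI)
    show "num ` A \<noteq> {}" using mgraphD(6)[OF g] unfolding connects_def by blast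
    fix T assume T: "T \<subseteq> num ` A" "T \<noteq> {}" "T \<noteq> num ` A"
    define S where "S = {v\<in>A. num v \<in> T}"
    have "S \<subseteq> A" "S \<noteq> {}" "S \<noteq> A" using T unfolding S_def by auto
    then obtain i where i: "i \<in> sg ` J" "en i \<inter> S \<noteq> {}" "en i \<inter> (A - S) \<noteq> {}"
      by (rule connectsE[OF c])
    obtain j where j: "j \<in> J" "i = sg j" using i(1) by blast
    obtain a where a: "a \<in> en i" "a \<in> A" "num a \<in> T" using i(2) unfolding S_def by auto
    obtain b where b: "b \<in> en i" "b \<in> A" "num b \<notin> T" using i(3) unfolding S_def by auto
    have "j \<in> I'" using J j(1) by blast
    then have "num a \<in> en' j" "num b \<in> en' j" using num_mem_iff a b j(2) by blast+
    then have "en' j \<inter> T \<noteq> {} \<and> en' j \<inter> (num ` A - T) \<noteq> {}" using a b by blast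
    then show "\<exists>j\<in>J. en' j \<inter> T \<noteq> {} \<and> en' j \<inter> (num ` A - T) \<noteq> {}" using j(1) by blast
  qed
qed

lemma cost_relabel:
  assumes J: "J \<subseteq> I'"
  shows "cost (num ` A) en' w' (\<lambda>_. 0) J = cost A en w (\<lambda>_. 0) (sg ` J)"
  unfolding cost_def pw_def sum.reindex[OF num] comp_def
proof (rule sum.cong[OF refl])
  fix v assume v: "v \<in> A"
  have m: "num v \<in> en' j \<longleftrightarrow> v \<in> en (sg j)" if "j \<in> J" for j using num_mem_iff[OF v] J that by blast
  have "{i \<in> sg ` J. v \<in> en i} = sg ` {j \<in> J. num v \<in> en' j}"
    by (auto simp: m)
  moreover have "w' ` {j \<in> J. num v \<in> en' j} = (\<lambda>j. w (sg j)) ` {j \<in> J. num v \<in> en' j}"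
    by (rule image_cong) (use w' J in auto)
  ultimately have "w' ` {j \<in> J. num v \<in> en' j} = w ` {i \<in> sg ` J. v \<in> en i}"
    by (simp only: image_image)
  then show "Max (insert 0 (w' ` {j \<in> J. num v \<in> en' j})) = Max (insert 0 (w ` {i \<in> sg ` J. v \<in> en i}))"
    by simp
qed

lemma mgraph_relabel: "mgraph (num ` A) I' en'"
  unfolding mgraph_def
proof (intro conjI ballI)
  note G = mgraphD[OF g]
  show "finite (num ` A)" using G(1) by simp
  show "connects (num ` A) en' I'" using connects_relabel[of I'] G(6) sg_image by simp
  show "finite I'" using G(2) bij_betw_finite[OF sg] by simp
  show "inj_on en' I'"
  proof (rule inj_onI)
    fix i j assume ij: "i \<in> I'" "j \<in> I'" "en' i = en' j"
    then have "num ` en (sg i) = num ` en (sg j)" using en' by simp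
    then have "en (sg i) = en (sg j)"
      using inj_on_image_eq_iff[OF num G(3)[OF sgI[OF ij(1)]] G(3)[OF sgI[OF ij(2)]]] by simp
    then have "sg i = sg j" using inj_onD[OF G(5)] sgI ij by blast
    then show "i = j" using inj_onD[OF bij_betw_imp_inj_on[OF sg]] ij by blast
  qed
  fix j assume j: "j \<in> I'"
  show "en' j \<subseteq> num ` A" using en'[OF j] G(3)[OF sgI[OF j]] by auto
  have "inj_on num (en (sg j))" using num G(3)[OF sgI[OF j]] by (rule inj_on_subset)
  then show "card (en' j) = 2" using en'[OF j] G(4)[OF sgI[OF j]] by (simp add: card_image)
qed

lemma optval_relabel: "optval (num ` A) I' en' w' (\<lambda>_. 0) = optval A I en w (\<lambda>_. 0)"
proof -
  have "{J. J \<subseteq> I \<and> connects A en J} = (`) sg ` {J. J \<subseteq> I' \<and> connects (num ` A) en' J}"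
  proof (intro equalityI subsetI)
    fix K assume "K \<in> {J. J \<subseteq> I \<and> connects A en J}"
    then have K: "K \<subseteq> sg ` I'" "connects A en K" using sg_image by auto
    then obtain J where "J \<subseteq> I'" "K = sg ` J" by (meson subset_imageE)
    then show "K \<in> (`) sg ` {J. J \<subseteq> I' \<and> connects (num ` A) en' J}" using connects_relabel K by blast
  qed (use connects_relabel sgI in blast)
  moreover have "cost A en w (\<lambda>_. 0) ` (`) sg ` {J. J \<subseteq> I' \<and> connects (num ` A) en' J} =
      cost (num ` A) en' w' (\<lambda>_. 0) ` {J. J \<subseteq> I' \<and> connects (num ` A) en' J}"
    unfolding image_image by (rule image_cong) (use cost_relabel in auto)
  ultimately show ?thesis unfolding optval_def by simp
qed

end

section \<open>Forests and the feedback edge number\<close>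

text \<open>All neighbours of the first vertex of a longest path lie on that path, and an edge from
  there to a vertex other than the second one closes a cycle.\<close>

lemma min_degree_cycle:
  assumes V: "finite V" "V \<noteq> {}" and E: "\<And>e. e \<in> E \<Longrightarrow> e \<subseteq> V \<and> card e = 2"
    and deg: "\<And>v. v \<in> V \<Longrightarrow> 2 \<le> card {e\<in>E. v \<in> e}"
  shows "\<exists>vs. is_cycle E vs"
proof -
  define P where "P vs \<longleftrightarrow> vs \<noteq> [] \<and> distinct vs \<and> set vs \<subseteq> V \<and>
    (\<forall>i. Suc i < length vs \<longrightarrow> {vs ! i, vs ! Suc i} \<in> E)" for vs
  obtain v where "v \<in> V" using V by blast
  then have "P [v]" unfolding P_def by simp
  moreover have "length vs < Suc (card V)" if "P vs" for vs
    using that V(1) unfolding P_def by (metis card_mono distinct_card le_imp_less_Suc)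
  ultimately obtain vs where vs: "P vs" "\<And>us. P us \<Longrightarrow> length us \<le> length vs"
    using ex_has_greatest_nat[of P "[v]" length "Suc (card V)"] by blast
  define v0 where "v0 = vs ! 0"
  have v0: "v0 \<in> set vs" "v0 \<in> V" using vs(1) unfolding P_def v0_def by auto
  have nb: "x \<in> set vs" if e: "{v0, x} \<in> E" for x
  proof (rule ccontr)
    assume x: "x \<notin> set vs"
    have "P (x # vs)"
      unfolding P_def
    proof (intro conjI allI impI)
      show "set (x # vs) \<subseteq> V" using vs(1) E[OF e] unfolding P_def by auto
      fix i assume "Suc i < length (x # vs)"
      then show "{(x # vs) ! i, (x # vs) ! Suc i} \<in> E"
        using vs(1) e unfolding P_def v0_def by (cases i) (auto simp: insert_commute)
    qed (use vs(1) x in \<open>auto simp: P_def\<close>)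
    then show False using vs(2) by fastforce
  qed
  \<comment> \<open>If the path is a single vertex, \<open>vs ! 1\<close> is unspecified; still at
    most one of the edges at \<open>v0\<close> equals \<open>{v0, vs ! 1}\<close>, and there are at
    least two.\<close>
  have "\<exists>e\<in>E. v0 \<in> e \<and> e \<noteq> {v0, vs ! 1}"
  proof (rule ccontr)
    assume "\<not> ?thesis"
    then have "{e\<in>E. v0 \<in> e} \<subseteq> {{v0, vs ! 1}}" by blast
    then have "card {e\<in>E. v0 \<in> e} \<le> 1" using card_mono[of "{{v0, vs ! 1}}"] by simp
    then show False using deg[OF v0(2)] by simp
  qed
  then obtain e where e: "e \<in> E" "v0 \<in> e" "e \<noteq> {v0, vs ! 1}" by blast
  obtain x where x: "e = {v0, x}" "x \<noteq> v0" by (rule card_2_other[of e v0]) (use e E in auto)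
  obtain i where i: "i < length vs" "vs ! i = x" using nb e x by (metis in_set_conv_nth)
  have i2: "2 \<le> i"
  proof -
    have "i \<noteq> 0" using i(2) x(2) v0_def by metis
    moreover have "i \<noteq> 1" using i(2) x(1) e(3) by auto
    ultimately show ?thesis by simp
  qed
  have "is_cycle E (take (Suc i) vs)"
    unfolding is_cycle_def
  proof (intro conjI allI impI)
    show "3 \<le> length (take (Suc i) vs)" using i i2 by simp
    show "distinct (take (Suc i) vs)" using vs(1) unfolding P_def by simp
    fix j assume j: "j < length (take (Suc i) vs)"
    have len: "length (take (Suc i) vs) = Suc i" using i by simp
    show "{take (Suc i) vs ! j, take (Suc i) vs ! (Suc j mod length (take (Suc i) vs))} \<in> E"
    proof (cases "j = i")
      case True
      then show ?thesis using len i x(1) e(1) unfolding v0_def by (simp add: insert_commute)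
    next
      case False
      then have ji: "j < i" using j len by simp
      then have "{vs ! j, vs ! Suc j} \<in> E" using vs(1) i(1) unfolding P_def by simp
      then show ?thesis using ji len by simp
    qed
  qed
  then show ?thesis by blast
qed

text \<open>Without cycles some vertex meets at most one edge, and deleting it loses one vertex and
  at most one edge.\<close>

lemma forest_card:
  assumes "finite V" "V \<noteq> {}" "\<And>e. e \<in> E \<Longrightarrow> e \<subseteq> V \<and> card e = 2" "forest E"
  shows "card E < card V"
  using assms
proof (induction "card V" arbitrary: V E rule: less_induct)
  case less
  obtain v where v: "v \<in> V" "card {e\<in>E. v \<in> e} < 2"
    using min_degree_cycle[OF less.prems(1-3)] less.prems(4) unfolding forest_def by (meson not_le)
  show ?case
  proof (cases "V = {v}")
    case True
    have "E = {}"
    proof (rule ccontr)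
      assume "E \<noteq> {}"
      then obtain e where "e \<subseteq> {v}" "card e = 2" using less.prems(3) True by blast
      then show False using card_mono[of "{v}" e] by simp
    qed
    then show ?thesis using True by simp
  next
    case False
    let ?E = "{e\<in>E. v \<notin> e}"
    have "is_cycle E vs" if "is_cycle ?E vs" for vs using that unfolding is_cycle_def by auto
    then have f: "forest ?E" using less.prems(4) unfolding forest_def by blast
    have c: "card (V - {v}) = card V - 1" "card V > 0"
      using v(1) less.prems(1) by (auto simp: card_gt_0_iff)
    have "card ?E < card (V - {v})"
      by (rule less.hyps) (use c v(1) less.prems(1,3) f False in auto)
    moreover have "E = ?E \<union> {e\<in>E. v \<in> e}" by blast
    then have "card E \<le> card ?E + card {e\<in>E. v \<in> e}" by (metis card_Un_le)
    ultimately show ?thesis using v(2) c by linarith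
  qed
qed

text \<open>Deleting a smallest feedback edge set leaves a forest. This bounds \<open>m - n\<close>,
  which the reductions preserve, by the feedback edge number minus one.\<close>

lemma feedback_edge_number_ge:
  fixes V :: "'a set"
  assumes "minpsc_graph V E"
  shows "card E < feedback_edge_number E + card V"
proof -
  have V: "finite V" "V \<noteq> {}" and E: "\<And>e. e \<in> E \<Longrightarrow> e \<subseteq> V \<and> card e = 2"
    using assms unfolding minpsc_graph_def simple_graph_def connected_graph_def by auto
  have finE: "finite E" using E by (intro finite_subset[of E "Pow V"]) (auto simp: V(1))
  have "\<not> is_cycle ({} :: 'a set set) vs" for vs unfolding is_cycle_def by (cases vs) auto
  then have "forest ({} :: 'a set set)" unfolding forest_def by simp
  then have "E \<in> {S. S \<subseteq> E \<and> forest (E - S)}" by simp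
  then have "feedback_edge_number E \<in> card ` {S. S \<subseteq> E \<and> forest (E - S)}"
    unfolding feedback_edge_number_def using finE by (intro Min_in) auto
  then obtain S where S: "S \<subseteq> E" "forest (E - S)" "feedback_edge_number E = card S" by blast
  have "card (E - S) < card V" by (rule forest_card) (use V E S in auto)
  moreover have "card (E - S) = card E - card S" "card S \<le> card E"
    using card_Diff_subset[OF finite_subset[OF S(1) finE] S(1)] card_mono[OF finE S(1)] by simp_all
  ultimately show ?thesis using S(3) by simp
qed


section \<open>Walking without adjacency lists\<close>

text \<open>The degree and the sum of the incident edge numbers of a vertex suffice to find the only edge
  at a vertex of degree one, and to leave a vertex of degree two by the other edge.\<close>

locale arrays =
  fixes t h g e :: "nat \<Rightarrow> nat"
begin

definition "opp i v = t i + h i - v"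
definition "nxt v i = e v - i"
definition "e1 i = nxt (t i) i"
definition "v1 i = opp (e1 i) (t i)"
definition "e3 i = nxt (h i) i"
definition "v4 i = opp (e3 i) (h i)"
definition "e4 i = nxt (v4 i) (e3 i)"
definition "v5 i = opp (e4 i) (v4 i)"
definition "e0 i = nxt (v1 i) (e1 i)"
definition "e5 i = nxt (v5 i) (e4 i)"

text \<open>The path is numbered so that \<open>t i\<close>, \<open>i\<close> and \<open>h i\<close>
  stand for the missing \<open>v2\<close>, \<open>e2\<close> and \<open>v3\<close>. The inequalities
  that are not tested follow because there are no loops and no parallel edges.\<close>

definition "is_window i \<longleftrightarrow> g (t i) = 2 \<and> g (h i) = 2 \<and> g (v1 i) = 2 \<and> g (v4 i) = 2 \<and> g (v5 i) = 2 \<and>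
  v1 i \<noteq> v4 i \<and> v1 i \<noteq> v5 i"

end

locale incidence = arrays t h g e
  for A I :: "nat set" and t h g e :: "nat \<Rightarrow> nat" +
  assumes G: "mgraph A I (\<lambda>i. {t i, h i})"
    and deg: "\<And>v. g v = card (inc I (\<lambda>i. {t i, h i}) v)"
    and esum: "\<And>v. e v = \<Sum>(inc I (\<lambda>i. {t i, h i}) v)"
begin

abbreviation "en \<equiv> \<lambda>i. {t i, h i}"

lemma opp:
  assumes "i \<in> I" "v \<in> {t i, h i}"
  shows "{t i, h i} = {v, opp i v}" "opp i v \<noteq> v"
  using mgraphD(4)[OF G assms(1)] assms(2) unfolding opp_def by (auto split: if_splits simp: card_insert_if)

lemma nxt:
  assumes "i \<in> I" "v \<in> {t i, h i}" "g v = 2"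
  shows "inc I en v = {i, nxt v i}" "nxt v i \<noteq> i"
proof -
  have i: "i \<in> inc I en v" using assms unfolding inc_def by simp
  obtain j where j: "inc I en v = {i, j}" "j \<noteq> i"
    by (rule card_2_other[of "inc I en v" i]) (use i assms(3) deg[of v] in auto)
  then have "nxt v i = j" unfolding nxt_def esum by simp
  then show "inc I en v = {i, nxt v i}" "nxt v i \<noteq> i" using j by auto
qed

lemma walk:
  assumes "i \<in> I" "v \<in> {t i, h i}" "g v = 2"
  shows "nxt v i \<in> I" "{t (nxt v i), h (nxt v i)} = {v, opp (nxt v i) v}" "opp (nxt v i) v \<noteq> v"
proof -
  have *: "nxt v i \<in> I \<and> v \<in> {t (nxt v i), h (nxt v i)}"
    using nxt(1)[OF assms] unfolding inc_def by blast
  then show "nxt v i \<in> I" by blast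
  show "{t (nxt v i), h (nxt v i)} = {v, opp (nxt v i) v}" "opp (nxt v i) v \<noteq> v" using * opp by blast+
qed

lemma step1:
  assumes "i \<in> I" "g (t i) = 2"
  shows "e1 i \<in> I" "{t (e1 i), h (e1 i)} = {t i, v1 i}" "v1 i \<noteq> t i" "e1 i \<noteq> i" "inc I en (t i) = {e1 i, i}"
  using walk[of i "t i"] nxt[of i "t i"] assms unfolding e1_def v1_def by (auto simp: insert_commute)

lemma step3:
  assumes "i \<in> I" "g (h i) = 2"
  shows "e3 i \<in> I" "{t (e3 i), h (e3 i)} = {h i, v4 i}" "v4 i \<noteq> h i" "e3 i \<noteq> i" "inc I en (h i) = {i, e3 i}"
  using walk[of i "h i"] nxt[of i "h i"] assms unfolding e3_def v4_def by auto

lemma step4: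
  assumes "i \<in> I" "g (h i) = 2" "g (v4 i) = 2"
  shows "e4 i \<in> I" "{t (e4 i), h (e4 i)} = {v4 i, v5 i}" "v5 i \<noteq> v4 i" "e4 i \<noteq> e3 i"
    "inc I en (v4 i) = {e3 i, e4 i}"
  using walk[of "e3 i" "v4 i"] nxt[of "e3 i" "v4 i"] step3[OF assms(1,2)] assms(3)
  unfolding e4_def v5_def by auto

lemma step0:
  assumes "i \<in> I" "g (t i) = 2" "g (v1 i) = 2"
  shows "e0 i \<noteq> e1 i" "inc I en (v1 i) = {e0 i, e1 i}"
  using nxt[of "e1 i" "v1 i"] step1[OF assms(1,2)] assms(3) unfolding e0_def by auto

lemma step5:
  assumes "i \<in> I" "g (h i) = 2" "g (v4 i) = 2" "g (v5 i) = 2"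
  shows "e5 i \<noteq> e4 i" "inc I en (v5 i) = {e4 i, e5 i}"
  using nxt[of "e4 i" "v5 i"] step4[OF assms(1-3)] assms(4) unfolding e5_def by auto

lemma edge_inj: "i \<in> I \<Longrightarrow> j \<in> I \<Longrightarrow> {t i, h i} = {t j, h j} \<Longrightarrow> i = j"
  using mgraphD(5)[OF G] by (auto simp: inj_on_def)

lemma loop_free: "i \<in> I \<Longrightarrow> t i \<noteq> h i"
  using mgraphD(4)[OF G, of i] by (auto simp: card_insert_if split: if_splits)

lemma closed_good:
  assumes S: "S \<subseteq> A" "S \<noteq> {}" "card S \<le> 4" "\<And>v. v \<in> S \<Longrightarrow> g v = 2 \<and> (\<forall>j\<in>inc I en v. {t j, h j} \<subseteq> S)"
  shows "good A I en i"
proof -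
  have "S = A"
    by (rule closed_all[OF mgraphD(6)[OF G] S(1,2)]) (use S(4) in \<open>auto simp: inc_def\<close>)
  then show ?thesis using S(3,4) deg unfolding good_def by simp
qed

lemma mem_A: "i \<in> I \<Longrightarrow> t i \<in> A" "i \<in> I \<Longrightarrow> h i \<in> A"
  using mgraphD(3)[OF G] by auto

text \<open>If a tested degree is not two, the place of the vertex gives the distance: zero at the
  ends of \<open>i\<close>, one at \<open>v1 i\<close> and \<open>v4 i\<close>, two at
  \<open>v5 i\<close>. Otherwise \<open>v1 i = v4 i\<close> closes a triangle or
  \<open>v1 i = v5 i\<close> a cycle on four vertices, which by connectivity is the whole
  graph.\<close>

lemma not_window_good:
  assumes i: "i \<in> I" and nw: "\<not> is_window i"
  shows "good A I en i"
proof -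
  have near0: "near I en 0 j" if "v \<in> {t j, h j}" "g v \<noteq> 2" for v j using that deg by auto
  have near1: "near I en (Suc k) j" if "near I en k j'" "j' \<in> I" "v \<in> {t j, h j}" "v \<in> {t j', h j'}" for k j j' v
    unfolding near.simps using that by blast
  have near_mono: "near I en k j \<Longrightarrow> near I en (Suc k) j" for k j by simp
  have good: "near I en (Suc (Suc 0)) j \<Longrightarrow> good A I en j" for j unfolding good_def by (simp add: numeral_2_eq_2)
  show ?thesis
  proof (cases "g (t i) = 2 \<and> g (h i) = 2")
    case False
    then have "near I en 0 i" using near0[of "t i" i] near0[of "h i" i] by blast
    then show ?thesis using good near_mono by blast
  next
    case True
    note s1 = step1[OF i] and s3 = step3[OF i]
    show ?thesis
    proof (cases "g (v1 i) = 2 \<and> g (v4 i) = 2")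
      case False
      then consider "g (v1 i) \<noteq> 2" | "g (v4 i) \<noteq> 2" by blast
      then have "near I en (Suc 0) i"
      proof cases
        case 1
        then have "near I en 0 (e1 i)" using near0[of "v1 i" "e1 i"] s1(2) True by simp
        then show ?thesis by (rule near1[of _ _ "t i"]) (use s1 True in auto)
      next
        case 2
        then have "near I en 0 (e3 i)" using near0[of "v4 i" "e3 i"] s3(2) True by simp
        then show ?thesis by (rule near1[of _ _ "h i"]) (use s3 True in auto)
      qed
      then show ?thesis using good near_mono by blast
    next
      case d14: True
      note s4 = step4[OF i]
      show ?thesis
      proof (cases "g (v5 i) = 2")
        case False
        have "near I en 0 (e4 i)" using near0[of "v5 i" "e4 i"] False s4(2) True d14 by simp
        then have "near I en (Suc 0) (e3 i)"
          by (rule near1[of _ _ "v4 i"]) (use s3(2) s4(1,2) True d14 in auto)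
        then have "near I en (Suc (Suc 0)) i"
          by (rule near1[of _ _ "h i"]) (use s3 True in auto)
        then show ?thesis by (rule good)
      next
        case d5: True
        note S1 = s1[OF conjunct1[OF True]] and S3 = s3[OF conjunct2[OF True]]
        note S4 = s4[OF conjunct2[OF True] conjunct2[OF d14]]
        have A: "v1 i \<in> A" "t i \<in> A" "h i \<in> A" "v4 i \<in> A"
          using mem_A[OF i] mgraphD(3)[OF G S1(1)] mgraphD(3)[OF G S3(1)] S1(2) S3(2) by auto
        from nw consider "v1 i = v4 i" | "v1 i \<noteq> v4 i" "v1 i = v5 i"
          using True d14 d5 unfolding is_window_def by blast
        then show ?thesis
        proof cases
          case 1
          have "e1 i \<in> inc I en (v4 i)" using S1(1,2) 1 unfolding inc_def by auto
          moreover have "e1 i \<noteq> e3 i"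
          proof
            assume "e1 i = e3 i"
            then have "{t i, v1 i} = {h i, v1 i}" using S1(2) S3(2) 1 by simp
            then show False using loop_free[OF i] S1(3) by (auto simp: doubleton_eq_iff)
          qed
          ultimately have "e1 i = e4 i" using S4(5) by auto
          then have "inc I en (v4 i) = {e3 i, e1 i}" using S4(5) by simp
          then show ?thesis
            using S1 S3 A 1 True d14 i
            by (intro closed_good[of "{v1 i, t i, h i}"]) (auto simp: card_insert_if)
        next
          case 2
          have "e1 i \<in> inc I en (v5 i)" "e4 i \<in> inc I en (v5 i)"
            using S1(1,2) S4(1,2) 2 unfolding inc_def by auto
          moreover have "e1 i \<noteq> e4 i"
          proof
            assume *: "e1 i = e4 i"
            then have "{t i, v1 i} = {v4 i, v1 i}" using S1(2) S4(2) 2 by simp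
            then have "t i = v4 i" using 2(1) by (auto simp: doubleton_eq_iff)
            then have "{t i, h i} = {t (e3 i), h (e3 i)}" using S3(2) by auto
            then show False using edge_inj[OF i S3(1)] S3(4) by simp
          qed
          ultimately have "inc I en (v5 i) = {e1 i, e4 i}"
            using d5 deg[of "v5 i"] by (intro card_2_pair) auto
          then show ?thesis
            using S1 S3 S4 A 2 True d14 d5 i
            by (intro closed_good[of "{v1 i, t i, h i, v4 i}"]) (auto simp: card_insert_if)
        qed
      qed
    qed
  qed
qed

text \<open>The same path is read in both directions. The middle vertex \<open>h i\<close> is
  \<open>x\<close> both times; the vertex to be bypassed is \<open>v4 i\<close> in the first reading
  and \<open>t i\<close> in the second.\<close>

lemma windows:
  assumes i: "i \<in> I" and w: "is_window i"
  shows "window A I en (v1 i) (t i) (h i) (v4 i) (v5 i) (e0 i) (e1 i) i (e3 i) (e4 i) (e5 i)"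
    and "window A I en (v5 i) (v4 i) (h i) (t i) (v1 i) (e5 i) (e4 i) (e3 i) i (e1 i) (e0 i)"
proof -
  have d: "g (t i) = 2" "g (h i) = 2" "g (v1 i) = 2" "g (v4 i) = 2" "g (v5 i) = 2"
    and ne: "v1 i \<noteq> v4 i" "v1 i \<noteq> v5 i" using w unfolding is_window_def by auto
  note S1 = step1[OF i d(1)] and S3 = step3[OF i d(2)] and S4 = step4[OF i d(2,4)]
    and S0 = step0[OF i d(1,3)] and S5 = step5[OF i d(2,4,5)]
  have n: "t i \<noteq> h i" by (rule loop_free[OF i])
  have "v1 i \<noteq> h i"
  proof
    assume "v1 i = h i"
    then have "{t i, h i} = {t (e1 i), h (e1 i)}" using S1(2) by simp
    then show False using edge_inj[OF i S1(1)] S1(4) by simp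
  qed
  moreover have "v4 i \<noteq> t i"
  proof
    assume "v4 i = t i"
    then have "{t i, h i} = {t (e3 i), h (e3 i)}" using S3(2) by auto
    then show False using edge_inj[OF i S3(1)] S3(4) by simp
  qed
  moreover have "v5 i \<noteq> h i"
  proof
    assume "v5 i = h i"
    then have "{t (e3 i), h (e3 i)} = {t (e4 i), h (e4 i)}" using S3(2) S4(2) by auto
    then show False using edge_inj[OF S3(1) S4(1)] S4(4) by simp
  qed
  \<comment> \<open>Otherwise \<open>e4 i\<close> is one of the two edges at \<open>t i\<close>,
    whose other ends \<open>v1 i\<close> and \<open>h i\<close> both differ from
    \<open>v4 i\<close>.\<close>
  moreover have "v5 i \<noteq> t i"
  proof
    assume *: "v5 i = t i"
    then have "e4 i \<in> inc I en (t i)" using S4(1,2) unfolding inc_def by auto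
    then have "e4 i = e1 i \<or> e4 i = i" using S1(5) by auto
    then show False
    proof
      assume "e4 i = e1 i"
      then have "{t i, v1 i} = {v4 i, t i}" using S1(2) S4(2) * by simp
      then show False using ne(1) S1(3) by (auto simp: doubleton_eq_iff)
    next
      assume "e4 i = i"
      then have "{t i, h i} = {v4 i, t i}" using S4(2) * by simp
      then show False using S3(3) n by (auto simp: doubleton_eq_iff)
    qed
  qed
  ultimately have dist: "distinct [v1 i, t i, h i, v4 i, v5 i]"
    using n ne S1(3) S3(3) S4(3) by auto
  then have dist': "distinct [v5 i, v4 i, h i, t i, v1 i]" by auto
  show "window A I en (v1 i) (t i) (h i) (v4 i) (v5 i) (e0 i) (e1 i) i (e3 i) (e4 i) (e5 i)"
  proof
    show "{t (e1 i), h (e1 i)} = {v1 i, t i}" by (rule trans[OF S1(2) insert_commute])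
  qed (fact G S3(2) S4(2) dist S0(2) S1(5) S3(5) S4(5) S5 refl)+
  show "window A I en (v5 i) (v4 i) (h i) (t i) (v1 i) (e5 i) (e4 i) (e3 i) i (e1 i) (e0 i)"
  proof
    show "{t (e4 i), h (e4 i)} = {v5 i, v4 i}" by (rule trans[OF S4(2) insert_commute])
    show "{t (e3 i), h (e3 i)} = {v4 i, h i}" by (rule trans[OF S3(2) insert_commute])
    show "{t i, h i} = {h i, t i}" by (rule insert_commute)
    show "inc I en (v5 i) = {e5 i, e4 i}" by (rule trans[OF S5(2) insert_commute])
    show "inc I en (v4 i) = {e4 i, e3 i}" by (rule trans[OF S4(5) insert_commute])
    show "inc I en (h i) = {e3 i, i}" by (rule trans[OF S3(5) insert_commute])
    show "inc I en (t i) = {i, e1 i}" by (rule trans[OF S1(5) insert_commute])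
    show "inc I en (v1 i) = {e1 i, e0 i}" by (rule trans[OF S0(2) insert_commute])
  qed (fact G S1(2) dist' S0(1))+
qed

end

section \<open>The invariant of the reductions\<close>

text \<open>The numbers below \<open>n\<close> without a deletion mark; used for vertices with
  \<open>X\<close> and for edges with \<open>Y\<close>.\<close>

definition verts :: "nat \<Rightarrow> (nat \<Rightarrow> nat) \<Rightarrow> nat set" where
  "verts n X = {v. v < n \<and> X v = 0}"

text \<open>The invariant \<open>\<Sum> l \<le> d\<close> is what allows the lower bounds to be paid for by pendant edges.\<close>

definition core :: "nat \<Rightarrow> nat \<Rightarrow> nat \<Rightarrow> (nat \<Rightarrow> nat) \<Rightarrow> (nat \<Rightarrow> nat) \<Rightarrow> (nat \<Rightarrow> nat) \<Rightarrow> (nat \<Rightarrow> nat) \<Rightarrow>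
    (nat \<Rightarrow> nat) \<Rightarrow> (nat \<Rightarrow> nat) \<Rightarrow> (nat \<Rightarrow> nat) \<Rightarrow> (nat \<Rightarrow> nat) \<Rightarrow> nat \<Rightarrow> bool" where
  "core n m K t h w l g e X Y d \<longleftrightarrow>
     incidence (verts n X) (verts m Y) t h g e \<and>
     optval (verts n X) (verts m Y) (\<lambda>i. {t i, h i}) w l + d = K \<and>
     (\<Sum>v\<in>verts n X. l v) \<le> d \<and> card (verts m Y) + n = card (verts n X) + m"

lemma verts_upd: "verts n (X(v := Suc k)) = verts n X - {v}"
  unfolding verts_def by auto

lemma finite_verts [simp]: "finite (verts n X)"
  unfolding verts_def by simp

lemma core_peel:
  assumes c: "core n m K t h w l g e X Y d" and v: "g v = 1"
  defines "a \<equiv> e v" and "b \<equiv> t (e v) + h (e v) - v"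
  shows "core n m K t h w (l(b := max (l b) (w a))) (g(v := 0, b := g b - 1)) (e(v := 0, b := e b - a))
      (X(v := 1)) (Y(a := 1)) (d + max (l v) (w a))"
    and "b \<noteq> v" "b < n" "a \<in> verts m Y"
proof -
  let ?A = "verts n X" and ?I = "verts m Y" and ?en = "\<lambda>i. {t i, h i}"
  interpret incidence ?A ?I t h g e using c unfolding core_def by blast
  obtain i where i: "inc ?I ?en v = {i}" using v deg[of v] by (metis card_1_singletonE)
  then have ai: "a = i" unfolding a_def esum by simp
  have a: "a \<in> ?I" "v \<in> ?en a" using i ai unfolding inc_def by blast+
  then show "a \<in> ?I" by blast
  have bo: "b = opp a v" unfolding b_def a_def opp_def ..
  have ab: "?en a = {v, b}" "b \<noteq> v" unfolding bo using opp[OF a] by auto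
  show "b \<noteq> v" by (rule ab(2))
  interpret leaf ?A ?I ?en v b a
    by unfold_locales (use G i ai ab in auto)
  show "b < n" using mem(2) unfolding verts_def by blast
  have inc': "inc (?I - {a}) ?en u = inc ?I ?en u - {a}" for u unfolding inc_def by auto
  have fin: "finite (inc ?I ?en u)" for u unfolding inc_def by simp
  have mem_a: "a \<in> inc ?I ?en u \<longleftrightarrow> u = v \<or> u = b" for u using a(1) ab(1) unfolding inc_def by auto
  have A': "verts n (X(v := 1)) = ?A - {v}" "verts m (Y(a := 1)) = ?I - {a}"
    using verts_upd[of _ _ _ 0] by simp_all
  have "incidence (?A - {v}) (?I - {a}) t h (g(v := 0, b := g b - 1)) (e(v := 0, b := e b - a))"
  proof
    show "mgraph (?A - {v}) (?I - {a}) ?en" by (rule mgraph_peel)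
    fix u
    show "(g(v := 0, b := g b - 1)) u = card (inc (?I - {a}) ?en u)"
      unfolding inc' using deg[of u] mem_a[of u] i ai fin[of u] by (auto simp: card_Diff_singleton)
    show "(e(v := 0, b := e b - a)) u = \<Sum>(inc (?I - {a}) ?en u)"
      unfolding inc' using esum[of u] mem_a[of u] i ai fin[of u] by (auto simp: sum_diff1_nat)
  qed
  moreover have "optval (?A - {v}) (?I - {a}) ?en w (l(b := max (l b) (w a))) + (d + max (l v) (w a)) = K"
    using c optval_peel[of w l] unfolding core_def by simp
  moreover have "(\<Sum>u\<in>?A - {v}. (l(b := max (l b) (w a))) u) \<le> d + max (l v) (w a)"
  proof -
    have "(\<Sum>u\<in>?A - {v}. (l(b := max (l b) (w a))) u) =
        max (l b) (w a) + (\<Sum>u\<in>?A - {v} - {b}. (l(b := max (l b) (w a))) u)"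
      using mem ab(2) by (subst sum.remove[of _ b]) auto
    also have "(\<Sum>u\<in>?A - {v} - {b}. (l(b := max (l b) (w a))) u) = (\<Sum>u\<in>?A - {v} - {b}. l u)"
      by (rule sum.cong) auto
    \<comment> \<open>The bound at \<open>b\<close> grows by at most \<open>w a\<close>, while
      \<open>d\<close> grows by at least \<open>w a\<close>.\<close>
    also have "max (l b) (w a) + (\<Sum>u\<in>?A - {v} - {b}. l u) \<le> w a + (\<Sum>u\<in>?A - {v}. l u)"
      using mem ab(2) by (subst (2) sum.remove[of _ b]) auto
    also have "(\<Sum>u\<in>?A - {v}. l u) \<le> (\<Sum>u\<in>?A. l u)" by (rule sum_mono2) auto
    finally show ?thesis using c unfolding core_def by linarith
  qed
  moreover have "card (?I - {a}) + n = card (?A - {v}) + m"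
  proof -
    have "card ?I = Suc (card (?I - {a}))" "card ?A = Suc (card (?A - {v}))"
      using mem(1) a(1) by (simp_all only: card_Suc_Diff1 finite_verts)
    then show ?thesis using c unfolding core_def by simp
  qed
  ultimately show "core n m K t h w (l(b := max (l b) (w a))) (g(v := 0, b := g b - 1))
      (e(v := 0, b := e b - a)) (X(v := 1)) (Y(a := 1)) (d + max (l v) (w a))"
    unfolding core_def A' by blast
qed

lemma core_contract:
  assumes c: "core n m K t h w l g e X Y d"
    and win: "window (verts n X) (verts m Y) (\<lambda>i. {t i, h i}) v1 v2 x u y e0 s r p q z"
    and best: "max (saving w l x r p q u) (saving w l u p q z y) \<le>
      max (saving w l v1 e0 s r v2) (saving w l v2 s r p x)"
  shows "core n m K (t(p := x)) (h(p := y)) (w(p := min (w p) (w q)))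
      (if w q < w p then l(x := max (l x) (w p)) else l(y := max (l y) (w q)))
      (g(u := 0)) (e(u := 0, y := e y + p - q)) (X(u := 1)) (Y(q := 1))
      (d + max (l u) (max (w p) (w q)))"
proof -
  let ?A = "verts n X" and ?I = "verts m Y" and ?en = "\<lambda>i. {t i, h i}"
  interpret incidence ?A ?I t h g e using c unfolding core_def by blast
  interpret window ?A ?I ?en v1 v2 x u y e0 s r p q z by (rule win)
  have A': "verts n (X(u := 1)) = ?A - {u}" "verts m (Y(q := 1)) = ?I - {q}"
    using verts_upd[of _ _ _ 0] by simp_all
  have en': "(\<lambda>i. {(t(p := x)) i, (h(p := y)) i}) = ?en(p := {x, y})" by (simp add: fun_eq_iff)
  have "incidence (?A - {u}) (?I - {q}) (t(p := x)) (h(p := y)) (g(u := 0)) (e(u := 0, y := e y + p - q))"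
    unfolding incidence_def en'
  proof (intro conjI allI)
    show "mgraph (?A - {u}) (?I - {q}) (?en(p := {x, y}))" by (rule mgraph_contract)
    fix v
    show "(g(u := 0)) v = card (inc (?I - {q}) (?en(p := {x, y})) v)"
      unfolding card_inc_contract using deg[of v] by simp
    \<comment> \<open>The sum at \<open>y\<close> contains \<open>q\<close>, so after adding
      \<open>p\<close> the truncated subtraction is exact.\<close>
    show "(e(u := 0, y := e y + p - q)) v = \<Sum>(inc (?I - {q}) (?en(p := {x, y})) v)"
      unfolding inc_contract using esum[of v] incs(5) zq z_neq(1) dist by auto
  qed
  moreover have "optval (?A - {u}) (?I - {q}) (?en(p := {x, y})) (w(p := min (w p) (w q)))
      (if w q < w p then l(x := max (l x) (w p)) else l(y := max (l y) (w q))) +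
      (d + max (l u) (max (w p) (w q))) = K"
    using c optval_contract[OF best] unfolding core_def by simp
  moreover have "(\<Sum>v\<in>?A - {u}. (if w q < w p then l(x := max (l x) (w p)) else l(y := max (l y) (w q))) v)
      \<le> d + max (l u) (max (w p) (w q))"
  proof -
    have *: "(\<Sum>v\<in>?A - {u}. (l(z := max (l z) k)) v) \<le> d + k" if "z \<in> ?A - {u}" for z k
    proof -
      have "(\<Sum>v\<in>?A - {u}. (l(z := max (l z) k)) v) = max (l z) k + (\<Sum>v\<in>?A - {u} - {z}. (l(z := max (l z) k)) v)"
        using that by (subst sum.remove[of _ z]) auto
      also have "(\<Sum>v\<in>?A - {u} - {z}. (l(z := max (l z) k)) v) = (\<Sum>v\<in>?A - {u} - {z}. l v)"
        by (rule sum.cong) auto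
      also have "max (l z) k + (\<Sum>v\<in>?A - {u} - {z}. l v) \<le> k + (\<Sum>v\<in>?A - {u}. l v)"
        using that by (subst (2) sum.remove[of _ z]) auto
      also have "(\<Sum>v\<in>?A - {u}. l v) \<le> (\<Sum>v\<in>?A. l v)" by (rule sum_mono2) auto
      finally show ?thesis using c unfolding core_def by linarith
    qed
    have xy: "x \<in> ?A - {u}" "y \<in> ?A - {u}" using memA dist by auto
    show ?thesis using *[OF xy(1), of "w p"] *[OF xy(2), of "w q"] by (cases "w q < w p") auto
  qed
  moreover have "card (?I - {q}) + n = card (?A - {u}) + m"
  proof -
    have "card ?I = Suc (card (?I - {q}))" "card ?A = Suc (card (?A - {u}))"
      using memA(4) memI(4) by (simp_all only: card_Suc_Diff1 finite_verts)
    then show ?thesis using c unfolding core_def by simp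
  qed
  ultimately show ?thesis unfolding core_def A' en' by blast
qed


section \<open>Total correctness with running time\<close>

definition runs :: "com \<Rightarrow> state \<Rightarrow> (nat \<Rightarrow> state \<Rightarrow> bool) \<Rightarrow> bool" where
  "runs c s Q \<longleftrightarrow> (\<exists>t s'. exec c s t s' \<and> Q t s')"

lemma runs_mono: "runs c s Q \<Longrightarrow> (\<And>t s'. Q t s' \<Longrightarrow> R t s') \<Longrightarrow> runs c s R"
  unfolding runs_def by blast

lemma runs_Seq: "runs c s (\<lambda>t s'. runs c' s' (\<lambda>t'. Q (t + t'))) \<Longrightarrow> runs (Seq c c') s Q"
  unfolding runs_def using exec.Seq by blast

lemma runs_Cond:
  assumes "bval b s \<Longrightarrow> runs c s (\<lambda>t. Q (Suc t))" "\<not> bval b s \<Longrightarrow> runs c' s (\<lambda>t. Q (Suc t))"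
  shows "runs (Cond b c c') s Q"
  using assms exec.CondTrue exec.CondFalse unfolding runs_def by metis

lemma runs_Skip: "Q 1 s \<Longrightarrow> runs Skip s Q"
  unfolding runs_def using exec.Skip by blast

lemma runs_Store: "Q 1 (s(x := (s x)(aval a s := aval b s))) \<Longrightarrow> runs (Store x a b) s Q"
  unfolding runs_def using exec.Store by blast

text \<open>The number \<open>p\<close> is a budget from which the body pays for its running time.\<close>

lemma runs_While:
  assumes body: "\<And>s p. P s p \<Longrightarrow> bval b s \<Longrightarrow> runs c s (\<lambda>t s'. \<exists>p'. P s' p' \<and> Suc t + p' \<le> p)"
    and "P s p"
  shows "runs (While b c) s (\<lambda>t s'. \<exists>p'. P s' p' \<and> \<not> bval b s' \<and> t + p' \<le> Suc p)"
  using assms(2)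
proof (induction p arbitrary: s rule: less_induct)
  case (less p)
  show ?case
  proof (cases "bval b s")
    case True
    obtain t s' p' where 1: "exec c s t s'" "P s' p'" "Suc t + p' \<le> p"
      using body[OF less.prems True] unfolding runs_def by blast
    then obtain t' s'' p'' where 2: "exec (While b c) s' t' s''" "P s'' p''" "\<not> bval b s''" "t' + p'' \<le> Suc p'"
      using less.IH[of p' s'] unfolding runs_def by auto
    have "exec (While b c) s (Suc (t + t')) s''" by (rule exec.WhileTrue[OF True 1(1) 2(1)])
    moreover have "Suc (t + t') + p'' \<le> Suc p" using 1(3) 2(4) by linarith
    ultimately show ?thesis using 2 unfolding runs_def by blast
  next
    case False
    then show ?thesis using exec.WhileFalse[OF False, of c] less.prems unfolding runs_def by fastforce
  qed
qed

fun block :: "(name \<times> aexp \<times> aexp) list \<Rightarrow> com" where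
  "block [] = Skip"
| "block ((x, a, b) # cs) = Seq (Store x a b) (block cs)"

fun upds :: "(name \<times> aexp \<times> aexp) list \<Rightarrow> state \<Rightarrow> state" where
  "upds [] s = s"
| "upds ((x, a, b) # cs) s = upds cs (s(x := (s x)(aval a s := aval b s)))"

lemma runs_block: "Q (Suc (length cs)) (upds cs s) \<Longrightarrow> runs (block cs) s Q"
proof (induction cs arbitrary: s Q rule: block.induct)
  case (2 x a b cs)
  show ?case unfolding block.simps
    by (rule runs_Seq, rule runs_Store, rule "2.IH")
      (use "2.prems" in \<open>simp only: plus_1_eq_Suc length_Cons upds.simps\<close>)
qed (simp add: runs_Skip)

definition for_loop :: "name \<Rightarrow> name \<Rightarrow> com \<Rightarrow> com" where
  "for_loop x y c = Seq (Store x (Const 0) (Const 0))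
     (While (Less (Cell x (Const 0)) (Cell y (Const 0)))
       (Seq c (Store x (Const 0) (Plus (Cell x (Const 0)) (Const 1)))))"

text \<open>An iteration adds two steps to its body, for the test and the increment; two more go
  into the initialisation and the last test. The limit is read again in every round, so
  \<open>P\<close> has to keep it at \<open>N\<close>.\<close>

lemma runs_for_loop:
  assumes start: "P 0 p (s(x := (s x)(0 := 0)))"
    and bound: "\<And>i p s. P i p s \<Longrightarrow> s x 0 = i \<and> s y 0 = N \<and> i \<le> N"
    and body: "\<And>i p s. P i p s \<Longrightarrow> i < N \<Longrightarrow>
      runs c s (\<lambda>t s'. \<exists>p'. P (Suc i) p' (s'(x := (s' x)(0 := Suc (s' x 0)))) \<and> t + p' + 2 \<le> p)"
    and Q: "\<And>t s' p'. P N p' s' \<Longrightarrow> t + p' \<le> p + 2 \<Longrightarrow> Q t s'"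
  shows "runs (for_loop x y c) s Q"
  unfolding for_loop_def
proof (rule runs_Seq, rule runs_Store)
  let ?P = "\<lambda>s p. P (s x 0) p s"
  let ?c = "Seq c (Store x (Const 0) (Plus (Cell x (Const 0)) (Const 1)))"
  let ?b = "Less (Cell x (Const 0)) (Cell y (Const 0))"
  have "runs (While ?b ?c) (s(x := (s x)(0 := 0)))
      (\<lambda>t s'. \<exists>p'. ?P s' p' \<and> \<not> bval ?b s' \<and> t + p' \<le> Suc p)"
  proof (rule runs_While)
    fix s p assume "?P s p" "bval ?b s"
    then have P: "P (s x 0) p s" and lt: "s x 0 < N" using bound[of "s x 0" p s] by auto
    show "runs ?c s (\<lambda>t s'. \<exists>p'. ?P s' p' \<and> Suc t + p' \<le> p)"
    proof (rule runs_Seq, rule runs_mono[OF body[OF P lt]], rule runs_Store)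
      fix t s' assume "\<exists>p'. P (Suc (s x 0)) p' (s'(x := (s' x)(0 := Suc (s' x 0)))) \<and> t + p' + 2 \<le> p"
      then obtain p' where p': "P (Suc (s x 0)) p' (s'(x := (s' x)(0 := Suc (s' x 0))))" "t + p' + 2 \<le> p" by blast
      have "Suc (s x 0) = Suc (s' x 0)" using bound[OF p'(1)] by simp
      then show "\<exists>p'. ?P (s'(x := (s' x)(aval (Const 0) s' := aval (Plus (Cell x (Const 0)) (Const 1)) s'))) p' \<and>
          Suc (t + 1) + p' \<le> p"
        using p' by (intro exI[of _ p']) simp
    qed
  qed (use start in simp)
  then show "runs (While ?b ?c) (s(x := (s x)(aval (Const 0) s := aval (Const 0) s))) (\<lambda>t'. Q (1 + t'))"
  proof (simp only: aval.simps, elim runs_mono)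
    fix t s' assume "\<exists>p'. ?P s' p' \<and> \<not> bval ?b s' \<and> t + p' \<le> Suc p"
    then obtain p' where *: "P (s' x 0) p' s'" "\<not> s' x 0 < s' y 0" "t + p' \<le> Suc p" by auto
    then have "s' x 0 = N" using bound[OF *(1)] by auto
    then show "Q (1 + t) s'" using * by (intro Q) auto
  qed
qed

section \<open>The program\<close>

text \<open>Array \<open>g\<close> holds the degrees, \<open>e\<close> the sums of the incident edge numbers, \<open>l\<close> the lower bounds, \<open>N\<close>
  the new vertex numbers; \<open>X\<close> and \<open>Y\<close> mark the deleted vertices and edges. The other names are scalars.\<close>

abbreviation Scal :: "name \<Rightarrow> aexp" where "Scal x \<equiv> Cell x (Const 0)"

definition Max2 :: "aexp \<Rightarrow> aexp \<Rightarrow> aexp" where "Max2 a b = Plus a (Minus b a)"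
definition Opp :: "aexp \<Rightarrow> aexp \<Rightarrow> aexp" where
  "Opp i v = Minus (Plus (Cell ''tail'' i) (Cell ''head'' i)) v"
definition Nxt :: "aexp \<Rightarrow> aexp \<Rightarrow> aexp" where "Nxt v i = Minus (Cell ''e'' v) i"
definition Eq :: "aexp \<Rightarrow> aexp \<Rightarrow> bexp" where "Eq a b = Conj (Neg (Less a b)) (Neg (Less b a))"
definition Saving :: "aexp \<Rightarrow> aexp \<Rightarrow> aexp \<Rightarrow> aexp \<Rightarrow> aexp \<Rightarrow> aexp" where
  "Saving a fa f fb b =
     Plus (Minus (Cell ''weight'' f) (Max2 (Cell ''l'' a) (Cell ''weight'' fa)))
       (Minus (Cell ''weight'' f) (Max2 (Cell ''l'' b) (Cell ''weight'' fb)))"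

lemma aval_bval_macros [simp]:
  "aval (Max2 a b) s = max (aval a s) (aval b s)"
  "aval (Opp i v) s = arrays.opp (s ''tail'') (s ''head'') (aval i s) (aval v s)"
  "aval (Nxt v i) s = arrays.nxt (s ''e'') (aval v s) (aval i s)"
  "bval (Eq a b) s \<longleftrightarrow> aval a s = aval b s"
  "aval (Saving a fa f fb b) s =
     saving (s ''weight'') (s ''l'') (aval a s) (aval fa s) (aval f s) (aval fb s) (aval b s)"
  by (auto simp: Max2_def Opp_def Nxt_def Eq_def Saving_def saving_def arrays.opp_def arrays.nxt_def)

abbreviation "EI \<equiv> Scal ''i''"
abbreviation "ET \<equiv> Cell ''tail'' EI"
abbreviation "EH \<equiv> Cell ''head'' EI"
definition "E1 = Nxt ET EI"
definition "V1 = Opp E1 ET"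
definition "E3 = Nxt EH EI"
definition "V4 = Opp E3 EH"
definition "E4 = Nxt V4 E3"
definition "V5 = Opp E4 V4"
definition "E0 = Nxt V1 E1"
definition "E5 = Nxt V5 E4"

lemma aval_walk [simp]:
  "aval E1 s = arrays.e1 (s ''tail'') (s ''e'') (s ''i'' 0)"
  "aval V1 s = arrays.v1 (s ''tail'') (s ''head'') (s ''e'') (s ''i'' 0)"
  "aval E3 s = arrays.e3 (s ''head'') (s ''e'') (s ''i'' 0)"
  "aval V4 s = arrays.v4 (s ''tail'') (s ''head'') (s ''e'') (s ''i'' 0)"
  "aval E4 s = arrays.e4 (s ''tail'') (s ''head'') (s ''e'') (s ''i'' 0)"
  "aval V5 s = arrays.v5 (s ''tail'') (s ''head'') (s ''e'') (s ''i'' 0)"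
  "aval E0 s = arrays.e0 (s ''tail'') (s ''head'') (s ''e'') (s ''i'' 0)"
  "aval E5 s = arrays.e5 (s ''tail'') (s ''head'') (s ''e'') (s ''i'' 0)"
  by (simp_all add: E1_def V1_def E3_def V4_def E4_def V5_def E0_def E5_def arrays.e1_def arrays.v1_def
      arrays.e3_def arrays.v4_def arrays.e4_def arrays.v5_def arrays.e0_def arrays.e5_def)

definition "Window = Conj (Eq (Cell ''Y'' EI) (Const 0)) (Conj (Eq (Cell ''g'' ET) (Const 2))
  (Conj (Eq (Cell ''g'' EH) (Const 2)) (Conj (Eq (Cell ''g'' V1) (Const 2)) (Conj (Eq (Cell ''g'' V4) (Const 2))
  (Conj (Eq (Cell ''g'' V5) (Const 2)) (Conj (Neg (Eq V1 V4)) (Neg (Eq V1 V5))))))))"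

lemma bval_Window:
  "bval Window s \<longleftrightarrow> s ''Y'' (s ''i'' 0) = 0 \<and>
     arrays.is_window (s ''tail'') (s ''head'') (s ''g'') (s ''e'') (s ''i'' 0)"
  by (simp add: Window_def arrays.is_window_def)

definition "Degrees = for_loop ''i'' ''m'' (block [
  (''g'', ET, Plus (Cell ''g'' ET) (Const 1)),
  (''g'', EH, Plus (Cell ''g'' EH) (Const 1)),
  (''e'', ET, Plus (Cell ''e'' ET) EI),
  (''e'', EH, Plus (Cell ''e'' EH) EI)])"

definition "Peel1 = block [
  (''a'', Const 0, Cell ''e'' (Scal ''v'')),
  (''b'', Const 0, Opp (Scal ''a'') (Scal ''v'')),
  (''d'', Const 0, Plus (Scal ''d'') (Max2 (Cell ''l'' (Scal ''v'')) (Cell ''weight'' (Scal ''a'')))),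
  (''l'', Scal ''b'', Max2 (Cell ''l'' (Scal ''b'')) (Cell ''weight'' (Scal ''a''))),
  (''g'', Scal ''v'', Const 0),
  (''g'', Scal ''b'', Minus (Cell ''g'' (Scal ''b'')) (Const 1)),
  (''e'', Scal ''v'', Const 0),
  (''e'', Scal ''b'', Minus (Cell ''e'' (Scal ''b'')) (Scal ''a'')),
  (''X'', Scal ''v'', Const 1),
  (''Y'', Scal ''a'', Const 1),
  (''v'', Const 0, Scal ''b'')]"

text \<open>Deleting a leaf can turn only its neighbour into a leaf, and the inner loop moves on to
  that neighbour. So vertices already passed stay done, and all inner loops together delete each
  edge at most once.\<close>

definition "Peel = for_loop ''i'' ''n''
  (Seq (Store ''v'' (Const 0) EI) (While (Eq (Cell ''g'' (Scal ''v'')) (Const 1)) Peel1))"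

text \<open>The window is saved in scalars because the later updates of \<open>tail\<close>,
  \<open>head\<close> and \<open>e\<close> change what the walking expressions evaluate to. The
  constant is increased here, while weights and lower bounds are still the old ones.\<close>

definition "Orient u y p q = block [
  (''x'', Const 0, EH), (''u'', Const 0, u), (''y'', Const 0, y), (''p'', Const 0, p), (''q'', Const 0, q),
  (''d'', Const 0, Plus (Scal ''d'')
     (Max2 (Cell ''l'' (Scal ''u'')) (Max2 (Cell ''weight'' (Scal ''p'')) (Cell ''weight'' (Scal ''q'')))))]"

definition "Choose = Cond (Less (Max2 (Saving V1 E0 E1 EI ET) (Saving ET E1 EI E3 EH))
    (Max2 (Saving EH EI E3 E4 V4) (Saving V4 E3 E4 E5 V5)))
  (Orient ET V1 EI E1) (Orient V4 V5 E3 E4)"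

definition "Bump = Cond (Less (Cell ''weight'' (Scal ''q'')) (Cell ''weight'' (Scal ''p'')))
  (block [(''l'', Scal ''x'', Max2 (Cell ''l'' (Scal ''x'')) (Cell ''weight'' (Scal ''p'')))])
  (block [(''l'', Scal ''y'', Max2 (Cell ''l'' (Scal ''y'')) (Cell ''weight'' (Scal ''q'')))])"

definition "Bypass = [
  (''weight'', Scal ''p'', Minus (Cell ''weight'' (Scal ''p''))
     (Minus (Cell ''weight'' (Scal ''p'')) (Cell ''weight'' (Scal ''q'')))),
  (''tail'', Scal ''p'', Scal ''x''),
  (''head'', Scal ''p'', Scal ''y''),
  (''g'', Scal ''u'', Const 0),
  (''e'', Scal ''u'', Const 0),
  (''e'', Scal ''y'', Minus (Plus (Cell ''e'' (Scal ''y'')) (Scal ''p'')) (Scal ''q'')),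
  (''X'', Scal ''u'', Const 1),
  (''Y'', Scal ''q'', Const 1)]"

text \<open>\<open>Bump\<close> compares the old weights of \<open>p\<close> and \<open>q\<close>,
  so it precedes \<open>Bypass\<close>, which overwrites the weight of \<open>p\<close>.\<close>

definition "Contract1 = Seq Choose (Seq Bump (block Bypass))"

text \<open>A contraction deletes \<open>e1 i\<close> or \<open>e4 i\<close> but never
  \<open>i\<close>, so the inner loop stays at \<open>i\<close> until it has no window. Later
  contractions preserve goodness, hence one pass over the edges suffices.\<close>

definition "Contract = for_loop ''i'' ''m'' (While Window Contract1)"

text \<open>The pendant neighbour of \<open>v\<close> is \<open>n + v\<close>, which is fresh
  because all old vertices are below \<open>n\<close>. Clearing \<open>l\<close> lets the state
  itself describe the problem in which the bound has been replaced.\<close>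

definition "Pendants = for_loop ''i'' ''n'' (Cond (Eq (Cell ''X'' EI) (Const 0))
  (block [
    (''tail'', Scal ''m'', EI),
    (''head'', Scal ''m'', Plus (Scal ''n'') EI),
    (''weight'', Scal ''m'', Cell ''l'' EI),
    (''d'', Const 0, Minus (Scal ''d'') (Cell ''l'' EI)),
    (''l'', EI, Const 0),
    (''l'', Plus (Scal ''n'') EI, Const 0),
    (''N'', EI, Scal ''k''),
    (''N'', Plus (Scal ''n'') EI, Plus (Scal ''k'') (Const 1)),
    (''k'', Const 0, Plus (Scal ''k'') (Const 2)),
    (''m'', Const 0, Plus (Scal ''m'') (Const 1))])
  Skip)"

definition "Compact = for_loop ''i'' ''m'' (Cond (Eq (Cell ''Y'' EI) (Const 0))
  (block [
    (''tail'', Scal ''j'', Cell ''N'' ET),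
    (''head'', Scal ''j'', Cell ''N'' EH),
    (''weight'', Scal ''j'', Cell ''weight'' EI),
    (''j'', Const 0, Plus (Scal ''j'') (Const 1))])
  Skip)"

definition "Finish = block [(''m'', Const 0, Scal ''j''), (''n'', Const 0, Scal ''k'')]"

definition "Kernelize = Seq Degrees (Seq Peel (Seq Contract (Seq Pendants (Seq Compact Finish))))"


section \<open>Correctness of the program\<close>

text \<open>The unmarked cells of \<open>Y\<close> from \<open>m\<close> on make the edges appended
  later count as present.\<close>

definition cores :: "nat \<Rightarrow> nat \<Rightarrow> nat \<Rightarrow> state \<Rightarrow> bool" where
  "cores n m K s \<longleftrightarrow>
     core n m K (s ''tail'') (s ''head'') (s ''weight'') (s ''l'') (s ''g'') (s ''e'') (s ''X'') (s ''Y'') (s ''d'' 0) \<and>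
     s ''n'' 0 = n \<and> s ''m'' 0 = m \<and> s ''k'' 0 = 0 \<and> s ''j'' 0 = 0 \<and> (\<forall>i\<ge>m. s ''Y'' i = 0)"

abbreviation "ends s \<equiv> \<lambda>i. {s ''tail'' i, s ''head'' i}"

lemma coresD:
  assumes "cores n m K s"
  shows "core n m K (s ''tail'') (s ''head'') (s ''weight'') (s ''l'') (s ''g'') (s ''e'') (s ''X'') (s ''Y'') (s ''d'' 0)"
    "s ''n'' 0 = n" "s ''m'' 0 = m" "s ''k'' 0 = 0" "s ''j'' 0 = 0" "\<forall>i\<ge>m. s ''Y'' i = 0"
    "incidence (verts n (s ''X'')) (verts m (s ''Y'')) (s ''tail'') (s ''head'') (s ''g'') (s ''e'')"
  using assms unfolding cores_def core_def by auto

section \<open>Computing degrees and peeling leaves\<close>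

lemma inc_lessThan_Suc:
  "inc {..<Suc i} en v = (if v \<in> en i then insert i (inc {..<i} en v) else inc {..<i} en v)"
  unfolding inc_def by (auto simp: less_Suc_eq)

lemma runs_Degrees:
  assumes V: "minpsc_graph V E" and s: "initial_state s V E w"
  shows "runs Degrees s (\<lambda>t s'. t \<le> 7 * s ''m'' 0 + 2 \<and> cores (s ''n'' 0) (s ''m'' 0) (opt V E w) s')"
proof -
  define n where "n = s ''n'' 0"
  define m where "m = s ''m'' 0"
  have V_eq: "V = {..<n}" and bij: "bij_betw (ends s) {..<m} E"
    and w: "\<And>i. i < m \<Longrightarrow> w (ends s i) = s ''weight'' i"
    and zero: "\<And>x i. x \<notin> {''n'', ''m'', ''tail'', ''head'', ''weight''} \<Longrightarrow> s x i = 0"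
    using s unfolding initial_state_def stores_instance_def n_def m_def by auto
  have G: "mgraph V {..<m} (ends s)" by (rule mgraph_of_instance[OF V _ bij]) simp
  \<comment> \<open>Seven steps per edge: four stores, the \<open>Skip\<close> that ends the block,
    and two for the loop.\<close>
  define P where "P i p s' \<longleftrightarrow> i \<le> m \<and> p = 7 * (m - i) \<and> s' ''i'' 0 = i \<and>
    (\<forall>x. x \<notin> {''g'', ''e'', ''i''} \<longrightarrow> s' x = s x) \<and>
    (\<forall>v. s' ''g'' v = card (inc {..<i} (ends s) v) \<and> s' ''e'' v = \<Sum>(inc {..<i} (ends s) v))" for i p s'
  have "runs Degrees s (\<lambda>t s'. t \<le> 7 * m + 2 \<and> cores n m (opt V E w) s')"
    unfolding Degrees_def
  proof (rule runs_for_loop[where P = P and p = "7 * m" and N = m])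
    show "P 0 (7 * m) (s(''i'' := (s ''i'')(0 := 0)))"
      using zero unfolding P_def inc_def by simp
    show "s' ''i'' 0 = i \<and> s' ''m'' 0 = m \<and> i \<le> m" if "P i p s'" for i p s'
      using that unfolding P_def m_def by simp
  next
    fix i p s' assume P: "P i p s'" and i: "i < m"
    have ne: "s ''tail'' i \<noteq> s ''head'' i"
      using mgraphD(4)[OF G, of i] i by (auto simp: card_insert_if split: if_splits)
    have fin: "finite (inc {..<i} (ends s) v)" "i \<notin> inc {..<i} (ends s) v" for v unfolding inc_def by auto
    have eq: "s' ''tail'' = s ''tail''" "s' ''head'' = s ''head''" "s' ''i'' 0 = i" using P unfolding P_def by auto
    show "runs (block [(''g'', ET, Plus (Cell ''g'' ET) (Const 1)), (''g'', EH, Plus (Cell ''g'' EH) (Const 1)),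
        (''e'', ET, Plus (Cell ''e'' ET) EI), (''e'', EH, Plus (Cell ''e'' EH) EI)]) s'
      (\<lambda>t s''. \<exists>p'. P (Suc i) p' (s''(''i'' := (s'' ''i'')(0 := Suc (s'' ''i'' 0)))) \<and> t + p' + 2 \<le> p)"
      by (rule runs_block, rule exI[of _ "7 * (m - Suc i)"])
        (use P i ne fin eq in \<open>auto simp: P_def inc_lessThan_Suc\<close>)
  next
    fix t s' p' assume P: "P m p' s'" and t: "t + p' \<le> 7 * m + 2"
    have eq: "s' x = s x" if "x \<notin> {''g'', ''e'', ''i''}" for x using P that unfolding P_def by blast
    have A: "verts n (s' ''X'') = V" "verts m (s' ''Y'') = {..<m}"
      using zero eq V_eq unfolding verts_def by auto
    have l: "s' ''l'' = (\<lambda>_. 0)" using zero[of "''l''"] eq by auto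
    have "opt V E w = optval V {..<m} (ends s) (s ''weight'') (\<lambda>_. 0)"
      by (rule opt_eq_optval[OF V _ bij]) (use w in auto)
    then have "core n m (opt V E w) (s' ''tail'') (s' ''head'') (s' ''weight'') (s' ''l'') (s' ''g'') (s' ''e'')
        (s' ''X'') (s' ''Y'') (s' ''d'' 0)"
      using P G V_eq unfolding core_def A incidence_def l by (simp add: eq zero P_def)
    then show "t \<le> 7 * m + 2 \<and> cores n m (opt V E w) s'"
      using t eq zero unfolding cores_def n_def m_def by simp
  qed
  then show ?thesis unfolding n_def m_def .
qed

text \<open>The last conjunct expresses that only the neighbour, which is the new \<open>v\<close>,
  can have become a leaf.\<close>

lemma runs_Peel1:
  assumes c: "cores n m K s" and v: "s ''g'' (s ''v'' 0) = 1"
  shows "runs Peel1 s (\<lambda>t s'. t = 12 \<and> cores n m K s' \<and> s' ''v'' 0 < n \<and> s' ''i'' = s ''i'' \<and>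
    card (verts m (s ''Y'')) = Suc (card (verts m (s' ''Y''))) \<and>
    (\<forall>u. u \<noteq> s' ''v'' 0 \<longrightarrow> s' ''g'' u = 1 \<longrightarrow> u \<noteq> s ''v'' 0 \<and> s ''g'' u = 1))"
proof -
  define v a b where "v = s ''v'' 0" and "a = s ''e'' v" and "b = s ''tail'' a + s ''head'' a - v"
  note peel = core_peel[OF coresD(1)[OF c], of v, folded a_def, folded b_def]
  have b: "b \<noteq> v" "b < n" "a \<in> verts m (s ''Y'')" using peel(2-4) v unfolding v_def by auto
  have a: "a < m" using b(3) unfolding verts_def by blast
  have "card (verts m (s ''Y'')) = Suc (card (verts m (s ''Y'') - {a}))"
    using b(3) by (simp only: card_Suc_Diff1 finite_verts)
  then have card: "card (verts m (s ''Y'')) = Suc (card (verts m ((s ''Y'')(a := Suc 0))))"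
    by (simp only: verts_upd)
  show ?thesis
    unfolding Peel1_def
    by (rule runs_block)
      (use b a card peel(1) v coresD(2-6)[OF c] in
        \<open>simp add: cores_def arrays.opp_def v_def[symmetric] a_def[symmetric] b_def[symmetric]\<close>)
qed

lemma cores_degree_0:
  assumes "cores n m K s" "n \<le> v"
  shows "s ''g'' v = 0"
proof -
  note i = coresD(7)[OF assms(1)]
  have "inc (verts m (s ''Y'')) (ends s) v = {}"
    using mgraphD(3)[OF incidence.G[OF i]] assms(2) unfolding inc_def verts_def by fastforce
  then show ?thesis using incidence.deg[OF i, of v] by simp
qed

lemma card_verts_le: "card (verts m Y) \<le> m"
  using card_mono[of "{..<m}" "verts m Y"] by (auto simp: verts_def)

lemma runs_Peel:
  assumes c: "cores n m K s"
  shows "runs Peel s (\<lambda>t s'. t \<le> 13 * m + 4 * n + 2 \<and> cores n m K s' \<and> (\<forall>v. s' ''g'' v \<noteq> 1))"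
proof -
  define D where "D s = card (verts m (s ''Y''))" for s :: state
  \<comment> \<open>Thirteen steps per deleted edge: twelve for \<open>Peel1\<close> and one test.
    Four per vertex: storing \<open>v\<close>, the last test of the inner loop, and two for the
    outer loop.\<close>
  define P where "P i p s \<longleftrightarrow> i \<le> n \<and> p = 13 * D s + 4 * (n - i) \<and> s ''i'' 0 = i \<and> cores n m K s \<and>
    (\<forall>v<i. s ''g'' v \<noteq> 1)" for i p s
  have D: "D s \<le> m" unfolding D_def by (rule card_verts_le)
  show ?thesis
    unfolding Peel_def
  proof (rule runs_for_loop[where P = P and p = "13 * D s + 4 * n" and N = n])
    show "P 0 (13 * D s + 4 * n) (s(''i'' := (s ''i'')(0 := 0)))"
      using c unfolding P_def D_def cores_def by simp
    show "s' ''i'' 0 = i \<and> s' ''n'' 0 = n \<and> i \<le> n" if "P i p s'" for i p s'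
      using that coresD(2) unfolding P_def by blast
  next
    fix i p s assume P: "P i p s" and i: "i < n"
    define Q where "Q s' p' \<longleftrightarrow> cores n m K s' \<and> s' ''v'' 0 < n \<and> s' ''i'' 0 = i \<and> p' = 13 * D s' \<and>
      (\<forall>u<Suc i. u \<noteq> s' ''v'' 0 \<longrightarrow> s' ''g'' u \<noteq> 1)" for s' p'
    have Q0: "Q (s(''v'' := (s ''v'')(0 := i))) (13 * D s)"
      using P i unfolding P_def Q_def cores_def D_def by (auto simp: less_Suc_eq)
    let ?b = "Eq (Cell ''g'' (Scal ''v'')) (Const 1)"
    have W: "runs (While ?b Peel1) (s(''v'' := (s ''v'')(0 := i)))
        (\<lambda>t s'. \<exists>p'. Q s' p' \<and> \<not> bval ?b s' \<and> t + p' \<le> Suc (13 * D s))"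
    proof (rule runs_While[where P = Q])
      fix s p assume Q: "Q s p" and b: "bval ?b s"
      have c: "cores n m K s" and g: "s ''g'' (s ''v'' 0) = 1" using Q b unfolding Q_def by auto
      show "runs Peel1 s (\<lambda>t s'. \<exists>p'. Q s' p' \<and> Suc t + p' \<le> p)"
        by (rule runs_mono[OF runs_Peel1[OF c g]]) (use Q in \<open>auto simp: Q_def D_def\<close>)
    qed (rule Q0)
    show "runs (Seq (Store ''v'' (Const 0) EI) (While ?b Peel1)) s
        (\<lambda>t s'. \<exists>p'. P (Suc i) p' (s'(''i'' := (s' ''i'')(0 := Suc (s' ''i'' 0)))) \<and> t + p' + 2 \<le> p)"
    proof (rule runs_Seq, rule runs_Store)
      have "aval EI s = i" using P unfolding P_def by simp
      then show "runs (While ?b Peel1) (s(''v'' := (s ''v'')(aval (Const 0) s := aval EI s)))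
          (\<lambda>t'. (\<lambda>s'. \<exists>p'. P (Suc i) p' (s'(''i'' := (s' ''i'')(0 := Suc (s' ''i'' 0)))) \<and> 1 + t' + p' + 2 \<le> p))"
      proof (simp only: aval.simps, intro runs_mono[OF W])
        fix t s' assume "\<exists>p'. Q s' p' \<and> \<not> bval ?b s' \<and> t + p' \<le> Suc (13 * D s)"
        then have Q: "Q s' (13 * D s')" "s' ''g'' (s' ''v'' 0) \<noteq> 1" "t + 13 * D s' \<le> Suc (13 * D s)"
          unfolding Q_def by auto
        have "P (Suc i) (13 * D s' + 4 * (n - Suc i)) (s'(''i'' := (s' ''i'')(0 := Suc (s' ''i'' 0))))"
          using Q(1,2) i unfolding Q_def P_def cores_def D_def by (simp, metis)
        moreover have "1 + t + (13 * D s' + 4 * (n - Suc i)) + 2 \<le> p"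
          using P i Q(3) unfolding P_def by simp
        ultimately show "\<exists>p'. P (Suc i) p' (s'(''i'' := (s' ''i'')(0 := Suc (s' ''i'' 0)))) \<and> 1 + t + p' + 2 \<le> p"
          by blast
      qed
    qed
  next
    fix t s' p' assume P: "P n p' s'" and t: "t + p' \<le> 13 * D s + 4 * n + 2"
    have "s' ''g'' v \<noteq> 1" for v
      using P cores_degree_0[of n m K s' v] unfolding P_def by (cases "v < n") auto
    then show "t \<le> 13 * m + 4 * n + 2 \<and> cores n m K s' \<and> (\<forall>v. s' ''g'' v \<noteq> 1)"
      using P t D unfolding P_def by simp
  qed
qed

section \<open>Contracting windows\<close>

lemma saving_commute: "saving w l a fa f fb b = saving w l b fb f fa a"
  unfolding saving_def by simp

text \<open>Both orientations of a window are reduced to the case that \<open>u\<close>, the vertex between \<open>x\<close> and \<open>y\<close>, is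
  bypassed, and the best edge to omit is one of the two on the far side of \<open>x\<close>.\<close>

definition oriented :: "nat \<Rightarrow> nat \<Rightarrow> state \<Rightarrow> state \<Rightarrow> bool" where
  "oriented n m s s1 \<longleftrightarrow> (\<exists>v1 v2 e0 sd r z.
      window (verts n (s ''X'')) (verts m (s ''Y'')) (ends s) v1 v2 (s1 ''x'' 0) (s1 ''u'' 0) (s1 ''y'' 0)
        e0 sd r (s1 ''p'' 0) (s1 ''q'' 0) z \<and>
      max (saving (s ''weight'') (s ''l'') (s1 ''x'' 0) r (s1 ''p'' 0) (s1 ''q'' 0) (s1 ''u'' 0))
          (saving (s ''weight'') (s ''l'') (s1 ''u'' 0) (s1 ''p'' 0) (s1 ''q'' 0) z (s1 ''y'' 0)) \<le>
        max (saving (s ''weight'') (s ''l'') v1 e0 sd r v2)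
          (saving (s ''weight'') (s ''l'') v2 sd r (s1 ''p'' 0) (s1 ''x'' 0))) \<and>
    (\<forall>a. a \<notin> {''x'', ''u'', ''y'', ''p'', ''q'', ''d''} \<longrightarrow> s1 a = s a) \<and>
    s1 ''d'' 0 = s ''d'' 0 +
      max (s ''l'' (s1 ''u'' 0)) (max (s ''weight'' (s1 ''p'' 0)) (s ''weight'' (s1 ''q'' 0)))"

text \<open>Nonzero degrees are unchanged, so no leaf reappears, and goodness of the surviving edges
  persists: the two facts that allow a single pass.\<close>

definition contracted :: "nat \<Rightarrow> nat \<Rightarrow> nat \<Rightarrow> state \<Rightarrow> state \<Rightarrow> bool" where
  "contracted n m K s s' \<longleftrightarrow> cores n m K s' \<and> s' ''i'' = s ''i'' \<and>
    card (verts m (s ''Y'')) = Suc (card (verts m (s' ''Y''))) \<and>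
    (\<forall>v. s' ''g'' v \<noteq> 0 \<longrightarrow> s' ''g'' v = s ''g'' v) \<and>
    (\<forall>j\<in>verts m (s' ''Y''). j \<in> verts m (s ''Y'') \<and>
       (good (verts n (s ''X'')) (verts m (s ''Y'')) (ends s) j \<longrightarrow>
        good (verts n (s' ''X'')) (verts m (s' ''Y'')) (ends s') j))"

lemma runs_Choose:
  assumes c: "cores n m K s" and i: "s ''i'' 0 < m" and b: "bval Window s"
  shows "runs Choose s (\<lambda>t s1. t = 8 \<and> oriented n m s s1)"
proof -
  interpret incidence "verts n (s ''X'')" "verts m (s ''Y'')" "s ''tail''" "s ''head''" "s ''g''" "s ''e''"
    by (rule coresD(7)[OF c])
  let ?i = "s ''i'' 0" and ?s = "saving (s ''weight'') (s ''l'')"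
  have "?i \<in> verts m (s ''Y'')" "is_window ?i" using i b unfolding bval_Window verts_def by auto
  note wins = windows[OF this]
  show ?thesis
    unfolding Choose_def Orient_def
  proof (rule runs_Cond)
    assume "bval (Less (Max2 (Saving V1 E0 E1 EI ET) (Saving ET E1 EI E3 EH))
      (Max2 (Saving EH EI E3 E4 V4) (Saving V4 E3 E4 E5 V5))) s"
    \<comment> \<open>Reading the path from its other end swaps the two sides of each saving, which
      leaves its value unchanged.\<close>
    then have "max (?s (s ''head'' ?i) (e3 ?i) ?i (e1 ?i) (s ''tail'' ?i)) (?s (s ''tail'' ?i) ?i (e1 ?i) (e0 ?i) (v1 ?i)) \<le>
        max (?s (v5 ?i) (e5 ?i) (e4 ?i) (e3 ?i) (v4 ?i)) (?s (v4 ?i) (e4 ?i) (e3 ?i) ?i (s ''head'' ?i))"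
      by (subst (1 2 3 4) saving_commute) (simp add: max.commute)
    with wins(2) have "\<exists>a1 a2 b0 bs r z.
        window (verts n (s ''X'')) (verts m (s ''Y'')) (ends s) a1 a2 (s ''head'' ?i) (s ''tail'' ?i) (v1 ?i)
          b0 bs r ?i (e1 ?i) z \<and>
        max (?s (s ''head'' ?i) r ?i (e1 ?i) (s ''tail'' ?i)) (?s (s ''tail'' ?i) ?i (e1 ?i) z (v1 ?i)) \<le>
          max (?s a1 b0 bs r a2) (?s a2 bs r ?i (s ''head'' ?i))" by blast
    then show "runs (block [(''x'', Const 0, EH), (''u'', Const 0, ET), (''y'', Const 0, V1),
        (''p'', Const 0, EI), (''q'', Const 0, E1), (''d'', Const 0, Plus (Scal ''d'')
        (Max2 (Cell ''l'' (Scal ''u'')) (Max2 (Cell ''weight'' (Scal ''p'')) (Cell ''weight'' (Scal ''q'')))))]) s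
      (\<lambda>t s1. Suc t = 8 \<and> oriented n m s s1)"
      by (intro runs_block) (simp add: oriented_def)
  next
    assume "\<not> bval (Less (Max2 (Saving V1 E0 E1 EI ET) (Saving ET E1 EI E3 EH))
      (Max2 (Saving EH EI E3 E4 V4) (Saving V4 E3 E4 E5 V5))) s"
    then have "max (?s (s ''head'' ?i) ?i (e3 ?i) (e4 ?i) (v4 ?i)) (?s (v4 ?i) (e3 ?i) (e4 ?i) (e5 ?i) (v5 ?i)) \<le>
        max (?s (v1 ?i) (e0 ?i) (e1 ?i) ?i (s ''tail'' ?i)) (?s (s ''tail'' ?i) (e1 ?i) ?i (e3 ?i) (s ''head'' ?i))"
      by (simp only: bval.simps aval_bval_macros aval_walk aval.simps not_less)
    with wins(1) have "\<exists>a1 a2 b0 bs r z.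
        window (verts n (s ''X'')) (verts m (s ''Y'')) (ends s) a1 a2 (s ''head'' ?i) (v4 ?i) (v5 ?i)
          b0 bs r (e3 ?i) (e4 ?i) z \<and>
        max (?s (s ''head'' ?i) r (e3 ?i) (e4 ?i) (v4 ?i)) (?s (v4 ?i) (e3 ?i) (e4 ?i) z (v5 ?i)) \<le>
          max (?s a1 b0 bs r a2) (?s a2 bs r (e3 ?i) (s ''head'' ?i))" by blast
    then show "runs (block [(''x'', Const 0, EH), (''u'', Const 0, V4), (''y'', Const 0, V5),
        (''p'', Const 0, E3), (''q'', Const 0, E4), (''d'', Const 0, Plus (Scal ''d'')
        (Max2 (Cell ''l'' (Scal ''u'')) (Max2 (Cell ''weight'' (Scal ''p'')) (Cell ''weight'' (Scal ''q'')))))]) s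
      (\<lambda>t s1. Suc t = 8 \<and> oriented n m s s1)"
      by (intro runs_block) (simp add: oriented_def)
  qed
qed

lemma runs_Bump:
  "runs Bump s (\<lambda>t s'. t = 3 \<and> s' = s(''l'' :=
     (if s ''weight'' (s ''q'' 0) < s ''weight'' (s ''p'' 0)
      then (s ''l'')(s ''x'' 0 := max (s ''l'' (s ''x'' 0)) (s ''weight'' (s ''p'' 0)))
      else (s ''l'')(s ''y'' 0 := max (s ''l'' (s ''y'' 0)) (s ''weight'' (s ''q'' 0))))))"
  unfolding Bump_def by (rule runs_Cond; rule runs_block) simp_all

lemma upds_Bypass:
  assumes "s ''x'' 0 = x" "s ''u'' 0 = u" "s ''y'' 0 = y" "s ''p'' 0 = p" "s ''q'' 0 = q" "u \<noteq> y"
  shows "upds Bypass s ''weight'' = (s ''weight'')(p := min (s ''weight'' p) (s ''weight'' q))"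
    "upds Bypass s ''tail'' = (s ''tail'')(p := x)" "upds Bypass s ''head'' = (s ''head'')(p := y)"
    "upds Bypass s ''g'' = (s ''g'')(u := 0)"
    "upds Bypass s ''e'' = (s ''e'')(u := 0, y := s ''e'' y + p - q)"
    "upds Bypass s ''X'' = (s ''X'')(u := 1)" "upds Bypass s ''Y'' = (s ''Y'')(q := 1)"
    "a \<in> {''l'', ''d'', ''i'', ''n'', ''m'', ''k'', ''j''} \<Longrightarrow> upds Bypass s a = s a"
proof -
  \<comment> \<open>Truncated subtraction computes the minimum without a test.\<close>
  have "a - (a - b) = min a b" for a b :: nat by simp
  then show "upds Bypass s ''weight'' = (s ''weight'')(p := min (s ''weight'' p) (s ''weight'' q))"
    "upds Bypass s ''tail'' = (s ''tail'')(p := x)" "upds Bypass s ''head'' = (s ''head'')(p := y)"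
    "upds Bypass s ''g'' = (s ''g'')(u := 0)"
    "upds Bypass s ''e'' = (s ''e'')(u := 0, y := s ''e'' y + p - q)"
    "upds Bypass s ''X'' = (s ''X'')(u := 1)" "upds Bypass s ''Y'' = (s ''Y'')(q := 1)"
    unfolding Bypass_def using assms by simp_all
  show "a \<in> {''l'', ''d'', ''i'', ''n'', ''m'', ''k'', ''j''} \<Longrightarrow> upds Bypass s a = s a"
    unfolding Bypass_def by auto
qed

lemma contracted_Bypass:
  assumes c: "cores n m K s" and o: "oriented n m s s1"
    and s2: "s2 = s1(''l'' :=
     (if s1 ''weight'' (s1 ''q'' 0) < s1 ''weight'' (s1 ''p'' 0)
      then (s1 ''l'')(s1 ''x'' 0 := max (s1 ''l'' (s1 ''x'' 0)) (s1 ''weight'' (s1 ''p'' 0)))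
      else (s1 ''l'')(s1 ''y'' 0 := max (s1 ''l'' (s1 ''y'' 0)) (s1 ''weight'' (s1 ''q'' 0)))))"
  shows "contracted n m K s (upds Bypass s2)"
proof -
  let ?A = "verts n (s ''X'')" and ?I = "verts m (s ''Y'')" and ?w = "s ''weight''" and ?l = "s ''l''"
  define x u y p q where xu: "x = s1 ''x'' 0" "u = s1 ''u'' 0" "y = s1 ''y'' 0" "p = s1 ''p'' 0" "q = s1 ''q'' 0"
  note o' = o[unfolded oriented_def]
  obtain v1 v2 e0 sd r z where
    W: "window ?A ?I (ends s) v1 v2 x u y e0 sd r p q z"
    and best: "max (saving ?w ?l x r p q u) (saving ?w ?l u p q z y) \<le>
      max (saving ?w ?l v1 e0 sd r v2) (saving ?w ?l v2 sd r p x)"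
    using conjunct1[OF o'] unfolding xu by (elim exE conjE)
  interpret window ?A ?I "ends s" v1 v2 x u y e0 sd r p q z by (rule W)
  note cc = core_contract[OF coresD(1)[OF c] W best]
  have eq: "s1 a = s a" if "a \<notin> {''x'', ''u'', ''y'', ''p'', ''q'', ''d''}" for a
    by (rule conjunct1[OF conjunct2[OF o'], rule_format, OF that])
  have d: "s1 ''d'' 0 = s ''d'' 0 + max (?l u) (max (?w p) (?w q))"
    unfolding xu by (rule conjunct2[OF conjunct2[OF o']])
  define l' where "l' = (if ?w q < ?w p then ?l(x := max (?l x) (?w p)) else ?l(y := max (?l y) (?w q)))"
  have s2': "s2 = s1(''l'' := l')" unfolding s2 l'_def by (simp add: eq xu)
  have uy: "u \<noteq> y" using dist by auto
  have s2x: "s2 ''x'' 0 = x" "s2 ''u'' 0 = u" "s2 ''y'' 0 = y" "s2 ''p'' 0 = p" "s2 ''q'' 0 = q"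
    unfolding s2' xu by simp_all
  have s2s: "s2 ''weight'' = ?w" "s2 ''tail'' = s ''tail''" "s2 ''head'' = s ''head''" "s2 ''g'' = s ''g''"
    "s2 ''e'' = s ''e''" "s2 ''X'' = s ''X''" "s2 ''Y'' = s ''Y''" "s2 ''l'' = l'" "s2 ''d'' 0 = s1 ''d'' 0"
    "s2 ''i'' = s ''i''" "s2 ''n'' = s ''n''" "s2 ''m'' = s ''m''" "s2 ''k'' = s ''k''" "s2 ''j'' = s ''j''"
    unfolding s2' by (simp_all add: eq)
  note s3 = upds_Bypass[of s2 x u y p q, OF s2x uy, unfolded s2s]
  have fr: "upds Bypass s2 ''l'' = l'" "upds Bypass s2 ''d'' 0 = s ''d'' 0 + max (?l u) (max (?w p) (?w q))"
    "upds Bypass s2 ''i'' = s ''i''" "upds Bypass s2 ''n'' = s ''n''" "upds Bypass s2 ''m'' = s ''m''"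
    "upds Bypass s2 ''k'' = s ''k''" "upds Bypass s2 ''j'' = s ''j''"
    by (simp_all add: s3(8) s2s d)
  have qm: "q < m" using memI(4) unfolding verts_def by blast
  have card: "card ?I = Suc (card (?I - {q}))" using memI(4) by (simp only: card_Suc_Diff1 finite_verts)
  have vu: "verts n ((s ''X'')(u := 1)) = ?A - {u}" "verts m ((s ''Y'')(q := 1)) = ?I - {q}"
    using verts_upd[of _ _ _ 0] by simp_all
  have ends': "(\<lambda>i. {((s ''tail'')(p := x)) i, ((s ''head'')(p := y)) i}) = (ends s)(p := {x, y})"
    by (simp add: fun_eq_iff)
  have Y0: "\<forall>i\<ge>m. ((s ''Y'')(q := 1)) i = 0" using coresD(6)[OF c] qm by simp
  have "cores n m K (upds Bypass s2)"
    unfolding cores_def s3(1-7) fr by (intro conjI cc[folded l'_def] coresD(2-5)[OF c] Y0)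
  moreover have "\<forall>v. ((s ''g'')(u := 0)) v \<noteq> 0 \<longrightarrow> ((s ''g'')(u := 0)) v = s ''g'' v" by simp
  moreover have "\<forall>j\<in>?I - {q}. j \<in> ?I \<and> (good ?A ?I (ends s) j \<longrightarrow>
      good (?A - {u}) (?I - {q}) ((ends s)(p := {x, y})) j)" using good_contract by blast
  ultimately show ?thesis
    unfolding contracted_def s3(1-7) fr vu ends' by (intro conjI card refl)
qed

lemma runs_Contract1:
  assumes "cores n m K s" "s ''i'' 0 < m" "bval Window s"
  shows "runs Contract1 s (\<lambda>t s'. t = 20 \<and> contracted n m K s s')"
  unfolding Contract1_def
proof (rule runs_Seq, rule runs_mono[OF runs_Choose[OF assms]], rule runs_Seq, rule runs_mono[OF runs_Bump],
    rule runs_block)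
  fix t t' :: nat and s1 s2 :: state
  assume 1: "t = 8 \<and> oriented n m s s1" and 2: "t' = 3 \<and> s2 = s1(''l'' :=
     (if s1 ''weight'' (s1 ''q'' 0) < s1 ''weight'' (s1 ''p'' 0)
      then (s1 ''l'')(s1 ''x'' 0 := max (s1 ''l'' (s1 ''x'' 0)) (s1 ''weight'' (s1 ''p'' 0)))
      else (s1 ''l'')(s1 ''y'' 0 := max (s1 ''l'' (s1 ''y'' 0)) (s1 ''weight'' (s1 ''q'' 0)))))"
  have "contracted n m K s (upds Bypass s2)"
    by (rule contracted_Bypass[OF assms(1) conjunct2[OF 1] conjunct2[OF 2]])
  then show "t + (t' + Suc (length Bypass)) = 20 \<and> contracted n m K s (upds Bypass s2)"
    using 1 2 unfolding Bypass_def by simp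
qed

lemma runs_Contract:
  assumes c: "cores n m K s" and g: "\<forall>v. s ''g'' v \<noteq> 1"
  shows "runs Contract s (\<lambda>t s'. t \<le> 24 * m + 2 \<and> cores n m K s' \<and>
    (18 * card (verts n (s' ''X'')) \<le> 17 * card (verts m (s' ''Y'')) \<or>
     card (verts n (s' ''X'')) \<le> 4 \<and> card (verts m (s' ''Y'')) \<le> 4))"
proof -
  define D where "D s = card (verts m (s ''Y''))" for s :: state
  define gd where "gd s j \<longleftrightarrow> (j \<in> verts m (s ''Y'') \<longrightarrow>
    good (verts n (s ''X'')) (verts m (s ''Y'')) (ends s) j)" for s :: state and j
  \<comment> \<open>A contraction deletes one edge and takes 20 steps plus a test. Three more per
    edge visited: the failing test of the inner loop and two for the outer loop.\<close>
  define P where "P i p s \<longleftrightarrow> i \<le> m \<and> p = 21 * D s + 3 * (m - i) \<and> s ''i'' 0 = i \<and> cores n m K s \<and>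
    (\<forall>v. s ''g'' v \<noteq> 1) \<and> (\<forall>j<i. gd s j)" for i p s
  have D: "D s \<le> m" unfolding D_def by (rule card_verts_le)
  show ?thesis
    unfolding Contract_def
  proof (rule runs_for_loop[where P = P and p = "21 * D s + 3 * m" and N = m])
    show "P 0 (21 * D s + 3 * m) (s(''i'' := (s ''i'')(0 := 0)))"
      using c g unfolding P_def D_def cores_def by simp
    show "s' ''i'' 0 = i \<and> s' ''m'' 0 = m \<and> i \<le> m" if "P i p s'" for i p s'
      using that coresD(3) unfolding P_def by blast
  next
    fix i p s assume P: "P i p s" and i: "i < m"
    define Q where "Q s' p' \<longleftrightarrow> cores n m K s' \<and> (\<forall>v. s' ''g'' v \<noteq> 1) \<and> s' ''i'' 0 = i \<and> p' = 21 * D s' \<and>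
      (\<forall>j<i. gd s' j)" for s' p'
    have W: "runs (While Window Contract1) s
        (\<lambda>t s'. \<exists>p'. Q s' p' \<and> \<not> bval Window s' \<and> t + p' \<le> Suc (21 * D s))"
    proof (rule runs_While[where P = Q])
      fix s p assume Q: "Q s p" and b: "bval Window s"
      have c: "cores n m K s" and im: "s ''i'' 0 < m" using Q i unfolding Q_def by auto
      show "runs Contract1 s (\<lambda>t s'. \<exists>p'. Q s' p' \<and> Suc t + p' \<le> p)"
      proof (rule runs_mono[OF runs_Contract1[OF c im b]])
        fix t :: nat and s' assume *: "t = 20 \<and> contracted n m K s s'"
        then have "\<forall>v. s' ''g'' v \<noteq> 1" "\<forall>j<i. gd s' j"
          using Q unfolding Q_def contracted_def gd_def by (metis one_neq_zero, blast)
        then have "Q s' (21 * D s')" using * Q unfolding Q_def contracted_def by simp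
        moreover have "Suc t + 21 * D s' \<le> p" using * Q unfolding Q_def contracted_def D_def by simp
        ultimately show "\<exists>p'. Q s' p' \<and> Suc t + p' \<le> p" by blast
      qed
    next
      show "Q s (21 * D s)" using P unfolding P_def Q_def by simp
    qed
    show "runs (While Window Contract1) s
        (\<lambda>t s'. \<exists>p'. P (Suc i) p' (s'(''i'' := (s' ''i'')(0 := Suc (s' ''i'' 0)))) \<and> t + p' + 2 \<le> p)"
    proof (rule runs_mono[OF W])
      fix t s' assume "\<exists>p'. Q s' p' \<and> \<not> bval Window s' \<and> t + p' \<le> Suc (21 * D s)"
      then have Q: "Q s' (21 * D s')" "\<not> bval Window s'" "t + 21 * D s' \<le> Suc (21 * D s)"
        unfolding Q_def by auto
      have c': "cores n m K s'" and i': "s' ''i'' 0 = i" using Q(1) unfolding Q_def by auto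
      have "gd s' i"
        using incidence.not_window_good[OF coresD(7)[OF c'], of i] Q(2)
        unfolding gd_def bval_Window i' verts_def by blast
      then have "P (Suc i) (21 * D s' + 3 * (m - Suc i)) (s'(''i'' := (s' ''i'')(0 := Suc (s' ''i'' 0))))"
        using Q(1) i unfolding Q_def P_def cores_def D_def gd_def by (simp add: less_Suc_eq)
      moreover have "t + (21 * D s' + 3 * (m - Suc i)) + 2 \<le> p"
        using P i Q(3) unfolding P_def by simp
      ultimately show "\<exists>p'. P (Suc i) p' (s'(''i'' := (s' ''i'')(0 := Suc (s' ''i'' 0)))) \<and> t + p' + 2 \<le> p"
        by blast
    qed
  next
    fix t s' p' assume P: "P m p' s'" and t: "t + p' \<le> 21 * D s + 3 * m + 2"
    have c': "cores n m K s'" using P unfolding P_def by blast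
    interpret incidence "verts n (s' ''X'')" "verts m (s' ''Y'')" "s' ''tail''" "s' ''head''" "s' ''g''" "s' ''e''"
      by (rule coresD(7)[OF c'])
    have "good (verts n (s' ''X'')) (verts m (s' ''Y'')) (ends s') j" if "j \<in> verts m (s' ''Y'')" for j
      using P that unfolding P_def gd_def verts_def by blast
    then show "t \<le> 24 * m + 2 \<and> cores n m K s' \<and>
        (18 * card (verts n (s' ''X'')) \<le> 17 * card (verts m (s' ''Y'')) \<or>
         card (verts n (s' ''X'')) \<le> 4 \<and> card (verts m (s' ''Y'')) \<le> 4)"
      using good_bounds[OF G] P t D c' deg unfolding P_def by simp
  qed
qed

section \<open>Attaching pendants and compacting the arrays\<close>

lemma bij_betw_upd:
  assumes "bij_betw f A B" "a \<notin> A" "b \<notin> B"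
  shows "bij_betw (f(a := b)) (insert a A) (insert b B)"
proof -
  have "bij_betw (f(a := b)) A B" using assms(1,2) by (subst bij_betw_cong[of A _ f]) auto
  then show ?thesis using notIn_Un_bij_betw3[of a A "f(a := b)" B] assms(2,3) by simp
qed

lemma verts_Suc: "verts (Suc i) X = (if X i = 0 then insert i (verts i X) else verts i X)"
  unfolding verts_def by (auto simp: less_Suc_eq)

text \<open>The vertices below \<open>i\<close> have been treated. The lower bounds still to be
  replaced sum up to at most \<open>d\<close>, so \<open>d\<close> can pay for the remaining
  pendants.\<close>

definition pendants_added :: "nat \<Rightarrow> nat \<Rightarrow> nat \<Rightarrow> nat \<Rightarrow> state \<Rightarrow> state \<Rightarrow> bool" where
  "pendants_added n m K i s s' \<longleftrightarrow>
     (let B = verts i (s ''X''); A = verts n (s ''X'') \<union> (+) n ` B; c = card B;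
          I = verts m (s ''Y'') \<union> {m..<m + c} in
      s' ''n'' 0 = n \<and> s' ''m'' 0 = m + c \<and> s' ''k'' 0 = 2 * c \<and> s' ''j'' 0 = 0 \<and>
      s' ''X'' = s ''X'' \<and> s' ''Y'' = s ''Y'' \<and>
      mgraph A I (ends s') \<and> optval A I (ends s') (s' ''weight'') (s' ''l'') + s' ''d'' 0 = K \<and>
      (\<Sum>v\<in>verts n (s ''X''). s' ''l'' v) \<le> s' ''d'' 0 \<and> (\<forall>v\<in>B \<union> (+) n ` B. s' ''l'' v = 0) \<and>
      bij_betw (s' ''N'') (B \<union> (+) n ` B) {..<2 * c})"

lemma pendants_added_step:
  assumes p: "pendants_added n m K i s s'" and i: "i < n" "s ''X'' i = 0"
    and s'': "s'' ''n'' = s' ''n''" "s'' ''m'' 0 = Suc (s' ''m'' 0)" "s'' ''k'' 0 = s' ''k'' 0 + 2"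
      "s'' ''j'' = s' ''j''" "s'' ''X'' = s' ''X''" "s'' ''Y'' = s' ''Y''"
      "s'' ''tail'' = (s' ''tail'')(s' ''m'' 0 := i)" "s'' ''head'' = (s' ''head'')(s' ''m'' 0 := n + i)"
      "s'' ''weight'' = (s' ''weight'')(s' ''m'' 0 := s' ''l'' i)"
      "s'' ''d'' 0 = s' ''d'' 0 - s' ''l'' i" "s'' ''l'' = (s' ''l'')(i := 0, n + i := 0)"
      "s'' ''N'' = (s' ''N'')(i := s' ''k'' 0, n + i := Suc (s' ''k'' 0))"
  shows "pendants_added n m K (Suc i) s s''"
proof -
  let ?V = "verts n (s ''X'')"
  define B where "B = verts i (s ''X'')"
  define c where "c = card B"
  define A where "A = ?V \<union> (+) n ` B"
  define I where "I = verts m (s ''Y'') \<union> {m..<m + c}"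
  have h: "s' ''n'' 0 = n" "s' ''m'' 0 = m + c" "s' ''k'' 0 = 2 * c" "s' ''j'' 0 = 0"
      "s' ''X'' = s ''X''" "s' ''Y'' = s ''Y''"
      "mgraph A I (ends s')" "optval A I (ends s') (s' ''weight'') (s' ''l'') + s' ''d'' 0 = K"
      "(\<Sum>v\<in>?V. s' ''l'' v) \<le> s' ''d'' 0" "\<forall>v\<in>B \<union> (+) n ` B. s' ''l'' v = 0"
      "bij_betw (s' ''N'') (B \<union> (+) n ` B) {..<2 * c}"
    using p unfolding pendants_added_def Let_def B_def[symmetric] c_def[symmetric] A_def[symmetric] I_def[symmetric]
    by - (elim conjE, assumption)+
  have Bi: "v < i" if "v \<in> B" for v using that unfolding B_def verts_def by simp
  have iB: "i \<notin> B" "i \<notin> (+) n ` B" "n + i \<notin> B" "n + i \<notin> (+) n ` B" using Bi i(1) by force+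
  have iV: "i \<in> ?V" "n + i \<notin> ?V" using i unfolding verts_def by auto
  have finB: "finite B" unfolding B_def by simp
  have B': "verts (Suc i) (s ''X'') = insert i B" unfolding verts_Suc B_def using i(2) by simp
  have c': "card (insert i B) = Suc c" unfolding c_def using iB(1) finB by simp
  have A': "?V \<union> (+) n ` insert i B = insert (n + i) A" unfolding A_def by auto
  have I': "verts m (s ''Y'') \<union> {m..<m + Suc c} = insert (m + c) I" unfolding I_def by auto
  have mI: "m + c \<notin> I" unfolding I_def verts_def by auto
  have xA: "n + i \<notin> A" "i \<in> A" using iV iB unfolding A_def by auto
  have ends'': "ends s'' = (ends s')(m + c := {i, n + i})" unfolding s'' h by (simp add: fun_eq_iff)
  note pen = optval_pendant(1)[OF h(7) xA mI]
    optval_pendant(2)[OF h(7) xA mI, where l = "s' ''l''" and w = "s' ''weight''"]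
  \<comment> \<open>Together with the bound of the sum by \<open>d\<close>, this makes the truncated
    subtraction of \<open>l i\<close> from \<open>d\<close> exact.\<close>
  have li: "s' ''l'' i \<le> (\<Sum>v\<in>?V. s' ''l'' v)" by (rule member_le_sum) (use iV in auto)
  have K: "optval (insert (n + i) A) (insert (m + c) I) (ends s'') (s'' ''weight'') (s'' ''l'') + s'' ''d'' 0 = K"
    using pen(2) h(8,9) li unfolding ends'' s''(9-11) h(2) by linarith
  have "(\<Sum>v\<in>?V. s'' ''l'' v) + s' ''l'' i \<le> (\<Sum>v\<in>?V. s' ''l'' v)"
  proof -
    have "(\<Sum>v\<in>?V. s' ''l'' v) = s' ''l'' i + (\<Sum>v\<in>?V - {i}. s' ''l'' v)"
      using iV(1) by (simp only: sum.remove finite_verts)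
    moreover have "(\<Sum>v\<in>?V. s'' ''l'' v) = s'' ''l'' i + (\<Sum>v\<in>?V - {i}. s'' ''l'' v)"
      using iV(1) by (simp only: sum.remove finite_verts)
    moreover have "(\<Sum>v\<in>?V - {i}. s'' ''l'' v) = (\<Sum>v\<in>?V - {i}. s' ''l'' v)"
      by (rule sum.cong) (use iV(2) in \<open>auto simp: s''\<close>)
    moreover have "s'' ''l'' i = 0" by (simp add: s'')
    ultimately show ?thesis by linarith
  qed
  then have sum: "(\<Sum>v\<in>?V. s'' ''l'' v) \<le> s'' ''d'' 0" unfolding s''(10) using h(9) by linarith
  have zero: "\<forall>v\<in>insert i B \<union> (+) n ` insert i B. s'' ''l'' v = 0" using h(10) unfolding s'' by auto
  have N: "insert i B \<union> (+) n ` insert i B = insert (n + i) (insert i (B \<union> (+) n ` B))"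
    "{..<2 * Suc c} = insert (Suc (2 * c)) (insert (2 * c) {..<2 * c})" by auto
  have bij: "bij_betw (s'' ''N'') (insert i B \<union> (+) n ` insert i B) {..<2 * Suc c}"
    unfolding N s'' h by (intro bij_betw_upd h(11)) (use iB i in auto)
  have "mgraph (insert (n + i) A) (insert (m + c) I) (ends s'')" unfolding ends'' by (rule pen(1))
  then show ?thesis
    unfolding pendants_added_def Let_def B' c' A' I' using K sum zero bij by (simp add: s'' h)
qed

lemma runs_Pendants:
  assumes c: "cores n m K s"
  shows "runs Pendants s (\<lambda>t s'. t \<le> 14 * n + 2 \<and> pendants_added n m K n s s')"
proof -
  \<comment> \<open>Fourteen steps per vertex: ten stores, the \<open>Skip\<close> of the block, the
    test, and two for the loop.\<close>
  define P where "P i p s' \<longleftrightarrow> i \<le> n \<and> p = 14 * (n - i) \<and> s' ''i'' 0 = i \<and> pendants_added n m K i s s'" for i p s'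
  show ?thesis
    unfolding Pendants_def
  proof (rule runs_for_loop[where P = P and p = "14 * n" and N = n])
    have "verts 0 X = {}" for X unfolding verts_def by simp
    then show "P 0 (14 * n) (s(''i'' := (s ''i'')(0 := 0)))"
      using c incidence.G[OF coresD(7)[OF c]]
      unfolding P_def pendants_added_def cores_def core_def by (simp add: bij_betw_def)
    show "s' ''i'' 0 = i \<and> s' ''n'' 0 = n \<and> i \<le> n" if "P i p s'" for i p s'
      using that unfolding P_def pendants_added_def Let_def by blast
    show "t \<le> 14 * n + 2 \<and> pendants_added n m K n s s'" if "P n p' s'" "t + p' \<le> 14 * n + 2" for t s' p'
      using that unfolding P_def by simp
  next
    fix i p s' assume P: "P i p s'" and i: "i < n"
    let ?s = "\<lambda>s. s(''i'' := (s ''i'')(0 := Suc (s ''i'' 0)))"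
    have p: "pendants_added n m K i s s'" and i0: "s' ''i'' 0 = i" using P unfolding P_def by auto
    have X: "s' ''X'' = s ''X''" "s' ''n'' 0 = n" using p unfolding pendants_added_def Let_def by blast+
    show "runs (Cond (Eq (Cell ''X'' EI) (Const 0)) (block [(''tail'', Scal ''m'', EI),
          (''head'', Scal ''m'', Plus (Scal ''n'') EI), (''weight'', Scal ''m'', Cell ''l'' EI),
          (''d'', Const 0, Minus (Scal ''d'') (Cell ''l'' EI)), (''l'', EI, Const 0),
          (''l'', Plus (Scal ''n'') EI, Const 0), (''N'', EI, Scal ''k''),
          (''N'', Plus (Scal ''n'') EI, Plus (Scal ''k'') (Const 1)),
          (''k'', Const 0, Plus (Scal ''k'') (Const 2)), (''m'', Const 0, Plus (Scal ''m'') (Const 1))]) Skip) s'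
        (\<lambda>t s''. \<exists>p'. P (Suc i) p' (?s s'') \<and> t + p' + 2 \<le> p)"
    proof (rule runs_Cond)
      assume "bval (Eq (Cell ''X'' EI) (Const 0)) s'"
      then have Xi: "s ''X'' i = 0" using i0 X by simp
      show "runs (block [(''tail'', Scal ''m'', EI),
          (''head'', Scal ''m'', Plus (Scal ''n'') EI), (''weight'', Scal ''m'', Cell ''l'' EI),
          (''d'', Const 0, Minus (Scal ''d'') (Cell ''l'' EI)), (''l'', EI, Const 0),
          (''l'', Plus (Scal ''n'') EI, Const 0), (''N'', EI, Scal ''k''),
          (''N'', Plus (Scal ''n'') EI, Plus (Scal ''k'') (Const 1)),
          (''k'', Const 0, Plus (Scal ''k'') (Const 2)), (''m'', Const 0, Plus (Scal ''m'') (Const 1))]) s'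
        (\<lambda>t s''. \<exists>p'. P (Suc i) p' (?s s'') \<and> Suc t + p' + 2 \<le> p)"
      proof (rule runs_block, rule exI[of _ "14 * (n - Suc i)"], rule conjI)
        show "P (Suc i) (14 * (n - Suc i)) (?s (upds [(''tail'', Scal ''m'', EI),
          (''head'', Scal ''m'', Plus (Scal ''n'') EI), (''weight'', Scal ''m'', Cell ''l'' EI),
          (''d'', Const 0, Minus (Scal ''d'') (Cell ''l'' EI)), (''l'', EI, Const 0),
          (''l'', Plus (Scal ''n'') EI, Const 0), (''N'', EI, Scal ''k''),
          (''N'', Plus (Scal ''n'') EI, Plus (Scal ''k'') (Const 1)),
          (''k'', Const 0, Plus (Scal ''k'') (Const 2)), (''m'', Const 0, Plus (Scal ''m'') (Const 1))] s'))"
          unfolding P_def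
        proof (intro conjI)
          show "pendants_added n m K (Suc i) s (?s (upds [(''tail'', Scal ''m'', EI),
          (''head'', Scal ''m'', Plus (Scal ''n'') EI), (''weight'', Scal ''m'', Cell ''l'' EI),
          (''d'', Const 0, Minus (Scal ''d'') (Cell ''l'' EI)), (''l'', EI, Const 0),
          (''l'', Plus (Scal ''n'') EI, Const 0), (''N'', EI, Scal ''k''),
          (''N'', Plus (Scal ''n'') EI, Plus (Scal ''k'') (Const 1)),
          (''k'', Const 0, Plus (Scal ''k'') (Const 2)), (''m'', Const 0, Plus (Scal ''m'') (Const 1))] s'))"
            by (rule pendants_added_step[OF p i Xi]) (simp_all add: i0 X(2))
        qed (use i i0 in auto)
      qed (use P i in \<open>simp add: P_def\<close>)
    next
      assume "\<not> bval (Eq (Cell ''X'' EI) (Const 0)) s'"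
      then have "verts (Suc i) (s ''X'') = verts i (s ''X'')" using i0 X by (simp add: verts_Suc)
      then have "pendants_added n m K (Suc i) s (?s s')"
        using p unfolding pendants_added_def by simp
      then have "P (Suc i) (14 * (n - Suc i)) (?s s')" using i i0 unfolding P_def by simp
      then show "runs Skip s' (\<lambda>t s''. \<exists>p'. P (Suc i) p' (?s s'') \<and> Suc t + p' + 2 \<le> p)"
        using P i unfolding P_def[of i p] by (intro runs_Skip exI[of _ "14 * (n - Suc i)"]) simp
    qed
  qed
qed

text \<open>The map \<open>sg\<close> gives the old position of a kept edge. Copying in place is
  safe because the write position never passes the read position \<open>i\<close>, from which on the
  arrays are still the old ones.\<close>

definition compacted :: "nat \<Rightarrow> state \<Rightarrow> state \<Rightarrow> bool" where
  "compacted i s s' \<longleftrightarrow> (\<exists>sg. bij_betw sg {..<s' ''j'' 0} (verts i (s ''Y'')) \<and>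
     (\<forall>a<s' ''j'' 0. s' ''tail'' a = s ''N'' (s ''tail'' (sg a)) \<and> s' ''head'' a = s ''N'' (s ''head'' (sg a)) \<and>
        s' ''weight'' a = s ''weight'' (sg a))) \<and> s' ''j'' 0 \<le> i \<and>
     (\<forall>a\<ge>i. s' ''tail'' a = s ''tail'' a \<and> s' ''head'' a = s ''head'' a \<and> s' ''weight'' a = s ''weight'' a) \<and>
     s' ''N'' = s ''N'' \<and> s' ''Y'' = s ''Y'' \<and> s' ''d'' = s ''d'' \<and> s' ''k'' = s ''k'' \<and> s' ''m'' = s ''m''"

lemma compacted_step:
  assumes c: "compacted i s s'" and i: "s ''Y'' i = 0"
    and s'': "s'' ''tail'' = (s' ''tail'')(s' ''j'' 0 := s' ''N'' (s' ''tail'' i))"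
      "s'' ''head'' = (s' ''head'')(s' ''j'' 0 := s' ''N'' (s' ''head'' i))"
      "s'' ''weight'' = (s' ''weight'')(s' ''j'' 0 := s' ''weight'' i)" "s'' ''j'' 0 = Suc (s' ''j'' 0)"
      "s'' ''N'' = s' ''N''" "s'' ''Y'' = s' ''Y''" "s'' ''d'' = s' ''d''" "s'' ''k'' = s' ''k''" "s'' ''m'' = s' ''m''"
  shows "compacted (Suc i) s s''"
proof -
  define j where "j = s' ''j'' 0"
  obtain sg where sg: "bij_betw sg {..<j} (verts i (s ''Y''))"
    "\<And>a. a < j \<Longrightarrow> s' ''tail'' a = s ''N'' (s ''tail'' (sg a)) \<and> s' ''head'' a = s ''N'' (s ''head'' (sg a)) \<and>
        s' ''weight'' a = s ''weight'' (sg a)"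
    and h: "j \<le> i" "\<And>a. a \<ge> i \<Longrightarrow> s' ''tail'' a = s ''tail'' a \<and> s' ''head'' a = s ''head'' a \<and> s' ''weight'' a = s ''weight'' a"
     "s' ''N'' = s ''N''" "s' ''Y'' = s ''Y''" "s' ''d'' = s ''d''" "s' ''k'' = s ''k''" "s' ''m'' = s ''m''"
    using c unfolding compacted_def j_def[symmetric] by blast
  have "i \<notin> verts i (s ''Y'')" unfolding verts_def by simp
  then have "bij_betw (sg(j := i)) {..<Suc j} (verts (Suc i) (s ''Y''))"
    using bij_betw_upd[OF sg(1), of j i] i unfolding verts_Suc lessThan_Suc by simp
  moreover have "s'' ''tail'' a = s ''N'' (s ''tail'' ((sg(j := i)) a)) \<and>
      s'' ''head'' a = s ''N'' (s ''head'' ((sg(j := i)) a)) \<and>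
      s'' ''weight'' a = s ''weight'' ((sg(j := i)) a)" if "a < Suc j" for a
    using that sg(2)[of a] h(2)[of i] unfolding s'' j_def[symmetric] h(3) by (cases "a = j") auto
  moreover have "s'' ''tail'' a = s ''tail'' a \<and> s'' ''head'' a = s ''head'' a \<and> s'' ''weight'' a = s ''weight'' a"
    if "a \<ge> Suc i" for a using that h(1) h(2)[of a] unfolding s'' j_def[symmetric] by auto
  ultimately show ?thesis
    unfolding compacted_def s''(4-) j_def[symmetric] h(3-) using h(1) by (intro conjI exI[of _ "sg(j := i)"]) auto
qed

lemma runs_Compact:
  assumes j: "s ''j'' 0 = 0" and m: "s ''m'' 0 = m"
  shows "runs Compact s (\<lambda>t s'. t \<le> 8 * m + 2 \<and> compacted m s s')"
proof -
  \<comment> \<open>Eight steps per edge: four stores, the \<open>Skip\<close> of the block, the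
    test, and two for the loop.\<close>
  define P where "P i p s' \<longleftrightarrow> i \<le> m \<and> p = 8 * (m - i) \<and> s' ''i'' 0 = i \<and> compacted i s s'" for i p s'
  let ?b = "[(''tail'', Scal ''j'', Cell ''N'' ET), (''head'', Scal ''j'', Cell ''N'' EH),
    (''weight'', Scal ''j'', Cell ''weight'' EI), (''j'', Const 0, Plus (Scal ''j'') (Const 1))]"
  show ?thesis
    unfolding Compact_def
  proof (rule runs_for_loop[where P = P and p = "8 * m" and N = m])
    have "verts 0 X = {}" for X unfolding verts_def by simp
    then show "P 0 (8 * m) (s(''i'' := (s ''i'')(0 := 0)))"
      using j unfolding P_def compacted_def by (simp add: bij_betw_def)
    show "s' ''i'' 0 = i \<and> s' ''m'' 0 = m \<and> i \<le> m" if "P i p s'" for i p s'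
      using that m unfolding P_def compacted_def by simp
    show "t \<le> 8 * m + 2 \<and> compacted m s s'" if "P m p' s'" "t + p' \<le> 8 * m + 2" for t s' p'
      using that unfolding P_def by simp
  next
    fix i p s' assume P: "P i p s'" and i: "i < m"
    let ?s = "\<lambda>s. s(''i'' := (s ''i'')(0 := Suc (s ''i'' 0)))"
    have c: "compacted i s s'" and i0: "s' ''i'' 0 = i" using P unfolding P_def by auto
    have Y: "s' ''Y'' = s ''Y''" using c unfolding compacted_def by blast
    show "runs (Cond (Eq (Cell ''Y'' EI) (Const 0)) (block ?b) Skip) s'
        (\<lambda>t s''. \<exists>p'. P (Suc i) p' (?s s'') \<and> t + p' + 2 \<le> p)"
    proof (rule runs_Cond)
      assume "bval (Eq (Cell ''Y'' EI) (Const 0)) s'"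
      then have Yi: "s ''Y'' i = 0" using i0 Y by simp
      have "compacted (Suc i) s (?s (upds ?b s'))"
        by (rule compacted_step[OF c Yi]) (simp_all add: i0)
      then have "P (Suc i) (8 * (m - Suc i)) (?s (upds ?b s'))" using i i0 unfolding P_def by simp
      then show "runs (block ?b) s' (\<lambda>t s''. \<exists>p'. P (Suc i) p' (?s s'') \<and> Suc t + p' + 2 \<le> p)"
        using P i unfolding P_def[of i p] by (intro runs_block exI[of _ "8 * (m - Suc i)"] conjI) simp_all
    next
      assume "\<not> bval (Eq (Cell ''Y'' EI) (Const 0)) s'"
      then have "verts (Suc i) (s ''Y'') = verts i (s ''Y'')" using i0 Y by (simp add: verts_Suc)
      then have "compacted (Suc i) s (?s s')"
        using c unfolding compacted_def by simp
      then have "P (Suc i) (8 * (m - Suc i)) (?s s')" using i i0 unfolding P_def by simp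
      then show "runs Skip s' (\<lambda>t s''. \<exists>p'. P (Suc i) p' (?s s'') \<and> Suc t + p' + 2 \<le> p)"
        using P i unfolding P_def[of i p] by (intro runs_Skip exI[of _ "8 * (m - Suc i)"]) simp
    qed
  qed
qed

text \<open>Here \<open>c\<close> and \<open>k\<close> count the vertices and edges that are left before the pendants are attached.\<close>

definition kernel :: "nat \<Rightarrow> nat \<Rightarrow> nat \<Rightarrow> state \<Rightarrow> bool" where
  "kernel K c k s \<longleftrightarrow> (\<exists>E w. stores_instance s {..<2 * c} E w \<and> minpsc_graph {..<2 * c} E \<and>
     card E = k + c \<and> K = opt {..<2 * c} E w + s ''d'' 0)"

lemma runs_Finish:
  assumes p: "pendants_added n m K n s s1" and c: "compacted (s1 ''m'' 0) s1 s2"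
    and Y: "\<forall>i\<ge>m. s ''Y'' i = 0"
  shows "runs Finish s2 (\<lambda>t s'. t = 3 \<and> kernel K (card (verts n (s ''X''))) (card (verts m (s ''Y''))) s')"
  unfolding Finish_def
proof (rule runs_block)
  let ?s' = "upds [(''m'', Const 0, Scal ''j''), (''n'', Const 0, Scal ''k'')] s2"
  define B where "B = verts n (s ''X'')"
  define cc where "cc = card B"
  define A where "A = B \<union> (+) n ` B"
  define I where "I = verts m (s ''Y'') \<union> {m..<m + cc}"
  have h: "s1 ''m'' 0 = m + cc" "s1 ''k'' 0 = 2 * cc" "s1 ''Y'' = s ''Y''"
      "mgraph A I (ends s1)" "optval A I (ends s1) (s1 ''weight'') (s1 ''l'') + s1 ''d'' 0 = K"
      "\<forall>v\<in>A. s1 ''l'' v = 0" "bij_betw (s1 ''N'') A {..<2 * cc}"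
    using p unfolding pendants_added_def Let_def B_def[symmetric] cc_def[symmetric] A_def[symmetric] I_def[symmetric]
    by - (elim conjE, assumption)+
  define j where "j = s2 ''j'' 0"
  \<comment> \<open>The appended edges lie from \<open>m\<close> on, where \<open>Y\<close> carries
    no marks, so all of them are kept.\<close>
  have I_eq: "verts (m + cc) (s ''Y'') = I" unfolding I_def verts_def using Y by auto
  obtain sg where sg: "bij_betw sg {..<j} I"
    "\<And>a. a < j \<Longrightarrow> s2 ''tail'' a = s1 ''N'' (s1 ''tail'' (sg a)) \<and> s2 ''head'' a = s1 ''N'' (s1 ''head'' (sg a)) \<and>
        s2 ''weight'' a = s1 ''weight'' (sg a)"
    and s2: "s2 ''d'' = s1 ''d''" "s2 ''k'' = s1 ''k''"
    using c unfolding compacted_def h(1,3) j_def[symmetric] I_eq by (elim conjE exE) blast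
  interpret relabeling A I "ends s1" "s1 ''weight''" "s1 ''N''" "{..<j}" sg "ends s2" "s2 ''weight''"
    by unfold_locales (use h(4) bij_betw_imp_inj_on[OF h(7)] sg in auto)
  have NA: "s1 ''N'' ` A = {..<2 * cc}" by (rule bij_betw_imp_surj_on[OF h(7)])
  note g = mgraph_relabel[unfolded NA] and o = optval_relabel[unfolded NA]
  define E where "E = ends s2 ` {..<j}"
  \<comment> \<open>Weights stored by position become a function on edges, since no edge occurs at
    two positions.\<close>
  define W where "W e = s2 ''weight'' (inv_into {..<j} (ends s2) e)" for e
  have bij: "bij_betw (ends s2) {..<j} E" using mgraphD(5)[OF g] unfolding E_def by (rule inj_on_imp_bij_betw)
  have W: "W (ends s2 a) = s2 ''weight'' a" if "a < j" for a
    using inv_into_f_f[OF mgraphD(5)[OF g], of a] that unfolding W_def by simp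
  have mp: "minpsc_graph {..<2 * cc} E" unfolding E_def by (rule instance_of_mgraph[OF g])
  have "opt {..<2 * cc} E W = optval {..<2 * cc} {..<j} (ends s2) (s2 ''weight'') (\<lambda>_. 0)"
    by (rule opt_eq_optval[OF mp _ bij]) (use W in auto)
  also have "\<dots> = optval A I (ends s1) (s1 ''weight'') (s1 ''l'')"
    unfolding o by (rule optval_cong) (use h(6) in auto)
  finally have K: "K = opt {..<2 * cc} E W + ?s' ''d'' 0" using h(5) s2(1) by simp
  have st: "stores_instance ?s' {..<2 * cc} E W"
    unfolding stores_instance_def using bij W h(2) s2(2) by (simp add: j_def[symmetric])
  have "card E = j" using bij_betw_same_card[OF bij] by simp
  moreover have "card I = j" using bij_betw_same_card[OF sg(1)] by simp
  moreover have "card I = card (verts m (s ''Y'')) + cc"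
    unfolding I_def by (subst card_Un_disjoint) (auto simp: verts_def)
  ultimately have "card E = card (verts m (s ''Y'')) + cc" by simp
  then have "kernel K cc (card (verts m (s ''Y''))) ?s'"
    unfolding kernel_def using K st mp by blast
  then show "Suc (length [(''m'', Const 0, Scal ''j''), (''n'', Const 0, Scal ''k'')]) = 3 \<and>
      kernel K (card (verts n (s ''X''))) (card (verts m (s ''Y''))) ?s'"
    unfolding cc_def B_def by simp
qed

section \<open>The whole program\<close>

lemma runs_Kernelize:
  assumes V: "minpsc_graph V E" and s: "initial_state s V E w"
  defines "n \<equiv> s ''n'' 0" and "m \<equiv> s ''m'' 0"
  shows "runs Kernelize s (\<lambda>t s'. t \<le> 52 * m + 26 * n + 13 \<and>
    (\<exists>c k. kernel (opt V E w) c k s' \<and> k + n = c + m \<and> (18 * c \<le> 17 * k \<or> c \<le> 4 \<and> k \<le> 4)))"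
proof -
  let ?K = "opt V E w"
  have 1: "runs Degrees s (\<lambda>t s'. t \<le> 7 * m + 2 \<and> cores n m ?K s')"
    unfolding n_def m_def by (rule runs_Degrees[OF V s])
  show ?thesis
    unfolding Kernelize_def
  proof (rule runs_Seq, rule runs_mono[OF 1])
    fix t1 s1 assume 1: "t1 \<le> 7 * m + 2 \<and> cores n m ?K s1"
    show "runs (Seq Peel (Seq Contract (Seq Pendants (Seq Compact Finish)))) s1
      (\<lambda>t s'. t1 + t \<le> 52 * m + 26 * n + 13 \<and>
        (\<exists>c k. kernel (opt V E w) c k s' \<and> k + n = c + m \<and> (18 * c \<le> 17 * k \<or> c \<le> 4 \<and> k \<le> 4)))"
    proof (rule runs_Seq, rule runs_mono[OF runs_Peel[OF conjunct2[OF 1]]])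
      fix t2 s2 assume 2: "t2 \<le> 13 * m + 4 * n + 2 \<and> cores n m ?K s2 \<and> (\<forall>v. s2 ''g'' v \<noteq> 1)"
      then have c2: "cores n m ?K s2" and g2: "\<forall>v. s2 ''g'' v \<noteq> 1" by auto
      show "runs (Seq Contract (Seq Pendants (Seq Compact Finish))) s2
        (\<lambda>t s'. t1 + (t2 + t) \<le> 52 * m + 26 * n + 13 \<and>
          (\<exists>c k. kernel (opt V E w) c k s' \<and> k + n = c + m \<and> (18 * c \<le> 17 * k \<or> c \<le> 4 \<and> k \<le> 4)))"
      proof (rule runs_Seq, rule runs_mono[OF runs_Contract[OF c2 g2]])
        fix t3 s3
        assume 3: "t3 \<le> 24 * m + 2 \<and> cores n m ?K s3 \<and>
          (18 * card (verts n (s3 ''X'')) \<le> 17 * card (verts m (s3 ''Y'')) \<or>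
           card (verts n (s3 ''X'')) \<le> 4 \<and> card (verts m (s3 ''Y'')) \<le> 4)"
        then have c3: "cores n m ?K s3" by blast
        let ?c = "card (verts n (s3 ''X''))" and ?k = "card (verts m (s3 ''Y''))"
        have kn: "?k + n = ?c + m" using coresD(1)[OF c3] unfolding core_def by blast
        have cn: "?c \<le> n" by (rule card_verts_le)
        show "runs (Seq Pendants (Seq Compact Finish)) s3
          (\<lambda>t s'. t1 + (t2 + (t3 + t)) \<le> 52 * m + 26 * n + 13 \<and>
            (\<exists>c k. kernel (opt V E w) c k s' \<and> k + n = c + m \<and> (18 * c \<le> 17 * k \<or> c \<le> 4 \<and> k \<le> 4)))"
        proof (rule runs_Seq, rule runs_mono[OF runs_Pendants[OF c3]])
          fix t4 s4 assume 4: "t4 \<le> 14 * n + 2 \<and> pendants_added n m ?K n s3 s4"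
          then have m4: "s4 ''m'' 0 = m + ?c" and j4: "s4 ''j'' 0 = 0"
            unfolding pendants_added_def Let_def by blast+
          show "runs (Seq Compact Finish) s4
            (\<lambda>t s'. t1 + (t2 + (t3 + (t4 + t))) \<le> 52 * m + 26 * n + 13 \<and>
              (\<exists>c k. kernel (opt V E w) c k s' \<and> k + n = c + m \<and> (18 * c \<le> 17 * k \<or> c \<le> 4 \<and> k \<le> 4)))"
          proof (rule runs_Seq, rule runs_mono[OF runs_Compact[of s4 "s4 ''m'' 0", OF j4 refl]])
            fix t5 s5 assume 5: "t5 \<le> 8 * s4 ''m'' 0 + 2 \<and> compacted (s4 ''m'' 0) s4 s5"
            show "runs Finish s5
              (\<lambda>t s'. t1 + (t2 + (t3 + (t4 + (t5 + t)))) \<le> 52 * m + 26 * n + 13 \<and>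
                (\<exists>c k. kernel (opt V E w) c k s' \<and> k + n = c + m \<and> (18 * c \<le> 17 * k \<or> c \<le> 4 \<and> k \<le> 4)))"
            proof (rule runs_mono[OF runs_Finish[OF conjunct2[OF 4] conjunct2[OF 5] coresD(6)[OF c3]]])
              fix t6 :: nat and s6 assume 6: "t6 = 3 \<and> kernel ?K ?c ?k s6"
              \<comment> \<open>The bounds of the phases add up; \<open>Compact\<close> runs over
                \<open>m + ?c\<close> edges, and \<open>?c \<le> n\<close>.\<close>
              have "t1 + (t2 + (t3 + (t4 + (t5 + t6)))) \<le> 52 * m + 26 * n + 13"
                using 1 2 3 4 5 6 m4 cn by linarith
              then show "t1 + (t2 + (t3 + (t4 + (t5 + t6)))) \<le> 52 * m + 26 * n + 13 \<and>
                (\<exists>c k. kernel (opt V E w) c k s6 \<and> k + n = c + m \<and> (18 * c \<le> 17 * k \<or> c \<le> 4 \<and> k \<le> 4))"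
                using 3 6 kn by blast
            qed
          qed
        qed
      qed
    qed
  qed
qed

theorem theorem2:
  "\<exists>(p :: com) (c :: nat). \<forall>(V :: nat set) E w s.
     minpsc_graph V E \<and> initial_state s V E w \<longrightarrow>
     (\<exists>t s' (V' :: nat set) E' w' d.
        exec p s t s' \<and> t \<le> c * (card V + card E) \<and>
        stores_instance s' V' E' w' \<and> minpsc_graph V' E' \<and> s' ''d'' 0 = d \<and>
        opt V E w = opt V' E' w' + d \<and>
        (feedback_edge_number E \<ge> 1 \<longrightarrow>
           int (card V') \<le> 40 * int (feedback_edge_number E) - 26 \<and>
           int (card E') \<le> 41 * int (feedback_edge_number E) - 27))"
proof (rule exI[of _ Kernelize], rule exI[of _ 65], intro allI impI, elim conjE)
  fix V :: "nat set" and E w and s :: state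
  assume V: "minpsc_graph V E" and s: "initial_state s V E w"
  define n m g where "n = s ''n'' 0" and "m = s ''m'' 0" and "g = feedback_edge_number E"
  have st: "V = {..<n}" "bij_betw (ends s) {..<m} E"
    using s unfolding initial_state_def stores_instance_def n_def m_def by blast+
  have nm: "card V = n" "card E = m" using st(1) bij_betw_same_card[OF st(2)] by simp_all
  have "V \<noteq> {}" using V unfolding minpsc_graph_def connected_graph_def by blast
  then have n: "1 \<le> n" using st(1) by (cases n) auto
  obtain t s' c k where t: "exec Kernelize s t s'" "t \<le> 52 * m + 26 * n + 13"
    and ker: "kernel (opt V E w) c k s'" and ck: "k + n = c + m" "18 * c \<le> 17 * k \<or> c \<le> 4 \<and> k \<le> 4"
    using runs_Kernelize[OF V s] unfolding runs_def n_def m_def by blast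
  obtain E' w' where E': "stores_instance s' {..<2 * c} E' w'" "minpsc_graph {..<2 * c} E'" "card E' = k + c"
    "opt V E w = opt {..<2 * c} E' w' + s' ''d'' 0"
    using ker unfolding kernel_def by blast
  have g: "m < g + n" using feedback_edge_number_ge[OF V] unfolding nm g_def .
  \<comment> \<open>Since \<open>k - c = m - n \<le> g - 1\<close>, the first alternative gives
    \<open>c \<le> 17 * (g - 1)\<close> and \<open>k \<le> 18 * (g - 1)\<close>. In the second, both
    sizes are at most 8, while the bounds are at least 14 for positive \<open>g\<close>.\<close>
  have bounds: "int (card {..<2 * c}) \<le> 40 * int g - 26 \<and> int (card E') \<le> 41 * int g - 27" if "1 \<le> g"
    using ck g that unfolding E'(3) by auto
  \<comment> \<open>The constant 13 is absorbed by \<open>1 \<le> n\<close>.\<close>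
  have "52 * m + 26 * n + 13 \<le> 65 * (n + m)" using n by simp
  then have "t \<le> 65 * (card V + card E)" using t(2) unfolding nm by (rule order.trans[rotated])
  then show "\<exists>t s' V' E' w' d. exec Kernelize s t s' \<and> t \<le> 65 * (card V + card E) \<and>
      stores_instance s' V' E' w' \<and> minpsc_graph V' E' \<and> s' ''d'' 0 = d \<and>
      opt V E w = opt V' E' w' + d \<and>
      (1 \<le> feedback_edge_number E \<longrightarrow>
         int (card V') \<le> 40 * int (feedback_edge_number E) - 26 \<and>
         int (card E') \<le> 41 * int (feedback_edge_number E) - 27)"
    using t(1) E' bounds unfolding g_def by blast
qed

end
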